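(* Let $\mathcal{O}\subset\mathbb{R}^n$ be the closure of a bounded connected open subset of $\mathbb{R}^n$ with boundary of class $C^2$, such that $\mathbb{R}^n\setminus\mathcal{O}$ is connected. Let $k_0\in\mathbb{R}^n\setminus\mathcal{O}$, let $d:\overline{\mathbb{R}^n\setminus\mathcal{O}}\to[0,+\infty[$ be the (Euclidean) distance function from $k_0$ in the presence of the obstacle $\mathcal{O}$, and let $\Sigma(d)$ be its singular set. Denote by $\operatorname{co}\mathcal{O}$ the convex hull of $\mathcal{O}$. (i) Let $x_0\in\Sigma(d)\cap(\operatorname{co}\mathcal{O}\setminus\mathcal{O})$, with $x_0\ne k_0$. Then there exist $\sigma>0$ and a Lipschitz map $[0,\sigma[\ni t\mapsto x(t)\in\Sigma(d)$ such that $x(0)=x_0$ and $x(t)\ne x_0$ for every $t\in]0,\sigma[$. (ii) Let $x_0\in\Sigma(d)\setminus\operatorname{co}\mathcal{O}$, with $x_0\ne k_0$, and let $x(\cdot)$ be the solution of $$\dot x(t)\in D^+d(x(t))\ \text{ for a.e. } t\ge0,\qquad x(0)=x_0.$$ Then $x(t)\in\Sigma(d)$ for every $t\ge0$, $t\mapsto d(x(t))$ is a strictly increasing function (so that $t\mapsto x(t)$ is injective), and $\{x(t) : t\ge0\}$ is an unbounded set.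
   Context: Distance function (case $A\equiv I$): let $\Gamma$ be the set of all (locally) absolutely continuous curves $\gamma:[0,+\infty[\to\overline{\mathbb{R}^n\setminus\mathcal{O}}$ with $|\dot\gamma(t)|\le 1$ for a.e. $t\ge0$. For $x\in\overline{\mathbb{R}^n\setminus\mathcal{O}}$ let $\Gamma[x]=\{\gamma\in\Gamma : \gamma(0)=x\}$, and let $\tau(\gamma)=\inf\{t\ge0 : \gamma(t)=k_0\}\in[0,+\infty]$. Then $d(x)=\inf_{\gamma\in\Gamma[x]}\tau(\gamma)$. Reachable gradients: for $x\in\overline{\mathbb{R}^n\setminus\mathcal{O}}$, $D^*d(x)$ is the set of all $p\in\mathbb{R}^n$ for which there is a sequence $x_h\in\mathbb{R}^n\setminus\mathcal{O}$ of points of differentiability of $d$ with $x_h\to x$ and $Dd(x_h)\to p$. Singular set: $\Sigma(d)=\{x\in\overline{\mathbb{R}^n\setminus\mathcal{O}}\setminus\{k_0\} : D^*d(x)\text{ has at least two elements}\}$. Superdifferential: for a real function $u$ on an open set $\Omega$ and $x\in\Omega$, $$D^+u(x)=\Big\{p\in\mathbb{R}^n : \limsup_{\Omega\ni y\to x}\frac{u(y)-u(x)-\langle p,y-x\rangle}{|y-x|}\le0\Big\}.$$ Here it is used with $u=d$ and $\Omega=\mathbb{R}^n\setminus\mathcal{O}$. Solution of the inclusion: a Lipschitz continuous curve satisfying $x(0)=x_0$ and the inclusion for a.e. $t$. Since $d$ is locally semiconcave with linear modulus on $\mathbb{R}^n\setminus(\mathcal{O}\cup\{k_0\})$, the solution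 exists and is unique, and a priori is defined only until the first time it reaches the boundary of this open set; part of the assertion in (ii) is that it is defined for all $t\ge0$. *)

theory Defs
  imports "HOL-Analysis.Analysis"
begin

definition C2_on :: "(real ^ 'n \<Rightarrow> real) \<Rightarrow> (real ^ 'n) set \<Rightarrow> bool" where
  "C2_on \<phi> V \<longleftrightarrow>
     (\<exists>g H. (\<forall>x\<in>V. GDERIV \<phi> x :> g x \<and> (g has_derivative (\<lambda>h. H x *v h)) (at x)) \<and>
            continuous_on V (H :: real ^ 'n \<Rightarrow> real ^ 'n ^ 'n))"

(* Near every boundary point, U is the sublevel set of a C^2 function with nowhere vanishing
   gradient; in particular U lies locally on one side of its boundary. *)
definition C2_boundary :: "(real ^ 'n) set \<Rightarrow> bool" where
  "C2_boundary U \<longleftrightarrow>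
     (\<forall>p\<in>frontier U. \<exists>V \<phi>. open V \<and> p \<in> V \<and> C2_on \<phi> V \<and>
        (\<forall>x\<in>V. \<not> (GDERIV \<phi> x :> 0)) \<and> U \<inter> V = {x\<in>V. \<phi> x < 0})"

(* The classical epsilon-delta condition: the elements of a division are finitely many
   nonoverlapping compact intervals k = {Inf k..Sup k}. *)
definition abs_continuous_on_interval ::
    "real \<Rightarrow> real \<Rightarrow> (real \<Rightarrow> 'a::real_normed_vector) \<Rightarrow> bool" where
  "abs_continuous_on_interval a b \<gamma> \<longleftrightarrow>
     (\<forall>\<epsilon>>0. \<exists>\<delta>>0. \<forall>\<D>. \<D> division_of \<Union>\<D> \<and> \<Union>\<D> \<subseteq> {a..b} \<and> (\<Sum>k\<in>\<D>. Sup k - Inf k) < \<delta>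
        \<longrightarrow> (\<Sum>k\<in>\<D>. norm (\<gamma> (Sup k) - \<gamma> (Inf k))) < \<epsilon>)"

(* Curves on the half-line are total functions whose values at negative times are ignored. *)
definition admissible_curves :: "(real ^ 'n) set \<Rightarrow> (real \<Rightarrow> real ^ 'n) set" where
  "admissible_curves K =
     {\<gamma>. (\<forall>t\<ge>0. \<gamma> t \<in> closure (- K)) \<and>
         (\<forall>T\<ge>0. abs_continuous_on_interval 0 T \<gamma>) \<and>
         (AE t in lebesgue. 0 \<le> t \<longrightarrow>
            (\<exists>v. (\<gamma> has_vector_derivative v) (at t within {0..}) \<and> norm v \<le> 1))}"

(* The infimum of the empty set is \<infinity>. *)
definition arrival_time :: "'a \<Rightarrow> (real \<Rightarrow> 'a) \<Rightarrow> ereal" where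
  "arrival_time k0 \<gamma> = Inf {ereal t | t. 0 \<le> t \<and> \<gamma> t = k0}"

(* Meaningful on closure (- K); the infimum there is finite when - K is connected and the
   boundary of K is regular, so that real_of_ereal loses nothing. *)
definition obstacle_dist :: "(real ^ 'n) set \<Rightarrow> real ^ 'n \<Rightarrow> real ^ 'n \<Rightarrow> real" where
  "obstacle_dist K k0 x =
     real_of_ereal (INF \<gamma>\<in>{\<gamma>\<in>admissible_curves K. \<gamma> 0 = x}. arrival_time k0 \<gamma>)"

definition reachable_gradients ::
    "(real ^ 'n) set \<Rightarrow> (real ^ 'n \<Rightarrow> real) \<Rightarrow> real ^ 'n \<Rightarrow> (real ^ 'n) set" where
  "reachable_gradients \<Omega> u x =
     {p. \<exists>X P. (\<forall>h::nat. X h \<in> \<Omega> \<and> GDERIV u (X h) :> P h) \<and> X \<longlonglongrightarrow> x \<and> P \<longlonglongrightarrow> p}"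

definition singular_set :: "(real ^ 'n) set \<Rightarrow> real ^ 'n \<Rightarrow> (real ^ 'n) set" where
  "singular_set K k0 =
     {x \<in> closure (- K) - {k0}.
        \<exists>p q. p \<in> reachable_gradients (- K) (obstacle_dist K k0) x \<and>
              q \<in> reachable_gradients (- K) (obstacle_dist K k0) x \<and> p \<noteq> q}"

definition superdifferential ::
    "(real ^ 'n) set \<Rightarrow> (real ^ 'n \<Rightarrow> real) \<Rightarrow> real ^ 'n \<Rightarrow> (real ^ 'n) set" where
  "superdifferential \<Omega> u x =
     {p. Limsup (at x within \<Omega>) (\<lambda>y. ereal ((u y - u x - p \<bullet> (y - x)) / norm (y - x))) \<le> 0}"

(* Solutions of x' \<in> D^+ d(x) on the interval [0,T[, 0 < T \<le> \<infinity>, staying in the open set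
   - (K \<union> {k0}) on which d is locally semiconcave. *)
definition inclusion_solution ::
    "(real ^ 'n) set \<Rightarrow> real ^ 'n \<Rightarrow> real ^ 'n \<Rightarrow> ereal \<Rightarrow> (real \<Rightarrow> real ^ 'n) \<Rightarrow> bool" where
  "inclusion_solution K k0 x0 T x \<longleftrightarrow>
     (let I = {t. 0 \<le> t \<and> ereal t < T} in
        x 0 = x0 \<and>
        (\<exists>L. L-lipschitz_on I x) \<and>
        (\<forall>t\<in>I. x t \<in> - (K \<union> {k0})) \<and>
        (AE t in lebesgue. t \<in> I \<longrightarrow>
           (\<exists>v \<in> superdifferential (- K) (obstacle_dist K k0) (x t).
              (x has_vector_derivative v) (at t within I))))"

end

theory Submission
  imports Defs "HOL-Complex_Analysis.Great_Picard"
begin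

text \<open>
  Near a point \<open>x\<close> off the obstacle, \<open>d\<close> is the minimum of \<open>|y - z| + d z\<close> over \<open>z\<close> in
  a small sphere around \<open>x\<close>. Hence \<open>D\<^sup>*d x\<close> consists of the unit vectors \<open>p\<close> with
  \<open>d (x - r p) = d x - r\<close>, \<open>D\<^sup>+d x\<close> is its convex hull, and \<open>d\<close> is semiconcave, with no
  curvature in the direction \<open>p\<close> itself. In particular \<open>x\<close> is singular as soon as some
  \<open>p \<in> D\<^sup>+d x\<close> has \<open>|p| < 1\<close>, and this condition, with a uniform bound, passes to limits.

  For (i), minimal curves cannot run into the obstacle orthogonally, so the unit vector
  pointing from the nearest point of \<open>K\<close> to \<open>x0\<close> is not in \<open>D\<^sup>*d x0\<close>. Therefore some
  \<open>q \<notin> D\<^sup>+d x0\<close> has a projection on \<open>D\<^sup>+d x0\<close> of norm less than one, and the maximisers of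
  \<open>d y - \<langle>q, y - x0\<rangle> - |y - x0|\<^sup>2 / 2s\<close> form the required arc.

  For (ii), the implicit Euler scheme \<open>x' = x + h p'\<close>, \<open>p' \<in> D\<^sup>+d x'\<close>, stays in the half
  space \<open>\<nu> \<bullet> y \<ge> \<nu> \<bullet> x0\<close> separating \<open>x0\<close> from the convex hull of \<open>K\<close>: at a singular point
  every minimal curve starts with a segment hitting \<open>K\<close>, so \<open>\<langle>\<nu>, p\<rangle> > 0\<close> for \<open>p \<in> D\<^sup>+d\<close>.
  The deficit \<open>1 - |p|\<^sup>2\<close> decays at most exponentially along the scheme, so its limit stays
  singular.\<close>

section \<open>Lipschitz and absolutely continuous curves\<close>

text \<open>Minimal curves may creep along the obstacle, where their shape is awkward. Hence curves
  enter almost only through the dynamic programming principle on balls missing \<open>K\<close> and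
  \<open>k0\<close>, axiomatised in the locale \<open>eikonal\<close>: inside such a ball a
  near-minimal curve may be replaced by a segment to the sphere, and all local geometry comes from
  the Euclidean norm, with constants depending on the radius alone. This rests on admissible curves
  being exactly the 1-Lipschitz ones, whence the measure theory at the beginning. A limit of
  singular points can be regular, so singularity has to be carried by a number, the deficit
  \<open>1 - |p|^2\<close>. Here the absence of curvature in the direction \<open>p\<close> is
  decisive: with the plain semiconcavity bound the deficit could drop to zero in finite time. The
  scheme is implicit because a proximal point comes with its own supergradient and does not decrease
  \<open>d\<close>. To last for all times, the flow needs one radius \<open>r\<close> valid along
  its whole path; this is what the separating half space supplies.\<close>

lemma AE_lebesgue_obtain_negligible:
  assumes "AE t in lebesgue. Q (t :: 'a::euclidean_space)"
  obtains N where "negligible N" "\<And>t. t \<notin> N \<Longrightarrow> Q t"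
proof -
  obtain N where N: "{t \<in> space lebesgue. \<not> Q t} \<subseteq> N" "emeasure lebesgue N = 0" "N \<in> sets lebesgue"
    using assms by (rule AE_E)
  have "N \<in> null_sets lebesgue" using N(2,3) by (simp add: null_sets_def)
  then have "negligible N" by (simp add: negligible_iff_null_sets)
  moreover have "Q t" if "t \<notin> N" for t
  proof (rule ccontr)
    assume "\<not> Q t"
    then have "t \<in> {t \<in> space lebesgue. \<not> Q t}" by simp
    then show False using N(1) that by blast
  qed
  ultimately show ?thesis using that by blast
qed

lemma lipschitz_imp_abs_continuous:
  fixes f :: "real \<Rightarrow> 'a::real_normed_vector"
  assumes "L-lipschitz_on {a..b} f"
  shows "abs_continuous_on_interval a b f"
  unfolding abs_continuous_on_interval_def
proof (intro allI impI)
  fix e :: real assume "e > 0"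
  have L: "L \<ge> 0" using assms lipschitz_on_nonneg by blast
  have *: "(\<Sum>k\<in>D. norm (f (Sup k) - f (Inf k))) < e"
    if D: "D division_of \<Union>D" "\<Union>D \<subseteq> {a..b}" "(\<Sum>k\<in>D. Sup k - Inf k) < e / (L + 1)" for D
  proof -
    have "norm (f (Sup k) - f (Inf k)) \<le> L * (Sup k - Inf k)" if k: "k \<in> D" for k
    proof -
      obtain u v where uv: "k = {u..v}" "k \<noteq> {}"
        using division_ofD(3,4)[OF D(1) k] by (metis cbox_interval)
      have "k \<subseteq> {a..b}" using k D(2) by blast
      then show ?thesis using uv lipschitz_onD[OF assms, of v u] by (auto simp: dist_norm)
    qed
    then have "(\<Sum>k\<in>D. norm (f (Sup k) - f (Inf k))) \<le> (\<Sum>k\<in>D. L * (Sup k - Inf k))"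
      by (intro sum_mono) auto
    also have "\<dots> = L * (\<Sum>k\<in>D. Sup k - Inf k)" by (simp add: sum_distrib_left)
    also have "\<dots> \<le> L * (e / (L + 1))" using D(3) L by (intro mult_left_mono) auto
    also have "\<dots> < e" using L \<open>e > 0\<close> by (simp add: field_simps)
    finally show ?thesis .
  qed
  then show "\<exists>\<delta>>0. \<forall>D. D division_of \<Union>D \<and> \<Union>D \<subseteq> {a..b} \<and> (\<Sum>k\<in>D. Sup k - Inf k) < \<delta> \<longrightarrow>
      (\<Sum>k\<in>D. norm (f (Sup k) - f (Inf k))) < e"
    using \<open>e > 0\<close> L by (intro exI[of _ "e / (L + 1)"]) auto
qed

text \<open>A tagged division fine for a suitable gauge has two kinds of intervals. Those tagged off
  \<open>N\<close> have slope at most \<open>M + e\<close> by the derivative. Those tagged in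
  \<open>N\<close> lie in an open set of measure below \<open>\<delta>\<close>, so absolute
  continuity bounds their total increment by \<open>e\<close>. The sign of \<open>M\<close> lets the
  first bound be summed over the whole division.\<close>

lemma abs_continuous_mean_value_AE:
  fixes f :: "real \<Rightarrow> real"
  assumes ac: "abs_continuous_on_interval a b f" and "a \<le> b" and "M \<ge> 0"
    and neg: "negligible N"
    and der: "\<And>t. t \<in> {a..b} - N \<Longrightarrow> \<exists>v\<le>M. (f has_real_derivative v) (at t within {a..b})"
  shows "f b - f a \<le> M * (b - a)"
proof (rule field_le_epsilon)
  fix e0 :: real assume "e0 > 0"
  define e where "e = e0 / (b - a + 1)"
  have e: "e > 0" "e * (b - a) + e \<le> e0" 
  proof -
    show "e > 0" using \<open>e0 > 0\<close> \<open>a \<le> b\<close> by (auto simp: e_def)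
    have "e * (b - a + 1) = e0" using \<open>a \<le> b\<close> by (simp add: e_def)
    then show "e * (b - a) + e \<le> e0" by (simp add: algebra_simps)
  qed
  obtain \<delta> where "\<delta> > 0" and \<delta>: "\<And>D. D division_of \<Union>D \<Longrightarrow> \<Union>D \<subseteq> {a..b} \<Longrightarrow> (\<Sum>k\<in>D. Sup k - Inf k) < \<delta>
      \<Longrightarrow> (\<Sum>k\<in>D. norm (f (Sup k) - f (Inf k))) < e"
    using ac \<open>e > 0\<close> unfolding abs_continuous_on_interval_def by meson
  have NL: "N \<in> sets lebesgue" using neg by (simp add: negligible_imp_sets)
  obtain G where G: "open G" "N \<subseteq> G" "G - N \<in> lmeasurable" "emeasure lebesgue (G - N) < ennreal \<delta>"
    using sets_lebesgue_outer_open[OF NL \<open>\<delta> > 0\<close>] by blast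
  have "G \<in> lmeasurable"
    using G(3) neg by (metis G(2) Diff_partition fmeasurable.Un negligible_iff_measure)
  have mG: "measure lebesgue G < \<delta>"
  proof -
    have "measure lebesgue G \<le> measure lebesgue (G - N) + measure lebesgue N"
      using measure_Un_le[of "G - N" lebesgue N] G(3) NL \<open>N \<subseteq> G\<close>
      by (simp add: Un_absorb2 fmeasurableD)
    also have "measure lebesgue N = 0" using neg negligible_imp_measure0 by blast
    also have "measure lebesgue (G - N) < \<delta>"
      using G(3,4) \<open>\<delta> > 0\<close> by (metis add.right_neutral emeasure_eq_measure2 ennreal_less_iff measure_nonneg)
    finally show ?thesis by simp
  qed
  have "\<exists>r>0. (t \<in> N \<longrightarrow> ball t r \<subseteq> G) \<and>
      (t \<in> {a..b} - N \<longrightarrow> (\<forall>u v. u \<in> ball t r \<inter> {a..b} \<and> v \<in> ball t r \<inter> {a..b} \<and> u \<le> t \<and> t \<le> v \<longrightarrow> f v - f u \<le> (M + e) * (v - u)))" for t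
  proof (cases "t \<in> N")
    case True
    then show ?thesis using G by (meson openE subsetD DiffD2)
  next
    case False
    show ?thesis
    proof (cases "t \<in> {a..b}")
      case True
      with der[of t] False obtain v where v: "v \<le> M" "(f has_derivative (\<lambda>h. v * h)) (at t within {a..b})"
        unfolding has_field_derivative_def by auto
      then obtain r where r: "r > 0" "\<And>y. y \<in> {a..b} \<Longrightarrow> \<bar>y - t\<bar> < r \<Longrightarrow> \<bar>f y - f t - v * (y - t)\<bar> \<le> e * \<bar>y - t\<bar>"
        using \<open>e > 0\<close> unfolding has_derivative_within_alt by auto
      have "f y - f u \<le> (M + e) * (y - u)" if "u \<in> ball t r \<inter> {a..b}" "y \<in> ball t r \<inter> {a..b}" "u \<le> t" "t \<le> y" for u y
      proof -
        have "f y - f t - v * (y - t) \<le> e * (y - t)" using r(2)[of y] that by (auto simp: dist_real_def abs_le_iff)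
        moreover have "- (f u - f t - v * (u - t)) \<le> e * (t - u)" using r(2)[of u] that by (auto simp: dist_real_def abs_le_iff)
        moreover have "v * (y - u) \<le> M * (y - u)" using v that by (intro mult_right_mono) auto
        ultimately show ?thesis by (simp add: algebra_simps)
      qed
      then show ?thesis using r(1) False by blast
    next
      case 2: False
      then show ?thesis using False by (intro exI[of _ 1]) auto
    qed
  qed
  then obtain r where r: "\<And>t. r t > 0" "\<And>t. t \<in> N \<Longrightarrow> ball t (r t) \<subseteq> G"
    "\<And>t u v. t \<in> {a..b} - N \<Longrightarrow> u \<in> ball t (r t) \<inter> {a..b} \<Longrightarrow> v \<in> ball t (r t) \<inter> {a..b} \<Longrightarrow> u \<le> t \<Longrightarrow> t \<le> v \<Longrightarrow> f v - f u \<le> (M + e) * (v - u)"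
    by metis
  obtain p where p: "p tagged_division_of {a..b}" "(\<lambda>t. ball t (r t)) fine p"
    using fine_division_exists_real[of "\<lambda>t. ball t (r t)" a b] r(1) by (auto simp: gauge_def)
  note pD = tagged_division_ofD[OF p(1)]
  have iv: "\<exists>u v. k = {u..v} \<and> u \<le> x \<and> x \<le> v \<and> {u..v} \<subseteq> {a..b} \<and> {u..v} \<subseteq> ball x (r x)" if "(x,k) \<in> p" for x k
    using pD(2,3,4)[OF that] fineD[OF p(2) that] by (auto simp: cbox_interval)
  define p1 where "p1 = {(x,k) \<in> p. x \<in> N}"
  define p2 where "p2 = {(x,k) \<in> p. x \<notin> N}"
  have pp: "p = p1 \<union> p2" "p1 \<inter> p2 = {}" "finite p1" "finite p2"
    unfolding p1_def p2_def using pD(1) by (auto intro: rev_finite_subset)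
  have "f b - f a = (\<Sum>(x,k)\<in>p. f (Sup k) - f (Inf k))"
    using additive_tagged_division_1[OF \<open>a \<le> b\<close> p(1), of f] by simp
  also have "\<dots> = (\<Sum>(x,k)\<in>p1. f (Sup k) - f (Inf k)) + (\<Sum>(x,k)\<in>p2. f (Sup k) - f (Inf k))"
    using pp by (simp add: sum.union_disjoint)
  also have "(\<Sum>(x,k)\<in>p2. f (Sup k) - f (Inf k)) \<le> (\<Sum>(x,k)\<in>p2. (M + e) * (Sup k - Inf k))"
  proof (intro sum_mono, clarify)
    fix x k assume xk: "(x,k) \<in> p2"
    then obtain u v where uv: "k = {u..v}" "u \<le> x" "x \<le> v" "{u..v} \<subseteq> {a..b}" "{u..v} \<subseteq> ball x (r x)"
      using iv[of x k] p2_def by auto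
    then have "u \<in> {u..v}" "v \<in> {u..v}" "x \<in> {u..v}" by auto
    then show "f (Sup k) - f (Inf k) \<le> (M + e) * (Sup k - Inf k)"
      using r(3)[of x u v] uv xk unfolding p2_def by (auto simp: subset_iff)
  qed
  also have "\<dots> \<le> (\<Sum>(x,k)\<in>p. (M + e) * (Sup k - Inf k))"
  proof (rule sum_mono2)
    show "finite p" by (rule pD(1))
    show "p2 \<subseteq> p" using pp by auto
    fix y assume y: "y \<in> p - p2"
    obtain x k where "y = (x,k)" by force
    with y iv[of x k] \<open>M \<ge> 0\<close> \<open>e > 0\<close> show "0 \<le> (case y of (x,k) \<Rightarrow> (M + e) * (Sup k - Inf k))" by auto
  qed
  also have "\<dots> = (M + e) * (\<Sum>(x,k)\<in>p. Sup k - Inf k)"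
    by (simp add: sum_distrib_left case_prod_unfold)
  also have "(\<Sum>(x,k)\<in>p. Sup k - Inf k) = b - a"
    using additive_tagged_division_1[OF \<open>a \<le> b\<close> p(1), of "\<lambda>x. x"] by simp
  also have "(\<Sum>(x,k)\<in>p1. f (Sup k) - f (Inf k)) \<le> e"
  proof -
    have "p1 tagged_partial_division_of {a..b}"
      using p(1) pp(1) tagged_partial_division_subset tagged_division_of_def by blast
    then have td: "p1 tagged_division_of (\<Union>(snd ` p1))"
      using tagged_partial_division_of_Union_self by blast
    define D where "D = snd ` p1"
    have D: "D division_of \<Union>D" unfolding D_def using division_of_tagged_division[OF td] .
    have Dab: "\<Union>D \<subseteq> {a..b}" using iv pp unfolding D_def by fastforce
    have DG: "\<Union>D \<subseteq> G"
    proof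
      fix y assume "y \<in> \<Union>D"
      then obtain x k where xk: "(x,k) \<in> p" "x \<in> N" "y \<in> k" unfolding D_def p1_def by auto
      then show "y \<in> G" using iv[OF xk(1)] r(2)[OF xk(2)] by blast
    qed
    have len: "(\<Sum>k\<in>D. Sup k - Inf k) = measure lebesgue (\<Union>D)"
    proof -
      have "measure lebesgue (\<Union>D) = (\<Sum>k\<in>D. measure lebesgue k)"
        using content_division[OF D] by metis
      also have "\<dots> = (\<Sum>k\<in>D. Sup k - Inf k)"
      proof (rule sum.cong[OF refl])
        fix k assume "k \<in> D"
        then obtain x where "(x,k) \<in> p" unfolding D_def p1_def by auto
        from iv[OF this] show "measure lebesgue k = Sup k - Inf k" by auto
      qed
      finally show ?thesis by simp
    qed
    have "measure lebesgue (\<Union>D) \<le> measure lebesgue G"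
    proof (rule measure_mono_fmeasurable[OF DG _ \<open>G \<in> lmeasurable\<close>])
      show "\<Union>D \<in> sets lebesgue" using D by (meson fmeasurableD lmeasurable_division)
    qed
    then have "(\<Sum>k\<in>D. norm (f (Sup k) - f (Inf k))) < e"
      using \<delta>[OF D Dab] len mG by linarith
    moreover have "(\<Sum>(x,k)\<in>p1. norm (f (Sup k) - f (Inf k))) = (\<Sum>k\<in>D. norm (f (Sup k) - f (Inf k)))"
    proof -
      \<comment> \<open>Distinct tagged pairs may share an interval, but only one without interior.
        To sum over intervals instead, the summand must vanish on all such boxes, and for the empty
        one \<open>Sup\<close> and \<open>Inf\<close> give no usable value; hence the case
        distinction.\<close>
      define d where "d k = (if k = {} then 0 else norm (f (Sup k) - f (Inf k)))" for k
      have "(\<Sum>(x,k)\<in>p1. d k) = (\<Sum>k\<in>D. d k)"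
        unfolding D_def
      proof (rule sum.over_tagged_division_lemma[OF td])
        fix u v :: real assume "box u v = {}"
        then have "v \<le> u" by (simp add: box_real)
        then show "d (cbox u v) = 0"
          by (cases "u = v") (auto simp: cbox_interval d_def)
      qed
      moreover have ne: "k \<noteq> {}" if "(x,k) \<in> p1" for x k
        using pD(2)[of x k] that pp(1) by auto
      have "(\<Sum>(x,k)\<in>p1. norm (f (Sup k) - f (Inf k))) = (\<Sum>(x,k)\<in>p1. d k)"
        using ne by (intro sum.cong) (auto simp: d_def)
      moreover have "(\<Sum>k\<in>D. norm (f (Sup k) - f (Inf k))) = (\<Sum>k\<in>D. d k)"
        using ne by (intro sum.cong) (auto simp: d_def D_def)
      ultimately show ?thesis by simp
    qed
    moreover have "(\<Sum>(x,k)\<in>p1. f (Sup k) - f (Inf k)) \<le> (\<Sum>(x,k)\<in>p1. norm (f (Sup k) - f (Inf k)))"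
      by (intro sum_mono) auto
    ultimately show ?thesis by linarith
  qed
  finally show "f b - f a \<le> M * (b - a) + e0" using e by (simp add: algebra_simps)
qed

section \<open>Almost everywhere differentiability of Lipschitz functions on the line\<close>

lemma emeasure_disjoint_intervals_le:
  fixes C :: "(real \<times> real) set"
  assumes "countable C"
    and "pairwise (\<lambda>i j. disjnt {fst i..snd i} {fst j..snd j}) C"
    and "sets \<mu> = sets borel" "sets \<nu> = sets borel"
    and "\<And>i. i \<in> C \<Longrightarrow> emeasure \<mu> {fst i..snd i} \<le> c * emeasure \<nu> {fst i..snd i}"
  shows "emeasure \<mu> (\<Union>i\<in>C. {fst i..snd i}) \<le> c * emeasure \<nu> (\<Union>i\<in>C. {fst i..snd i})"
proof -
  have disj: "disjoint_family_on (\<lambda>i. {fst i..snd i}) C"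
    using assms(2) unfolding disjoint_family_on_def pairwise_def disjnt_def by auto
  have "emeasure \<mu> (\<Union>i\<in>C. {fst i..snd i}) = (\<integral>\<^sup>+i. emeasure \<mu> {fst i..snd i} \<partial>count_space C)"
    using assms disj by (intro emeasure_UN_countable) auto
  also have "\<dots> \<le> (\<integral>\<^sup>+i. c * emeasure \<nu> {fst i..snd i} \<partial>count_space C)"
    using assms by (intro nn_integral_mono) auto
  also have "\<dots> = c * (\<integral>\<^sup>+i. emeasure \<nu> {fst i..snd i} \<partial>count_space C)"
    by (intro nn_integral_cmult) auto
  also have "(\<integral>\<^sup>+i. emeasure \<nu> {fst i..snd i} \<partial>count_space C) = emeasure \<nu> (\<Union>i\<in>C. {fst i..snd i})"
    using assms disj by (intro emeasure_UN_countable[symmetric]) auto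
  finally show ?thesis .
qed

lemma Vitali_covering_intervals:
  fixes K :: "(real \<times> real) set"
  assumes "\<And>i. i \<in> K \<Longrightarrow> fst i < snd i"
    and "\<And>x d. x \<in> S \<Longrightarrow> 0 < d \<Longrightarrow> \<exists>i\<in>K. x \<in> {fst i..snd i} \<and> snd i - fst i < d"
  obtains C where "countable C" "C \<subseteq> K"
    "pairwise (\<lambda>i j. disjnt {fst i..snd i} {fst j..snd j}) C"
    "negligible (S - (\<Union>i\<in>C. {fst i..snd i}))"
proof -
  have eq: "cball ((fst i + snd i) / 2) ((snd i - fst i) / 2) = {fst i..snd i}" for i :: "real \<times> real"
    by (simp add: cball_eq_atLeastAtMost field_simps)
  have 1: "\<exists>i. i \<in> K \<and> x \<in> cball ((fst i + snd i) / 2) ((snd i - fst i) / 2) \<and> (snd i - fst i) / 2 < d"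
    if "x \<in> S" "0 < d" for x d
    using assms(2)[OF that] assms(1) unfolding eq by (force simp: field_simps)
  have 0: "0 < (snd i - fst i) / 2" if "i \<in> K" for i using assms(1)[OF that] by simp
  show ?thesis
    by (rule Vitali_covering_theorem_cballs[of K "\<lambda>i. (snd i - fst i) / 2" S "\<lambda>i. (fst i + snd i) / 2", OF 0 1])
      (use that in \<open>auto simp: eq\<close>)
qed

lemma lmeasurable_outer_open:
  fixes T :: "'a::euclidean_space set"
  assumes "T \<in> lmeasurable" "e > 0"
  obtains G where "open G" "T \<subseteq> G" "G \<in> lmeasurable" "measure lebesgue G < measure lebesgue T + e"
proof -
  obtain G where G: "open G" "T \<subseteq> G" "G - T \<in> lmeasurable" "emeasure lebesgue (G - T) < ennreal e"
    using sets_lebesgue_outer_open[of T e] assms by auto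
  have eq: "T \<union> (G - T) = G" using G(2) by blast
  have "G \<in> lmeasurable" using fmeasurable.Un[OF assms(1) G(3)] unfolding eq .
  moreover have "measure lebesgue G \<le> measure lebesgue T + measure lebesgue (G - T)"
    using measure_Un_le[of T lebesgue "G - T"] assms(1) G(3) unfolding eq by (simp add: fmeasurableD)
  moreover have "measure lebesgue (G - T) < e"
    using G(3,4) assms(2) by (simp add: emeasure_eq_measure2 ennreal_less_iff)
  ultimately show ?thesis using that G by force
qed

text \<open>Inside an open \<open>G\<close> around a part of \<open>E\<close>, a Vitali cover by
  flat intervals \<open>W1\<close> is refined by a Vitali cover by steep intervals
  \<open>W2\<close>. For the Stieltjes measure \<open>\<nu>\<close> of \<open>f\<close> this gives
  \<open>v |W2| \<le> \<nu> W2 \<le> \<nu> W1 \<le> u |W1| \<le> u |G|\<close>. So the outer measure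
  of a bounded part of \<open>E\<close> shrinks by the factor \<open>u / v < 1\<close>, which forces
  it to be zero.\<close>

lemma monotone_steep_flat_negligible:
  fixes f :: "real \<Rightarrow> real"
  assumes mono: "\<And>x y. x \<le> y \<Longrightarrow> f x \<le> f y" and cont: "continuous_on UNIV f"
    and uv: "0 < u" "u < v"
    and flat: "\<And>t \<delta>. t \<in> E \<Longrightarrow> \<delta> > 0 \<Longrightarrow> \<exists>a b. a \<le> t \<and> t \<le> b \<and> a < b \<and> b - a < \<delta> \<and> f b - f a < u * (b - a)"
    and steep: "\<And>t \<delta>. t \<in> E \<Longrightarrow> \<delta> > 0 \<Longrightarrow> \<exists>a b. a \<le> t \<and> t \<le> b \<and> a < b \<and> b - a < \<delta> \<and> f b - f a > v * (b - a)"
  shows "negligible E"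
proof -
  let ?\<nu> = "interval_measure f"
  have \<nu>: "emeasure ?\<nu> {a..b} = ennreal (f b - f a)" if "a \<le> b" for a b
    using emeasure_interval_measure_Icc[OF that mono cont] .
  have key: "\<exists>T. S \<subseteq> T \<and> T \<in> lmeasurable \<and> measure lebesgue T \<le> u / v * measure lebesgue G"
    if G: "open G" "G \<in> lmeasurable" "S \<subseteq> G" and SE: "S \<subseteq> E" for S G
  proof -
    define K where "K = {i :: real \<times> real. fst i < snd i \<and> {fst i..snd i} \<subseteq> G \<and> f (snd i) - f (fst i) < u * (snd i - fst i)}"
    obtain C where C: "countable C" "C \<subseteq> K" "pairwise (\<lambda>i j. disjnt {fst i..snd i} {fst j..snd j}) C"
      "negligible (S - (\<Union>i\<in>C. {fst i..snd i}))"
    proof (rule Vitali_covering_intervals[of K S])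
      show "fst i < snd i" if "i \<in> K" for i using that K_def by auto
      fix x and d :: real assume x: "x \<in> S" "0 < d"
      obtain r where r: "r > 0" "ball x r \<subseteq> G" using x G openE by blast
      obtain a b where ab: "a \<le> x" "x \<le> b" "a < b" "b - a < min d r" "f b - f a < u * (b - a)"
        using flat[of x "min d r"] x r SE by auto
      then have "{a..b} \<subseteq> ball x r" by (auto simp: dist_real_def)
      then show "\<exists>i\<in>K. x \<in> {fst i..snd i} \<and> snd i - fst i < d"
        using ab r by (intro bexI[of _ "(a,b)"]) (auto simp: K_def)
    qed
    \<comment> \<open>Interior points only, so that short steep intervals around them stay within
      one flat interval. The discarded endpoints are countably many.\<close>
    define S1 where "S1 = S \<inter> (\<Union>i\<in>C. {fst i<..<snd i})"
    define K2 where "K2 = {i :: real \<times> real. fst i < snd i \<and> (\<exists>j\<in>C. {fst i..snd i} \<subseteq> {fst j..snd j}) \<and> f (snd i) - f (fst i) > v * (snd i - fst i)}"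
    obtain D where D: "countable D" "D \<subseteq> K2" "pairwise (\<lambda>i j. disjnt {fst i..snd i} {fst j..snd j}) D"
      "negligible (S1 - (\<Union>i\<in>D. {fst i..snd i}))"
    proof (rule Vitali_covering_intervals[of K2 S1])
      show "fst i < snd i" if "i \<in> K2" for i using that K2_def by auto
      fix x and d :: real assume x: "x \<in> S1" "0 < d"
      then obtain j where j: "j \<in> C" "x \<in> {fst j<..<snd j}" unfolding S1_def by auto
      define r where "r = min d (min (x - fst j) (snd j - x))"
      have "r > 0" using x j r_def by auto
      then obtain a b where ab: "a \<le> x" "x \<le> b" "a < b" "b - a < r" "f b - f a > v * (b - a)"
        using steep[of x r] x SE S1_def by auto
      then have "{a..b} \<subseteq> {fst j..snd j}" using j unfolding r_def by auto
      then have "\<exists>j\<in>C. {a..b} \<subseteq> {fst j..snd j}" using j(1) by (rule bexI)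
      then show "\<exists>i\<in>K2. x \<in> {fst i..snd i} \<and> snd i - fst i < d"
        using ab j unfolding r_def K2_def by (intro bexI[of _ "(a,b)"]) (auto simp del: atLeastatMost_subset_iff)
    qed
    define W1 where "W1 = (\<Union>i\<in>C. {fst i..snd i})"
    define W2 where "W2 = (\<Union>i\<in>D. {fst i..snd i})"
    have [measurable]: "W1 \<in> sets borel" "W2 \<in> sets borel" unfolding W1_def W2_def using C D by auto
    have neg: "negligible (S - W2)"
    proof (rule negligible_subset)
      have "countable (\<Union>i\<in>C. {fst i, snd i})" using C(1) by (intro countable_UN) auto
      then have "negligible (\<Union>i\<in>C. {fst i, snd i})"
        using countable_imp_null_set_lborel negligible_iff_null_sets null_sets_completionI by blast
      moreover have "negligible (S - W1)" "negligible (S1 - W2)" using C(4) D(4) by (auto simp: W1_def W2_def)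
      ultimately show "negligible ((S - W1) \<union> (S1 - W2) \<union> (\<Union>i\<in>C. {fst i, snd i}))"
        by (intro negligible_Un)
      show "S - W2 \<subseteq> (S - W1) \<union> (S1 - W2) \<union> (\<Union>i\<in>C. {fst i, snd i})"
      proof
        fix x assume x: "x \<in> S - W2"
        show "x \<in> (S - W1) \<union> (S1 - W2) \<union> (\<Union>i\<in>C. {fst i, snd i})"
        proof (cases "x \<in> W1")
          case True
          then obtain i where i: "i \<in> C" "fst i \<le> x" "x \<le> snd i" unfolding W1_def by auto
          show ?thesis
          proof (cases "x = fst i \<or> x = snd i")
            case False
            then have "x \<in> {fst i<..<snd i}" using i by auto
            then have "x \<in> S1" using x i unfolding S1_def by blast
            then show ?thesis using x by blast
          qed (use i in blast)
        qed (use x in blast)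
      qed
    qed
    have "W2 \<subseteq> W1" 
    proof
      fix x assume "x \<in> W2"
      then obtain i where i: "i \<in> D" "x \<in> {fst i..snd i}" unfolding W2_def by blast
      then obtain j where "j \<in> C" "{fst i..snd i} \<subseteq> {fst j..snd j}" using D(2) unfolding K2_def by blast
      then show "x \<in> W1" using i unfolding W1_def by blast
    qed
    have "W1 \<subseteq> G" unfolding W1_def using C(2) unfolding K_def by blast
    have "ennreal v * emeasure lborel W2 \<le> emeasure ?\<nu> W2"
    proof -
      have "emeasure lborel W2 \<le> ennreal (1 / v) * emeasure ?\<nu> W2" unfolding W2_def
      proof (rule emeasure_disjoint_intervals_le[OF D(1,3)])
        fix i assume "i \<in> D"
        then have i: "fst i < snd i" "f (snd i) - f (fst i) > v * (snd i - fst i)" using D(2) K2_def by auto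
        then have le: "snd i - fst i \<le> 1 / v * (f (snd i) - f (fst i))" using uv by (simp add: field_simps)
        have "emeasure lborel {fst i..snd i} = ennreal (snd i - fst i)" using i by simp
        also have "\<dots> \<le> ennreal (1 / v * (f (snd i) - f (fst i)))" by (rule ennreal_leI[OF le])
        also have "\<dots> = ennreal (1 / v) * ennreal (f (snd i) - f (fst i))"
          using i uv mono[of "fst i" "snd i"] by (intro ennreal_mult) auto
        also have "ennreal (f (snd i) - f (fst i)) = emeasure ?\<nu> {fst i..snd i}" using i by (simp add: \<nu>)
        finally show "emeasure lborel {fst i..snd i} \<le> ennreal (1 / v) * emeasure ?\<nu> {fst i..snd i}" .
      qed auto
      then have "ennreal v * emeasure lborel W2 \<le> ennreal v * (ennreal (1 / v) * emeasure ?\<nu> W2)"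
        by (rule mult_left_mono) simp
      also have "\<dots> = emeasure ?\<nu> W2" 
      proof -
        have "ennreal v * ennreal (1 / v) = ennreal (v * (1 / v))" using uv by (intro ennreal_mult[symmetric]) auto
        also have "\<dots> = 1" using uv by simp
        finally show ?thesis by (metis mult.assoc mult_1)
      qed
      finally show ?thesis .
    qed
    also have "\<dots> \<le> emeasure ?\<nu> W1" using \<open>W2 \<subseteq> W1\<close> by (intro emeasure_mono) auto
    also have "\<dots> \<le> ennreal u * emeasure lborel W1" unfolding W1_def
    proof (rule emeasure_disjoint_intervals_le[OF C(1,3)])
      fix i assume "i \<in> C"
      then have i: "fst i < snd i" "f (snd i) - f (fst i) < u * (snd i - fst i)" using C(2) K_def by auto
      then show "emeasure ?\<nu> {fst i..snd i} \<le> ennreal u * emeasure lborel {fst i..snd i}"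
        using i uv by (simp add: \<nu> flip: ennreal_mult)
    qed auto
    also have "\<dots> \<le> ennreal u * emeasure lborel G"
      using \<open>W1 \<subseteq> G\<close> \<open>open G\<close> by (intro mult_left_mono emeasure_mono) auto
    finally have le: "ennreal v * emeasure lborel W2 \<le> ennreal u * emeasure lborel G" .
    have "W2 \<in> lmeasurable"
      using G(2) \<open>W1 \<subseteq> G\<close> \<open>W2 \<subseteq> W1\<close> by (intro fmeasurableI2[OF G(2)]) auto
    have "v * measure lebesgue W2 \<le> u * measure lebesgue G"
    proof -
      have "emeasure lborel W2 = emeasure lebesgue W2" by simp
      also have "\<dots> = ennreal (measure lebesgue W2)"
        using \<open>W2 \<in> lmeasurable\<close> by (rule emeasure_eq_measure2)
      finally have "emeasure lborel W2 = ennreal (measure lebesgue W2)" .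
      moreover have "emeasure lborel G = emeasure lebesgue G" using G by simp
      moreover have "emeasure lebesgue G = ennreal (measure lebesgue G)"
        using G(2) by (rule emeasure_eq_measure2)
      ultimately have "ennreal v * ennreal (measure lebesgue W2) \<le> ennreal u * ennreal (measure lebesgue G)"
        using le by metis
      then show ?thesis using uv ennreal_mult[of v "measure lebesgue W2"] ennreal_mult[of u "measure lebesgue G"]
        by (metis ennreal_le_iff less_eq_real_def measure_nonneg mult_nonneg_nonneg order.trans)
    qed
    then have "measure lebesgue W2 \<le> u / v * measure lebesgue G" using uv by (simp add: field_simps)
    moreover have "W2 \<union> (S - W2) \<in> lmeasurable"
      using \<open>W2 \<in> lmeasurable\<close> neg by (intro fmeasurable.Un) (auto simp: negligible_iff_measure)
    moreover have "measure lebesgue (W2 \<union> (S - W2)) = measure lebesgue W2"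
      using \<open>W2 \<in> lmeasurable\<close> neg
      by (intro measure_Un_null_set) (auto simp: negligible_iff_null_sets fmeasurableD)
    ultimately show ?thesis by (intro exI[of _ "W2 \<union> (S - W2)"]) auto
  qed
  have neg1: "negligible (E \<inter> {-real n<..<real n})" for n
  proof -
    define S where "S = E \<inter> {-real n<..<real n}"
    \<comment> \<open>\<open>E\<close> is not known to be measurable; \<open>Inf A\<close> plays the
      role of the outer measure of \<open>S\<close>.\<close>
    define A where "A = {measure lebesgue T | T. S \<subseteq> T \<and> T \<in> lmeasurable}"
    have bdd: "bdd_below A" unfolding A_def by (intro bdd_belowI[of _ 0]) auto
    have ne: "A \<noteq> {}" unfolding A_def S_def by (auto intro!: exI[of _ "{-real n<..<real n}"] lmeasurable_interval)
    define m where "m = Inf A"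
    have "m \<ge> 0" unfolding m_def using ne by (intro cInf_greatest) (auto simp: A_def)
    have "m = 0"
    proof (rule ccontr)
      assume "m \<noteq> 0"
      then have "m > 0" using \<open>m \<ge> 0\<close> by simp
      \<comment> \<open>Chosen so that \<open>u / v * (m + 2 * e)\<close> is the mean of
        \<open>m\<close> and \<open>m * u / v\<close>, hence less than \<open>m\<close>.\<close>
      define e where "e = (v / u - 1) * m / 4"
      have "e > 0" using uv \<open>m > 0\<close> by (auto simp: e_def)
      obtain T where T: "S \<subseteq> T" "T \<in> lmeasurable" "measure lebesgue T < m + e"
        using cInf_lessD[OF ne, of "m + e"] \<open>e > 0\<close> unfolding m_def A_def by auto
      obtain G where G: "open G" "T \<subseteq> G" "G \<in> lmeasurable" "measure lebesgue G < measure lebesgue T + e"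
        by (rule lmeasurable_outer_open[OF T(2) \<open>e > 0\<close>])
      obtain T' where T': "S \<subseteq> T'" "T' \<in> lmeasurable" "measure lebesgue T' \<le> u / v * measure lebesgue G"
        using key[OF G(1,3), of S] G T S_def by auto
      have "m \<le> measure lebesgue T'" unfolding m_def using T' by (intro cInf_lower bdd) (auto simp: A_def)
      also have "\<dots> \<le> u / v * measure lebesgue G" by (rule T'(3))
      also have "\<dots> \<le> u / v * (m + 2 * e)" using T(3) G(4) uv by (intro mult_left_mono) auto
      also have "m + 2 * e = m * (v / u + 1) / 2" proof -
        have "m + 2 * ((w - 1) * m / 4) = m * (w + 1) / 2" for w by (simp add: field_simps)
        then show ?thesis unfolding e_def .
      qed
      also have "u / v * (m * (v / u + 1) / 2) = m * (1 + u / v) / 2" using uv by (simp add: field_simps)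
      also have "\<dots> < m"
      proof -
        have "m * (u / v) < m * 1" using uv \<open>m > 0\<close> by (intro mult_strict_left_mono) auto
        then show ?thesis by (simp add: algebra_simps)
      qed
      finally show False by simp
    qed
    have "\<exists>T. S \<subseteq> T \<and> T \<in> lmeasurable \<and> measure lebesgue T < e" if "e > 0" for e
    proof -
      have "Inf A < e" using \<open>m = 0\<close> that by (simp add: m_def)
      then obtain x where "x \<in> A" "x < e" using cInf_lessD[OF ne] by blast
      then show ?thesis unfolding A_def by blast
    qed
    then have "negligible S" unfolding negligible_outer by simp
    then show ?thesis by (simp only: S_def)
  qed
  have neg: "negligible (\<Union>n. E \<inter> {-real n<..<real n})"
  proof (rule negligible_countable_Union)
    fix X assume "X \<in> range (\<lambda>n. E \<inter> {-real n<..<real n})"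
    then obtain n where "X = E \<inter> {-real n<..<real n}" by (rule imageE)
    then show "negligible X" using neg1 by (simp only:)
  qed (rule countable_image[OF countableI_type])
  have "E \<subseteq> (\<Union>n. E \<inter> {-real n<..<real n})"
  proof
    fix x assume "x \<in> E"
    obtain n where "\<bar>x\<bar> < real n" using reals_Archimedean2 by blast
    then have "x \<in> E \<inter> {-real n<..<real n}" using \<open>x \<in> E\<close> by (simp add: abs_less_iff)
    then show "x \<in> (\<Union>n. E \<inter> {-real n<..<real n})" by blast
  qed
  with neg show ?thesis by (rule negligible_subset)
qed

text \<open>The intervals in \<open>E u v\<close> may have \<open>t\<close> as an endpoint, so
  \<open>t \<notin> E u v\<close> makes the difference quotient at \<open>t\<close> eventually at
  least \<open>u\<close> or eventually at most \<open>v\<close>. For all rational pairs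
  \<open>u < v\<close> at once this leaves room for one limit only, the supremum of the eventual
  lower bounds. Slopes at least one keep that limit, and the rationals just above it, positive as
  the preceding lemma demands.\<close>

lemma monotone_slopes_AE_differentiable:
  fixes f :: "real \<Rightarrow> real"
  assumes sl: "\<And>x y. x \<le> y \<Longrightarrow> y - x \<le> f y - f x" "\<And>x y. x \<le> y \<Longrightarrow> f y - f x \<le> M * (y - x)"
  shows "negligible {t. \<not> f differentiable (at t)}"
proof -
  define E where "E u v = {t. (\<forall>\<delta>>0. \<exists>a b. a \<le> t \<and> t \<le> b \<and> a < b \<and> b - a < \<delta> \<and> f b - f a < u * (b - a)) \<and>
      (\<forall>\<delta>>0. \<exists>a b. a \<le> t \<and> t \<le> b \<and> a < b \<and> b - a < \<delta> \<and> f b - f a > v * (b - a))}" for u v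
  have mono: "x \<le> y \<Longrightarrow> f x \<le> f y" for x y using sl(1)[of x y] by simp
  have Lip: "\<bar>f y - f x\<bar> \<le> \<bar>M\<bar> * \<bar>y - x\<bar>" for x y
  proof (cases "x \<le> y")
    case True
    have "M * (y - x) \<le> \<bar>M\<bar> * (y - x)" using True by (intro mult_right_mono) auto
    then show ?thesis using sl(2)[OF True] mono[OF True] True by simp
  next
    case False
    then have *: "y \<le> x" by simp
    have "M * (x - y) \<le> \<bar>M\<bar> * (x - y)" using * by (intro mult_right_mono) auto
    then show ?thesis using sl(2)[OF *] mono[OF *] * by (simp add: abs_minus_commute)
  qed
  have cont: "continuous_on UNIV f"
    using lipschitz_on_continuous_on[of "\<bar>M\<bar>" UNIV f] Lip by (auto simp: lipschitz_on_def dist_real_def)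
  define P where "P = {(u,v) \<in> \<rat> \<times> \<rat>. 0 < u \<and> u < (v::real)}"
  define N where "N = (\<Union>(u,v)\<in>P. E u v)"
  have "countable P" unfolding P_def
    by (rule countable_subset[of _ "\<rat> \<times> \<rat>"]) (auto intro: countable_SIGMA countable_rat)
  have negE: "negligible (E u v)" if "(u,v) \<in> P" for u v
  proof (rule monotone_steep_flat_negligible[OF mono cont])
    show "0 < u" "u < v" using that P_def by auto
    show "\<exists>a b. a \<le> t \<and> t \<le> b \<and> a < b \<and> b - a < \<delta> \<and> f b - f a < u * (b - a)" if "t \<in> E u v" "\<delta> > 0" for t \<delta>
      using that unfolding E_def by blast
    show "\<exists>a b. a \<le> t \<and> t \<le> b \<and> a < b \<and> b - a < \<delta> \<and> f b - f a > v * (b - a)" if "t \<in> E u v" "\<delta> > 0" for t \<delta>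
      using that unfolding E_def by blast
  qed auto
  have "negligible N"
    unfolding N_def using \<open>countable P\<close> negE by (intro negligible_countable_Union) auto
  moreover have "f differentiable (at t)" if t: "t \<notin> N" for t
  proof -
    define Q where "Q s = (f s - f t) / (s - t)" for s
    have Q: "1 \<le> Q s \<and> Q s \<le> M" if "s \<noteq> t" for s
      using that sl[of s t] sl[of t s] unfolding Q_def by (cases "s < t") (auto simp: field_simps)
    have alt: "(\<forall>\<^sub>F s in at t. u \<le> Q s) \<or> (\<forall>\<^sub>F s in at t. Q s \<le> v)" if uv: "(u,v) \<in> P" for u v
    proof -
      have "t \<notin> E u v" using t uv N_def by auto
      then obtain \<delta> where d: "\<delta> > 0" and
        "(\<forall>a b. a \<le> t \<and> t \<le> b \<and> a < b \<and> b - a < \<delta> \<longrightarrow> f b - f a \<ge> u * (b - a)) \<or>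
         (\<forall>a b. a \<le> t \<and> t \<le> b \<and> a < b \<and> b - a < \<delta> \<longrightarrow> f b - f a \<le> v * (b - a))"
        unfolding E_def mem_Collect_eq by (meson not_less)
      then show ?thesis
      proof (elim disjE)
        assume A: "\<forall>a b. a \<le> t \<and> t \<le> b \<and> a < b \<and> b - a < \<delta> \<longrightarrow> f b - f a \<ge> u * (b - a)"
        have "\<forall>\<^sub>F s in at t. u \<le> Q s" unfolding eventually_at
        proof (intro exI[of _ \<delta>] conjI ballI impI d)
          fix s assume s: "s \<noteq> t \<and> dist s t < \<delta>"
          then show "u \<le> Q s" using A[rule_format, of s t] A[rule_format, of t s]
            unfolding Q_def by (cases "s < t") (auto simp: dist_real_def field_simps)
        qed
        then show ?thesis ..
      next
        assume A: "\<forall>a b. a \<le> t \<and> t \<le> b \<and> a < b \<and> b - a < \<delta> \<longrightarrow> f b - f a \<le> v * (b - a)"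
        have "\<forall>\<^sub>F s in at t. Q s \<le> v" unfolding eventually_at
        proof (intro exI[of _ \<delta>] conjI ballI impI d)
          fix s assume s: "s \<noteq> t \<and> dist s t < \<delta>"
          then show "Q s \<le> v" using A[rule_format, of s t] A[rule_format, of t s]
            unfolding Q_def by (cases "s < t") (auto simp: dist_real_def field_simps)
        qed
        then show ?thesis ..
      qed
    qed
    define A where "A = {u. \<forall>\<^sub>F s in at t. u \<le> Q s}"
    have evQ: "\<forall>\<^sub>F s in at t. 1 \<le> Q s \<and> Q s \<le> M" using Q by (auto simp: eventually_at_filter)
    have A1: "1 \<in> A" unfolding A_def using evQ by (auto elim: eventually_mono)
    have bdd: "bdd_above A"
    proof (rule bdd_aboveI[of _ M])
      fix u assume "u \<in> A"
      then have "\<forall>\<^sub>F s in at t. u \<le> Q s \<and> Q s \<le> M"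
        unfolding A_def using evQ by (auto elim: eventually_elim2)
      then show "u \<le> M" using eventually_happens'[OF at_neq_bot] order_trans by blast
    qed
    define l where "l = Sup A"
    have "l \<ge> 1" unfolding l_def using A1 bdd by (rule cSup_upper)
    have "(Q \<longlongrightarrow> l) (at t)"
    proof (rule tendstoI)
      fix e :: real assume "e > 0"
      obtain x where x: "x \<in> A" "x > l - e"
        using less_cSupD[of A "l - e"] A1 \<open>e > 0\<close> unfolding l_def by auto
      obtain u where u: "u \<in> \<rat>" "l < u" "u < l + e" using Rats_dense_in_real[of l "l + e"] \<open>e > 0\<close> by auto
      obtain v where v: "v \<in> \<rat>" "u < v" "v < l + e" using Rats_dense_in_real[of u "l + e"] u by auto
      have "u \<notin> A" using cSup_upper[OF _ bdd, of u] u unfolding l_def by auto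
      moreover have "(u,v) \<in> P" using u v \<open>l \<ge> 1\<close> unfolding P_def by auto
      ultimately have "\<forall>\<^sub>F s in at t. Q s \<le> v" using alt[of u v] unfolding A_def by auto
      moreover have "\<forall>\<^sub>F s in at t. x \<le> Q s" using x unfolding A_def by auto
      ultimately show "\<forall>\<^sub>F s in at t. dist (Q s) l < e"
        by eventually_elim (use x v in \<open>auto simp: dist_real_def\<close>)
    qed
    then have "(f has_field_derivative l) (at t)" unfolding has_field_derivative_iff Q_def .
    then show ?thesis using field_differentiable_def field_differentiable_imp_differentiable by blast
  qed
  ultimately show ?thesis by (elim negligible_subset) blast
qed

text \<open>Adding the linear term \<open>(L + 1) * t\<close> moves all slopes into the interval
  from \<open>1\<close> to \<open>2 * L + 1\<close>.\<close>

lemma lipschitz_real_AE_differentiable: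
  fixes f :: "real \<Rightarrow> real"
  assumes "L-lipschitz_on UNIV f"
  shows "negligible {t. \<not> f differentiable (at t)}"
proof -
  define g where "g t = f t + (L + 1) * t" for t
  have L: "\<bar>f y - f x\<bar> \<le> L * \<bar>y - x\<bar>" for x y
    using lipschitz_onD[OF assms, of y x] by (simp add: dist_real_def)
  have "negligible {t. \<not> g differentiable (at t)}"
  proof (rule monotone_slopes_AE_differentiable)
    fix x y :: real assume "x \<le> y"
    then show "y - x \<le> g y - g x" "g y - g x \<le> (2 * L + 1) * (y - x)"
      using L[of y x] unfolding g_def by (auto simp: algebra_simps abs_le_iff)
  qed
  moreover have "f differentiable (at t)" if "g differentiable (at t)" for t
  proof -
    have "(\<lambda>s. g s - (L + 1) * s) differentiable (at t)"
      using that by (intro derivative_intros) auto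
    then show ?thesis by (simp add: g_def)
  qed
  ultimately show ?thesis by (elim negligible_subset) blast
qed

lemma lipschitz_norm_vector_derivative_le:
  fixes f :: "real \<Rightarrow> 'a::real_normed_vector"
  assumes "L-lipschitz_on S f" "t \<in> S" "at t within S \<noteq> bot"
    and "(f has_vector_derivative v) (at t within S)"
  shows "norm v \<le> L"
proof (rule field_le_epsilon)
  fix e :: real assume "e > 0"
  have "\<forall>\<^sub>F s in at t within S. norm (f s - f t - (s - t) *\<^sub>R v) \<le> e * norm (s - t)"
    using assms(4) \<open>e > 0\<close> unfolding has_vector_derivative_def has_derivative_within_alt2 by blast
  moreover have "\<forall>\<^sub>F s in at t within S. s \<in> S \<and> s \<noteq> t"
    by (auto simp: eventually_at_filter)
  ultimately have "\<forall>\<^sub>F s in at t within S. norm (f s - f t - (s - t) *\<^sub>R v) \<le> e * norm (s - t) \<and> s \<in> S \<and> s \<noteq> t"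
    by eventually_elim auto
  then obtain s where s: "norm (f s - f t - (s - t) *\<^sub>R v) \<le> e * norm (s - t)" "s \<in> S" "s \<noteq> t"
    using assms(3) eventually_happens' by blast
  have "\<bar>s - t\<bar> * norm v = norm ((s - t) *\<^sub>R v)" by simp
  also have "\<dots> \<le> norm (f s - f t) + norm (f s - f t - (s - t) *\<^sub>R v)"
    by (metis norm_minus_commute norm_triangle_sub)
  also have "\<dots> \<le> L * \<bar>s - t\<bar> + e * \<bar>s - t\<bar>"
    using lipschitz_onD[OF assms(1) s(2) assms(2)] s(1) by (simp add: dist_norm)
  finally have "\<bar>s - t\<bar> * norm v \<le> \<bar>s - t\<bar> * (L + e)" by (simp add: algebra_simps)
  then show "norm v \<le> L + e" using s(3) by simp
qed

lemma lipschitz_AE_has_vector_derivative: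
  fixes f :: "real \<Rightarrow> 'a::euclidean_space"
  assumes "L-lipschitz_on {0..} f"
  shows "AE t in lebesgue. 0 \<le> t \<longrightarrow> (\<exists>v. (f has_vector_derivative v) (at t within {0..}) \<and> norm v \<le> L)"
proof -
  \<comment> \<open>Constant continuation to negative times, so that two-sided differentiability can
    be discussed; the corner at \<open>0\<close> joins the null set.\<close>
  define g where "g t = f (max 0 t)" for t
  define N where "N i = {t. \<not> (\<lambda>t. g t \<bullet> i) differentiable (at t)}" for i :: 'a
  have Lg: "dist (g x) (g y) \<le> L * dist x y" for x y
  proof -
    have "dist (g x) (g y) \<le> L * dist (max 0 x) (max 0 y)"
      unfolding g_def by (intro lipschitz_onD[OF assms]) auto
    also have "\<dots> \<le> L * dist x y" using lipschitz_on_nonneg[OF assms]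
      by (intro mult_left_mono) (auto simp: dist_real_def max_def)
    finally show ?thesis .
  qed
  have "negligible (N i)" if "i \<in> Basis" for i
    unfolding N_def
  proof (rule lipschitz_real_AE_differentiable[of L])
    show "L-lipschitz_on UNIV (\<lambda>t. g t \<bullet> i)"
    proof (rule lipschitz_onI)
      fix x y
      have "\<bar>(g x - g y) \<bullet> i\<bar> \<le> norm (g x - g y)" using that by (rule Basis_le_norm)
      then show "dist (g x \<bullet> i) (g y \<bullet> i) \<le> L * dist x y"
        using Lg[of x y] by (simp add: dist_norm inner_diff_left)
    qed (use assms lipschitz_on_nonneg in blast)
  qed
  then have neg: "negligible ((\<Union>i\<in>Basis. N i) \<union> {0})"
    by (intro negligible_Un negligible_Union) auto
  have good: "\<exists>v. (f has_vector_derivative v) (at t within {0..}) \<and> norm v \<le> L"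
    if t: "t \<notin> (\<Union>i\<in>Basis. N i) \<union> {0}" "0 \<le> t" for t
  proof -
    have "t > 0" using t by auto
    have "g differentiable (at t)"
      using t unfolding differentiable_componentwise_within[of g] N_def by auto
    then obtain v where v: "(g has_vector_derivative v) (at t)"
      using vector_derivative_works by blast
    have "(f has_vector_derivative v) (at t within {0..})"
      by (rule has_vector_derivative_transform[OF _ _ has_vector_derivative_at_within[OF v]])
        (use \<open>t > 0\<close> in \<open>auto simp: g_def\<close>)
    moreover have "norm v \<le> L"
    proof (rule lipschitz_norm_vector_derivative_le[OF assms _ _ calculation])
      show "at t within {0..} \<noteq> bot" using \<open>t > 0\<close>
        by (metis at_within_Ici_at_right at_within_interior interior_real_atLeast greaterThan_iff at_neq_bot)
    qed (use t in auto)
    ultimately show ?thesis by blast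
  qed
  have "(\<Union>i\<in>Basis. N i) \<union> {0} \<in> null_sets lebesgue" using neg by (simp add: negligible_iff_null_sets)
  then show ?thesis by (rule AE_I') (use good in blast)
qed

section \<open>Admissible curves and arrival times\<close>

lemma abs_continuous_inner:
  fixes f :: "real \<Rightarrow> 'a::real_inner"
  assumes "abs_continuous_on_interval a b f" "{c..e} \<subseteq> {a..b}"
  shows "abs_continuous_on_interval c e (\<lambda>t. f t \<bullet> u)"
  unfolding abs_continuous_on_interval_def
proof (intro allI impI)
  fix \<epsilon> :: real assume "\<epsilon> > 0"
  then have e: "\<epsilon> / (norm u + 1) > 0" by (simp add: add_nonneg_pos)
  obtain \<delta> where d: "\<delta> > 0" "\<And>D. D division_of \<Union>D \<and> \<Union>D \<subseteq> {a..b} \<and> (\<Sum>k\<in>D. Sup k - Inf k) < \<delta>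
      \<Longrightarrow> (\<Sum>k\<in>D. norm (f (Sup k) - f (Inf k))) < \<epsilon> / (norm u + 1)"
    using assms(1) e unfolding abs_continuous_on_interval_def by meson
  have "(\<Sum>k\<in>D. norm (f (Sup k) \<bullet> u - f (Inf k) \<bullet> u)) < \<epsilon>"
    if D: "D division_of \<Union>D \<and> \<Union>D \<subseteq> {c..e} \<and> (\<Sum>k\<in>D. Sup k - Inf k) < \<delta>" for D
  proof -
    let ?S = "\<Sum>k\<in>D. norm (f (Sup k) - f (Inf k))"
    have "(\<Sum>k\<in>D. norm (f (Sup k) \<bullet> u - f (Inf k) \<bullet> u)) \<le> (\<Sum>k\<in>D. norm (f (Sup k) - f (Inf k)) * norm u)"
      by (intro sum_mono) (metis Cauchy_Schwarz_ineq2 inner_diff_left real_norm_def)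
    also have "\<dots> = ?S * norm u" by (simp add: sum_distrib_right)
    also have "\<dots> \<le> ?S * (norm u + 1)" by (intro mult_left_mono sum_nonneg) auto
    also have "\<dots> < \<epsilon>"
    proof -
      have "\<Union>D \<subseteq> {a..b}" using D assms(2) by (meson order_trans)
      then have "?S < \<epsilon> / (norm u + 1)" using d(2)[of D] D by blast
      then show ?thesis by (simp add: pos_less_divide_eq add_nonneg_pos)
    qed
    finally show ?thesis .
  qed
  then show "\<exists>\<delta>>0. \<forall>D. D division_of \<Union>D \<and> \<Union>D \<subseteq> {c..e} \<and> (\<Sum>k\<in>D. Sup k - Inf k) < \<delta>
      \<longrightarrow> (\<Sum>k\<in>D. norm (f (Sup k) \<bullet> u - f (Inf k) \<bullet> u)) < \<epsilon>" using d(1) by blast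
qed

lemma lipschitz_on_Ici_I:
  fixes f :: "real \<Rightarrow> 'a::metric_space"
  assumes "\<And>T. T \<ge> 0 \<Longrightarrow> L-lipschitz_on {0..T} f"
  shows "L-lipschitz_on {0..} f"
proof (rule lipschitz_onI)
  show "0 \<le> L" using assms[of 0] lipschitz_on_nonneg by blast
  fix x y :: real assume "x \<in> {0..}" "y \<in> {0..}"
  then show "dist (f x) (f y) \<le> L * dist x y"
    using lipschitz_onD[OF assms[of "max x y"], of x y] by auto
qed

text \<open>Absolutely continuous curves are handled by projecting them on their own chord
  \<open>u\<close> and applying the mean value inequality to the resulting real function. The
  converse is almost everywhere differentiability of Lipschitz curves.\<close>

lemma admissible_curves_eq_lipschitz:
  fixes K :: "(real ^ 'n) set"
  shows "admissible_curves K = {\<gamma>. (\<forall>t\<ge>0. \<gamma> t \<in> closure (- K)) \<and> 1-lipschitz_on {0..} \<gamma>}"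
proof (intro equalityI subsetI CollectI conjI)
  fix \<gamma> assume g: "\<gamma> \<in> admissible_curves K"
  then show "\<forall>t\<ge>0. \<gamma> t \<in> closure (- K)" unfolding admissible_curves_def by blast
  have "AE t in lebesgue. 0 \<le> t \<longrightarrow> (\<exists>v. (\<gamma> has_vector_derivative v) (at t within {0..}) \<and> norm v \<le> 1)"
    using g unfolding admissible_curves_def by blast
  then obtain N where "emeasure lebesgue N = 0" "N \<in> sets lebesgue" and N0:
    "{t \<in> space lebesgue. \<not> (0 \<le> t \<longrightarrow> (\<exists>v. (\<gamma> has_vector_derivative v) (at t within {0..}) \<and> norm v \<le> 1))} \<subseteq> N"
    by (rule AE_E)
  then have N: "N \<in> null_sets lebesgue"
    "{t. \<not> (0 \<le> t \<longrightarrow> (\<exists>v. (\<gamma> has_vector_derivative v) (at t within {0..}) \<and> norm v \<le> 1))} \<subseteq> N"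
    by (auto simp: null_sets_def)
  have neg: "negligible N" using N(1) by (simp add: negligible_iff_null_sets)
  have *: "dist (\<gamma> s) (\<gamma> t) \<le> 1 * dist s t" if st: "0 \<le> s" "s \<le> t" for s t
  proof -
    define u where "u = \<gamma> t - \<gamma> s"
    have "abs_continuous_on_interval 0 t \<gamma>" using g st unfolding admissible_curves_def by auto
    then have ac: "abs_continuous_on_interval s t (\<lambda>r. \<gamma> r \<bullet> u)"
      using st by (intro abs_continuous_inner[of 0 t]) auto
    have "\<gamma> t \<bullet> u - \<gamma> s \<bullet> u \<le> norm u * (t - s)"
    proof (rule abs_continuous_mean_value_AE[OF ac \<open>s \<le> t\<close> _ neg])
      fix r assume r: "r \<in> {s..t} - N"
      then have "r \<notin> {t. \<not> (0 \<le> t \<longrightarrow> (\<exists>v. (\<gamma> has_vector_derivative v) (at t within {0..}) \<and> norm v \<le> 1))}"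
        using N(2) by blast
      moreover have "0 \<le> r" using r st by auto
      ultimately obtain v where v: "(\<gamma> has_vector_derivative v) (at r within {0..})" "norm v \<le> 1"
        by auto
      have "(\<gamma> has_vector_derivative v) (at r within {s..t})"
        using v(1) st by (rule_tac has_vector_derivative_within_subset) auto
      then have "((\<lambda>r. \<gamma> r \<bullet> u) has_vector_derivative v \<bullet> u) (at r within {s..t})"
        by (rule bounded_linear.has_vector_derivative[OF bounded_linear_inner_left])
      moreover have "v \<bullet> u \<le> norm u"
        using norm_cauchy_schwarz[of v u] v(2) mult_right_mono[OF v(2), of "norm u"] by simp
      ultimately show "\<exists>v\<le>norm u. ((\<lambda>r. \<gamma> r \<bullet> u) has_real_derivative v) (at r within {s..t})"
        unfolding has_real_derivative_iff_has_vector_derivative by blast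
    qed auto
    moreover have "\<gamma> t \<bullet> u - \<gamma> s \<bullet> u = norm u * norm u"
      unfolding u_def by (simp add: inner_diff_left[symmetric] power2_norm_eq_inner flip: power2_eq_square)
    ultimately have "norm u \<le> t - s" using st by (cases "norm u = 0") auto
    then show ?thesis using st unfolding u_def by (simp add: dist_norm norm_minus_commute)
  qed
  show "1-lipschitz_on {0..} \<gamma>"
  proof (rule lipschitz_on_leI)
    fix x y :: real assume "x \<in> {0..}" "y \<in> {0..}" "x \<le> y"
    then show "dist (\<gamma> x) (\<gamma> y) \<le> 1 * dist x y" using *[of x y] by simp
  qed simp
next
  fix \<gamma> :: "real \<Rightarrow> real ^ 'n"
  assume g: "\<gamma> \<in> {\<gamma>. (\<forall>t\<ge>0. \<gamma> t \<in> closure (- K)) \<and> 1-lipschitz_on {0..} \<gamma>}"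
  then have "abs_continuous_on_interval 0 T \<gamma>" for T
    by (intro lipschitz_imp_abs_continuous[of 1]) (auto intro: lipschitz_on_subset)
  moreover have "AE t in lebesgue. 0 \<le> t \<longrightarrow> (\<exists>v. (\<gamma> has_vector_derivative v) (at t within {0..}) \<and> norm v \<le> 1)"
    using g lipschitz_AE_has_vector_derivative by blast
  ultimately show "\<gamma> \<in> admissible_curves K" using g unfolding admissible_curves_def by blast
qed

text \<open>All passage times of all curves are collected, first arrival or not. The infimum is
  unchanged, and the nested extended-real infimum of \<open>obstacle_dist\<close> becomes a single
  real one.\<close>

definition reach_times :: "(real ^ 'n) set \<Rightarrow> real ^ 'n \<Rightarrow> real ^ 'n \<Rightarrow> real set" where
  "reach_times K k0 x = {t. 0 \<le> t \<and> (\<exists>\<gamma>\<in>admissible_curves K. \<gamma> 0 = x \<and> \<gamma> t = k0)}"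

lemma bdd_below_reach_times: "bdd_below (reach_times K k0 x)"
  by (rule bdd_belowI[of _ 0]) (auto simp: reach_times_def)

lemma obstacle_dist_eq_Inf:
  assumes "reach_times K k0 x \<noteq> {}"
  shows "obstacle_dist K k0 x = Inf (reach_times K k0 x)"
proof -
  have "(INF \<gamma>\<in>{\<gamma>\<in>admissible_curves K. \<gamma> 0 = x}. arrival_time k0 \<gamma>) = (INF t\<in>reach_times K k0 x. ereal t)"
  proof (rule antisym)
    show "(INF \<gamma>\<in>{\<gamma>\<in>admissible_curves K. \<gamma> 0 = x}. arrival_time k0 \<gamma>) \<le> (INF t\<in>reach_times K k0 x. ereal t)"
    proof (rule INF_greatest)
      fix t assume "t \<in> reach_times K k0 x"
      then obtain \<gamma> where g: "0 \<le> t" "\<gamma> \<in> admissible_curves K" "\<gamma> 0 = x" "\<gamma> t = k0"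
        unfolding reach_times_def by blast
      have "arrival_time k0 \<gamma> \<le> ereal t" unfolding arrival_time_def using g by (intro Inf_lower) auto
      then show "(INF \<gamma>\<in>{\<gamma>\<in>admissible_curves K. \<gamma> 0 = x}. arrival_time k0 \<gamma>) \<le> ereal t"
        using g by (intro INF_lower2[of \<gamma>]) auto
    qed
    show "(INF t\<in>reach_times K k0 x. ereal t) \<le> (INF \<gamma>\<in>{\<gamma>\<in>admissible_curves K. \<gamma> 0 = x}. arrival_time k0 \<gamma>)"
      unfolding arrival_time_def
    proof (intro INF_greatest Inf_greatest)
      fix \<gamma> s assume "\<gamma> \<in> {\<gamma> \<in> admissible_curves K. \<gamma> 0 = x}" "s \<in> {ereal t |t. 0 \<le> t \<and> \<gamma> t = k0}"
      then obtain t where "s = ereal t" "t \<in> reach_times K k0 x" unfolding reach_times_def by blast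
      then show "(INF t\<in>reach_times K k0 x. ereal t) \<le> s" by (auto intro: INF_lower)
    qed
  qed
  also have "\<dots> = ereal (Inf (reach_times K k0 x))"
    using ereal_Inf'[OF bdd_below_reach_times assms] by simp
  finally show ?thesis unfolding obstacle_dist_def by simp
qed

lemma reach_times_norm_le:
  assumes "t \<in> reach_times K k0 x"
  shows "norm (x - k0) \<le> t"
proof -
  obtain \<gamma> where g: "0 \<le> t" "1-lipschitz_on {0..} \<gamma>" "\<gamma> 0 = x" "\<gamma> t = k0"
    using assms unfolding reach_times_def admissible_curves_eq_lipschitz by blast
  then show ?thesis using lipschitz_onD[OF g(2), of 0 t] by (simp add: dist_norm)
qed

lemma reach_times_segment:
  fixes y z :: "real ^ 'n"
  assumes "t \<in> reach_times K k0 z" and seg: "closed_segment y z \<subseteq> closure (- K)"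
  shows "norm (y - z) + t \<in> reach_times K k0 y"
proof (cases "y = z")
  case False
  define L where "L = norm (y - z)"
  have L: "L > 0" using False by (simp add: L_def)
  obtain \<gamma> where g: "0 \<le> t" "\<And>t. t \<ge> 0 \<Longrightarrow> \<gamma> t \<in> closure (- K)" "1-lipschitz_on {0..} \<gamma>" "\<gamma> 0 = z" "\<gamma> t = k0"
    using assms(1) unfolding reach_times_def admissible_curves_eq_lipschitz by blast
  define \<eta> where "\<eta> r = (if r \<le> L then y + (r / L) *\<^sub>R (z - y) else \<gamma> (r - L))" for r
  have "1-lipschitz_on {0..T} \<eta>" for T
    unfolding \<eta>_def
  proof (rule lipschitz_on_concat)
    show "1-lipschitz_on {0..L} (\<lambda>r. y + (r / L) *\<^sub>R (z - y))"
    proof (rule lipschitz_onI)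
      fix a b :: real
      have "(a / L) *\<^sub>R (z - y) - (b / L) *\<^sub>R (z - y) = ((a - b) / L) *\<^sub>R (z - y)"
        by (simp add: scaleR_left_diff_distrib diff_divide_distrib)
      then show "dist (y + (a / L) *\<^sub>R (z - y)) (y + (b / L) *\<^sub>R (z - y)) \<le> 1 * dist a b"
        using L by (simp add: dist_norm L_def norm_minus_commute)
    qed simp
    show "1-lipschitz_on {L..T} (\<lambda>r. \<gamma> (r - L))"
    proof (rule lipschitz_onI)
      fix a b assume "a \<in> {L..T}" "b \<in> {L..T}"
      then show "dist (\<gamma> (a - L)) (\<gamma> (b - L)) \<le> 1 * dist a b"
        using lipschitz_onD[OF g(3), of "a - L" "b - L"] by (simp add: dist_real_def)
    qed simp
    show "y + (L / L) *\<^sub>R (z - y) = \<gamma> (L - L)" using L g by simp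
  qed
  then have "1-lipschitz_on {0..} \<eta>" by (rule lipschitz_on_Ici_I)
  moreover have "\<eta> r \<in> closure (- K)" if "r \<ge> 0" for r
  proof (cases "r \<le> L")
    case True
    then have "y + (r / L) *\<^sub>R (z - y) \<in> closed_segment y z"
      using that L unfolding in_segment by (intro exI[of _ "r / L"]) (auto simp: algebra_simps)
    then show ?thesis using True seg by (auto simp: \<eta>_def)
  qed (use g that in \<open>auto simp: \<eta>_def\<close>)
  moreover have "\<eta> 0 = y" "\<eta> (L + t) = k0" using L g by (auto simp: \<eta>_def)
  ultimately show ?thesis
    using L g(1) unfolding reach_times_def admissible_curves_eq_lipschitz L_def by auto
qed (use assms in simp)

text \<open>A curve from inside the ball to \<open>k0\<close> meets the sphere by the intermediate
  value theorem and is cut there. Its first piece is remembered only through its duration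
  \<open>s\<close>, at least the distance of its endpoints.\<close>

lemma reach_times_cross_sphere:
  fixes y c :: "real ^ 'n"
  assumes "T \<in> reach_times K k0 y" "y \<in> ball c r" "k0 \<notin> ball c r"
  obtains z s where "z \<in> sphere c r" "z \<in> closure (- K)" "norm (y - z) \<le> s" "T - s \<in> reach_times K k0 z"
proof -
  obtain \<gamma> where g: "0 \<le> T" "\<And>t. t \<ge> 0 \<Longrightarrow> \<gamma> t \<in> closure (- K)" "1-lipschitz_on {0..} \<gamma>" "\<gamma> 0 = y" "\<gamma> T = k0"
    using assms(1) unfolding reach_times_def admissible_curves_eq_lipschitz by blast
  have "continuous_on {0..T} (\<lambda>t. dist c (\<gamma> t))"
    by (intro continuous_intros continuous_on_subset[OF lipschitz_on_continuous_on[OF g(3)]]) auto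
  then obtain s where s: "0 \<le> s" "s \<le> T" "dist c (\<gamma> s) = r"
    using IVT'[of "\<lambda>t. dist c (\<gamma> t)" 0 r T] g assms by auto
  have "1-lipschitz_on {0..} (\<lambda>t. \<gamma> (s + t))"
  proof (rule lipschitz_onI)
    fix a b :: real assume "a \<in> {0..}" "b \<in> {0..}"
    then show "dist (\<gamma> (s + a)) (\<gamma> (s + b)) \<le> 1 * dist a b"
      using lipschitz_onD[OF g(3), of "s + a" "s + b"] s by (simp add: dist_real_def)
  qed simp
  then have "T - s \<in> reach_times K k0 (\<gamma> s)"
    unfolding reach_times_def admissible_curves_eq_lipschitz using g s
    by (auto intro!: exI[of _ "\<lambda>t. \<gamma> (s + t)"])
  moreover have "norm (y - \<gamma> s) \<le> s" using lipschitz_onD[OF g(3), of 0 s] s g by (simp add: dist_norm)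
  ultimately show ?thesis using that[of "\<gamma> s" s] s g by auto
qed

text \<open>Points joined by a segment off \<open>K\<close> can reach \<open>k0\<close>
  simultaneously or not at all. So reachability is locally constant on the open set
  \<open>- K\<close>, and connectedness spreads it from \<open>k0\<close>.\<close>

lemma reach_times_nonempty:
  fixes K :: "(real ^ 'n) set"
  assumes "closed K" "connected (- K)" "k0 \<in> - K" "x \<in> - K"
  shows "reach_times K k0 x \<noteq> {}"
proof (rule ccontr)
  assume x: "\<not> reach_times K k0 x \<noteq> {}"
  define A where "A = {x \<in> - K. reach_times K k0 x \<noteq> {}}"
  define B where "B = {x \<in> - K. reach_times K k0 x = {}}"
  have seg: "(reach_times K k0 z \<noteq> {}) = (reach_times K k0 y \<noteq> {})" if "closed_segment y z \<subseteq> - K" for y z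
  proof -
    have "closed_segment y z \<subseteq> closure (- K)" "closed_segment z y \<subseteq> closure (- K)"
      using that closure_subset[of "- K"] by (auto simp: closed_segment_commute[of z y])
    then show ?thesis
      using reach_times_segment[of _ K k0 z y] reach_times_segment[of _ K k0 y z] by fast
  qed
  have ball: "\<exists>r>0. ball y r \<subseteq> - K \<and> (\<forall>z\<in>ball y r. (reach_times K k0 z \<noteq> {}) = (reach_times K k0 y \<noteq> {}))" if y: "y \<in> - K" for y
  proof -
    obtain r where r: "r > 0" "ball y r \<subseteq> - K" using assms(1) y by (meson open_Compl openE)
    have "(reach_times K k0 z \<noteq> {}) = (reach_times K k0 y \<noteq> {})" if "z \<in> ball y r" for z
    proof (rule seg)
      have "closed_segment y z \<subseteq> ball y r" using r that by (intro closed_segment_subset) auto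
      then show "closed_segment y z \<subseteq> - K" using r(2) by (rule order_trans)
    qed
    then show ?thesis using r by (intro exI[of _ r] conjI ballI)
  qed
  have "open A"
    unfolding open_contains_ball
  proof
    fix y assume y: "y \<in> A"
    then have yK: "y \<in> - K" by (simp add: A_def)
    from ball[OF yK] obtain r where r: "r > 0" "ball y r \<subseteq> - K"
      "\<forall>z\<in>ball y r. (reach_times K k0 z \<noteq> {}) = (reach_times K k0 y \<noteq> {})"
      by (elim exE conjE)
    have "ball y r \<subseteq> A"
    proof
      fix z assume z: "z \<in> ball y r"
      have "reach_times K k0 y \<noteq> {}" using y unfolding A_def by simp
      then have "reach_times K k0 z \<noteq> {}" using bspec[OF r(3) z] by simp
      then show "z \<in> A" using subsetD[OF r(2) z] unfolding A_def by simp
    qed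
    then show "\<exists>e>0. ball y e \<subseteq> A" using r(1) by (intro exI[of _ r] conjI)
  qed
  have "open B"
    unfolding open_contains_ball
  proof
    fix y assume y: "y \<in> B"
    then have yK: "y \<in> - K" by (simp add: B_def)
    from ball[OF yK] obtain r where r: "r > 0" "ball y r \<subseteq> - K"
      "\<forall>z\<in>ball y r. (reach_times K k0 z \<noteq> {}) = (reach_times K k0 y \<noteq> {})"
      by (elim exE conjE)
    have "ball y r \<subseteq> B"
    proof
      fix z assume z: "z \<in> ball y r"
      have "reach_times K k0 y = {}" using y unfolding B_def by simp
      then have "reach_times K k0 z = {}" using bspec[OF r(3) z] by simp
      then show "z \<in> B" using subsetD[OF r(2) z] unfolding B_def by simp
    qed
    then show "\<exists>e>0. ball y e \<subseteq> B" using r(1) by (intro exI[of _ r] conjI)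
  qed
  have AB: "A \<inter> B \<inter> - K = {}" "- K \<subseteq> A \<union> B" by (auto simp: A_def B_def)
  have "0 \<in> reach_times K k0 k0"
  proof -
    have "(\<lambda>t. k0) \<in> admissible_curves K"
      unfolding admissible_curves_eq_lipschitz using assms(3) closure_subset[of "- K"]
      by (auto intro!: lipschitz_onI)
    then show ?thesis unfolding reach_times_def by (intro CollectI conjI bexI[of _ "\<lambda>t. k0"]) auto
  qed
  then have kA: "k0 \<in> A \<inter> - K" using assms(3) by (simp add: A_def) blast
  have xB: "x \<in> B \<inter> - K" using assms(4) x by (simp add: B_def)
  have "A \<inter> - K = {} \<or> B \<inter> - K = {}"
    by (rule connectedD[OF assms(2) \<open>open A\<close> \<open>open B\<close> AB])
  then show False using kA xB by (metis empty_iff)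
qed

section \<open>Local structure of solutions of the eikonal equation\<close>

lemma GDERIV_along_line_le:
  assumes f: "GDERIV f x :> P" and "\<delta> > 0" and le: "\<And>s. 0 < s \<Longrightarrow> s < \<delta> \<Longrightarrow> f (x + s *\<^sub>R v) \<le> f x + s * c"
  shows "v \<bullet> P \<le> c"
proof (rule ccontr)
  assume "\<not> v \<bullet> P \<le> c"
  have f': "(f has_derivative (\<lambda>h. h \<bullet> P)) (at (x + 0 *\<^sub>R v))" using f by (simp add: gderiv_def)
  have "((\<lambda>s. x + s *\<^sub>R v) has_derivative (\<lambda>h. h *\<^sub>R v)) (at 0)" by (auto intro!: derivative_eq_intros)
  from has_derivative_compose[OF this f']
  have "((\<lambda>s. f (x + s *\<^sub>R v)) has_real_derivative (v \<bullet> P)) (at 0)"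
    unfolding has_field_derivative_def by (simp add: mult_commute_abs)
  then have "((\<lambda>s. f (x + s *\<^sub>R v) - s * c) has_real_derivative (v \<bullet> P - c)) (at 0)"
    by (auto intro!: derivative_eq_intros)
  from DERIV_pos_inc_right[OF this] \<open>\<not> v \<bullet> P \<le> c\<close>
  obtain e where e: "e > 0" "\<And>h. 0 < h \<Longrightarrow> h < e \<Longrightarrow> f x < f (x + h *\<^sub>R v) - h * c" by auto
  define h where "h = min e \<delta> / 2"
  have "0 < h" "h < e" "h < \<delta>" using e(1) \<open>\<delta> > 0\<close> by (auto simp: h_def)
  then show False using e(2)[of h] le[of h] by simp
qed

lemma quadratic_imp_GDERIV:
  fixes p :: "'a::real_inner"
  assumes "\<delta> > 0" "\<And>w. norm (w - y) < \<delta> \<Longrightarrow> \<bar>f w - f y - p \<bullet> (w - y)\<bar> \<le> C * (norm (w - y))\<^sup>2"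
  shows "GDERIV f y :> p"
  unfolding gderiv_def has_derivative_at_alt
proof (intro conjI allI impI)
  show "bounded_linear (\<lambda>h. h \<bullet> p)" by (rule bounded_linear_inner_left)
  fix e :: real assume e: "e > 0"
  have C: "\<bar>C\<bar> + 1 > 0" by linarith
  show "\<exists>d>0. \<forall>w. norm (w - y) < d \<longrightarrow> norm (f w - f y - (w - y) \<bullet> p) \<le> e * norm (w - y)"
  proof (intro exI[of _ "min \<delta> (e / (\<bar>C\<bar> + 1))"] conjI allI impI)
    fix w assume w: "norm (w - y) < min \<delta> (e / (\<bar>C\<bar> + 1))"
    then have "(\<bar>C\<bar> + 1) * norm (w - y) \<le> e" using C by (simp add: field_simps)
    moreover have "C * norm (w - y) \<le> (\<bar>C\<bar> + 1) * norm (w - y)" by (intro mult_right_mono) auto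
    ultimately have "C * norm (w - y) * norm (w - y) \<le> e * norm (w - y)" by (intro mult_right_mono) auto
    then show "norm (f w - f y - (w - y) \<bullet> p) \<le> e * norm (w - y)"
      using assms(2)[of w] w by (simp add: power2_eq_square mult.assoc inner_commute)
  qed (use assms e C in auto)
qed

lemma unit_vectors_eq_iff_inner:
  assumes "norm p = 1" "norm q = 1"
  shows "p = q \<longleftrightarrow> 1 \<le> p \<bullet> q"
proof -
  have "(norm (p - q))\<^sup>2 = 2 - 2 * (p \<bullet> q)"
    using assms unfolding power2_norm_eq_inner by (simp add: inner_diff_left inner_diff_right inner_commute norm_eq_1)
  then show ?thesis
    by (metis diff_ge_0_iff_ge le_numeral_extra(4) mult_2 norm_eq_zero power2_less_eq_zero_iff right_minus_eq diff_le_0_iff_le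
        add_le_cancel_left one_add_one add_mono linorder_not_le add_strict_mono)
qed

text \<open>With \<open>a = p \<bullet> v\<close> and \<open>b\<close> the squared length of the
  part of \<open>v\<close> orthogonal to \<open>p\<close>, the squared norm is
  \<open>(r + a)^2 + b\<close>. Since \<open>|a| \<le> r / 2\<close>, one has
  \<open>b \<le> 2 (r + a) b / r\<close>, so it is at most \<open>(r + a + b / r)^2\<close>. The
  second order term involves only directions orthogonal to \<open>p\<close>.\<close>

lemma norm_shift_le:
  fixes v p :: "'a::real_inner"
  assumes "norm p = 1" "r > 0" "norm v \<le> r / 2"
  shows "norm (v + r *\<^sub>R p) \<le> r + p \<bullet> v + ((norm v)\<^sup>2 - (p \<bullet> v)\<^sup>2) / r"
proof -
  define a where "a = p \<bullet> v"
  have a: "\<bar>a\<bar> \<le> r / 2" using Cauchy_Schwarz_ineq2[of p v] assms unfolding a_def by simp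
  have b: "a\<^sup>2 \<le> (norm v)\<^sup>2" using Cauchy_Schwarz_ineq2[of p v] assms unfolding a_def by (metis abs_le_square_iff abs_norm_cancel mult_1)
  define b where "b = (norm v)\<^sup>2 - a\<^sup>2"
  have "b \<ge> 0" using b b_def by simp
  have "(norm (v + r *\<^sub>R p))\<^sup>2 = (norm v)\<^sup>2 + 2 * r * a + r\<^sup>2"
    using assms(1) unfolding power2_norm_eq_inner a_def
    by (simp add: inner_add_left inner_add_right inner_commute power2_eq_square norm_eq_1 algebra_simps)
  also have "\<dots> = (r + a)\<^sup>2 + b" by (simp add: b_def power2_eq_square algebra_simps)
  also have "\<dots> \<le> (r + a + b / r)\<^sup>2"
  proof -
    have "b \<le> 2 * (r + a) * (b / r)"
    proof -
      have "r * (b / r) \<le> 2 * (r + a) * (b / r)" using a assms(2) \<open>b \<ge> 0\<close> by (intro mult_right_mono) auto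
      then show ?thesis using assms(2) by simp
    qed
    moreover have "(r + a + b / r)\<^sup>2 = (r + a)\<^sup>2 + 2 * (r + a) * (b / r) + (b / r)\<^sup>2" by (simp add: power2_eq_square algebra_simps)
    moreover have "0 \<le> (b / r)\<^sup>2" by simp
    ultimately show ?thesis by linarith
  qed
  finally have "norm (v + r *\<^sub>R p) \<le> r + a + b / r"
    by (rule power2_le_imp_le) (use a assms(2) \<open>b \<ge> 0\<close> in auto)
  then show ?thesis by (simp add: a_def b_def)
qed

lemma hull_halfspace_ge:
  fixes v :: "'a::real_inner"
  assumes "\<And>q. q \<in> B \<Longrightarrow> a \<le> q \<bullet> v" "p \<in> convex hull B"
  shows "a \<le> p \<bullet> v"
proof -
  have "convex hull B \<subseteq> {q. v \<bullet> q \<ge> a}"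
    using assms(1) by (intro hull_minimal convex_halfspace_ge) (auto simp: inner_commute)
  then show ?thesis using assms(2) by (auto simp: inner_commute)
qed

lemma cball_subset_double:
  fixes x0 y :: "'a::real_normed_vector"
  assumes "cball x0 (2 * r) \<subseteq> A" "norm (y - x0) \<le> r"
  shows "cball y r \<subseteq> A"
proof
  fix w assume "w \<in> cball y r"
  then have "norm (w - y) \<le> r" by (simp add: dist_norm norm_minus_commute)
  then have "norm (w - x0) \<le> 2 * r" using norm_triangle_ineq[of "w - y" "y - x0"] assms(2) by simp
  then have "w \<in> cball x0 (2 * r)" by (simp add: dist_norm norm_minus_commute)
  then show "w \<in> A" using assms(1) by blast
qed

text \<open>Moving from a point of norm less than one inside a compact convex set \<open>D\<close> towards
  an outside unit vector, just after the exit point, gives a point whose projection on \<open>D\<close>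
  still has norm less than one.\<close>

lemma exists_outside_with_short_projection:
  fixes D :: "'a::euclidean_space set"
  assumes D: "convex D" "compact D" and m: "m \<in> D" "norm m < 1" and \<theta>: "\<theta> \<notin> D" "norm \<theta> \<le> 1"
  obtains q where "q \<notin> D" "norm (closest_point D q) < 1"
proof -
  define L where "L = {l \<in> {0..1::real}. m + l *\<^sub>R (\<theta> - m) \<in> D}"
  have L0: "0 \<in> L" using m by (simp add: L_def)
  have "closed ({0..1} \<inter> (\<lambda>l. m + l *\<^sub>R (\<theta> - m)) -` D)"
    using compact_imp_closed[OF D(2)] by (intro closed_Int closed_vimage continuous_intros) auto
  moreover have "{0..1} \<inter> (\<lambda>l. m + l *\<^sub>R (\<theta> - m)) -` D = L" by (auto simp: L_def)
  ultimately have "closed L" by simp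
  have bdd: "bdd_above L" by (auto simp: L_def intro: bdd_aboveI[of _ 1])
  define l where "l = Sup L"
  have lL: "l \<in> L" unfolding l_def using closed_contains_Sup[OF _ bdd \<open>closed L\<close>] L0 by blast
  have "l \<noteq> 1" using lL \<theta> by (auto simp: L_def)
  then have l: "0 \<le> l" "l < 1" using lL by (auto simp: L_def)
  define P where "P = m + l *\<^sub>R (\<theta> - m)"
  have PD: "P \<in> D" using lL by (simp add: L_def P_def)
  have nP: "norm P < 1"
  proof -
    have "P = (1 - l) *\<^sub>R m + l *\<^sub>R \<theta>" by (simp add: P_def algebra_simps)
    then have "norm P \<le> (1 - l) * norm m + l * norm \<theta>" using norm_triangle_ineq[of "(1 - l) *\<^sub>R m" "l *\<^sub>R \<theta>"] l by simp
    also have "\<dots> \<le> (1 - l) * norm m + l * 1" using \<theta> l by (intro add_left_mono mult_left_mono) auto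
    also have "\<dots> < (1 - l) * 1 + l * 1" using m l by (intro add_strict_right_mono mult_strict_left_mono) auto
    finally show ?thesis by simp
  qed
  \<comment> \<open>The projection on \<open>D\<close> is 1-Lipschitz and fixes \<open>P\<close>, so
    an overshoot of length less than \<open>1 - norm P\<close> keeps the projection inside the open
    unit ball.\<close>
  define h where "h = min (1 - l) ((1 - norm P) / (norm (\<theta> - m) + 1) / 2)"
  have n1: "norm (\<theta> - m) + 1 > 0" by (simp add: add_nonneg_pos)
  have h: "h > 0" "l + h \<le> 1" using l nP n1 by (auto simp: h_def)
  define q where "q = m + (l + h) *\<^sub>R (\<theta> - m)"
  have "q \<notin> D"
  proof
    assume "q \<in> D"
    then have "l + h \<in> L" using h l by (auto simp: L_def q_def)
    then have "l + h \<le> l" unfolding l_def by (rule cSup_upper[OF _ bdd])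
    then show False using h by simp
  qed
  moreover have "norm (closest_point D q) < 1"
  proof -
    have "dist (closest_point D q) (closest_point D P) \<le> dist q P"
      using D PD by (intro closest_point_lipschitz) (auto intro: compact_imp_closed)
    also have "closest_point D P = P" using PD by (rule closest_point_self)
    also have "q - P = h *\<^sub>R (\<theta> - m)" by (simp add: q_def P_def algebra_simps)
    then have "dist q P = h * norm (\<theta> - m)" using h by (simp add: dist_norm)
    also have "\<dots> < h * (norm (\<theta> - m) + 1)" using h by simp
    also have "\<dots> \<le> ((1 - norm P) / (norm (\<theta> - m) + 1) / 2) * (norm (\<theta> - m) + 1)"
      using n1 by (intro mult_right_mono) (auto simp: h_def)
    also have "\<dots> = (1 - norm P) / 2"
    proof -
      have "a / N / 2 * N = a / 2" if "N > 0" for a N :: real using that by simp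
      then show ?thesis using n1 by blast
    qed
    also have "\<dots> < 1 - norm P" using nP by simp
    finally have "dist (closest_point D q) P < 1 - norm P" .
    then show ?thesis using norm_triangle_sub[of "closest_point D q" P] by (simp add: dist_norm)
  qed
  ultimately show ?thesis using that by blast
qed

text \<open>\<open>d_segment\<close> and \<open>d_sphere\<close> are the two halves of the dynamic
  programming principle. The slack \<open>e\<close> is there because \<open>d\<close> is an infimum
  over curves; compactness of the sphere turns it into an attained minimum in
  \<open>d_sphere_min\<close>.\<close>

locale eikonal =
  fixes \<Omega> :: "(real ^ 'n) set" and k0 :: "real ^ 'n" and d :: "real ^ 'n \<Rightarrow> real"
  assumes open_dom: "open \<Omega>"
    and k0_dom: "k0 \<in> \<Omega>"
    and d_k0: "d k0 = 0"
    and d_ge: "x \<in> \<Omega> \<Longrightarrow> norm (x - k0) \<le> d x"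
    and d_segment: "closed_segment y z \<subseteq> \<Omega> \<Longrightarrow> d y \<le> norm (y - z) + d z"
    and d_sphere: "\<lbrakk>cball c r \<subseteq> \<Omega> - {k0}; y \<in> ball c r; e > 0\<rbrakk> \<Longrightarrow> \<exists>z\<in>sphere c r. norm (y - z) + d z < d y + e"
begin

lemma d_nonneg: "x \<in> \<Omega> \<Longrightarrow> 0 \<le> d x"
  using d_ge[of x] norm_ge_zero[of "x - k0"] by linarith

lemma d_pos: "x \<in> \<Omega> \<Longrightarrow> x \<noteq> k0 \<Longrightarrow> 0 < d x"
  using d_ge[of x] by (metis less_le_trans right_minus_eq zero_less_norm_iff)

lemma d_lipschitz:
  assumes "closed_segment y z \<subseteq> \<Omega>"
  shows "\<bar>d y - d z\<bar> \<le> norm (y - z)"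
  using d_segment[OF assms] d_segment[of z y] assms
  by (simp add: closed_segment_commute norm_minus_commute abs_le_iff)

lemma d_lipschitz_convex:
  assumes "convex S" "S \<subseteq> \<Omega>" "y \<in> S" "z \<in> S"
  shows "\<bar>d y - d z\<bar> \<le> norm (y - z)"
  by (rule d_lipschitz) (use closed_segment_subset assms in blast)

lemma continuous_on_d: "continuous_on \<Omega> d"
proof (rule continuous_onI)
  fix x and e :: real assume x: "x \<in> \<Omega>" "e > 0"
  obtain r where r: "r > 0" "ball x r \<subseteq> \<Omega>" using open_dom x openE by blast
  show "\<exists>\<delta>>0. \<forall>y\<in>\<Omega>. dist y x < \<delta> \<longrightarrow> dist (d y) (d x) \<le> e"
  proof (intro exI[of _ "min r e"] conjI ballI impI)
    fix y assume "y \<in> \<Omega>" "dist y x < min r e"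
    then show "dist (d y) (d x) \<le> e"
      using d_lipschitz_convex[OF convex_ball r(2), of y x] r by (auto simp: dist_norm norm_minus_commute)
  qed (use r x in auto)
qed

lemma tendsto_d: "x \<in> \<Omega> \<Longrightarrow> (f \<longlongrightarrow> x) F \<Longrightarrow> ((\<lambda>i. d (f i)) \<longlongrightarrow> d x) F"
  using continuous_on_d open_dom continuous_on_eq_continuous_at isCont_tendsto_compose by blast

lemma d_sphere_min:
  assumes cb: "cball c r \<subseteq> \<Omega> - {k0}" and y: "y \<in> ball c r"
  obtains z where "z \<in> sphere c r" "d y = norm (y - z) + d z"
proof -
  have S: "sphere c r \<subseteq> \<Omega>" using cb by auto
  have ne: "sphere c r \<noteq> {}" using d_sphere[OF cb y, of 1] by auto
  have cont: "continuous_on (sphere c r) (\<lambda>z. norm (y - z) + d z)"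
    by (intro continuous_intros continuous_on_subset[OF continuous_on_d S])
  obtain z where z: "z \<in> sphere c r" "\<And>w. w \<in> sphere c r \<Longrightarrow> norm (y - z) + d z \<le> norm (y - w) + d w"
    using continuous_attains_inf[OF compact_sphere ne cont] by blast
  have "norm (y - z) + d z \<le> d y"
  proof (rule field_le_epsilon)
    fix e :: real assume "e > 0"
    then obtain w where "w \<in> sphere c r" "norm (y - w) + d w < d y + e" using d_sphere[OF cb y] by blast
    then show "norm (y - z) + d z \<le> d y + e" using z(2)[of w] by linarith
  qed
  moreover have "closed_segment y z \<subseteq> cball c r"
    using y z(1) by (intro closed_segment_subset) auto
  then have "closed_segment y z \<subseteq> \<Omega>" using cb by blast
  then have "d y \<le> norm (y - z) + d z" by (rule d_segment)
  ultimately show ?thesis using that z by simp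
qed

section \<open>Backward directions, superdifferential and semiconcavity\<close>

text \<open>Reversed initial directions of minimal curves, required to be straight for the length
  \<open>r\<close>. As long as the ball of radius \<open>r\<close> misses the obstacle and
  \<open>k0\<close>, the set does not depend on \<open>r\<close> (see
  \<open>reachable_gradients_eq_bdirs\<close>); a common \<open>r\<close> for varying points is what
  makes the graph closed.\<close>

definition bdirs :: "real \<Rightarrow> real ^ 'n \<Rightarrow> (real ^ 'n) set" where
  "bdirs r x = {p. norm p = 1 \<and> d (x - r *\<^sub>R p) = d x - r}"

lemma bdirs_along:
  assumes cb: "cball x r \<subseteq> \<Omega>" and p: "p \<in> bdirs r x" and s: "0 \<le> s" "s \<le> r"
  shows "d (x - s *\<^sub>R p) = d x - s"
proof -
  have np: "norm p = 1" "d (x - r *\<^sub>R p) = d x - r" using p by (auto simp: bdirs_def)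
  have in1: "x - u *\<^sub>R p \<in> cball x r" if "0 \<le> u" "u \<le> r" for u using that np by (auto simp: dist_norm)
  have "d x - d (x - s *\<^sub>R p) \<le> s"
    using d_lipschitz_convex[OF convex_cball cb, of x "x - s *\<^sub>R p"] in1[of s] in1[of 0] s np by auto
  moreover have "(x - s *\<^sub>R p) - (x - r *\<^sub>R p) = (r - s) *\<^sub>R p" by (simp add: algebra_simps)
  then have "d (x - s *\<^sub>R p) - d (x - r *\<^sub>R p) \<le> r - s"
    using d_lipschitz_convex[OF convex_cball cb, of "x - s *\<^sub>R p" "x - r *\<^sub>R p"] in1[of s] in1[of r] s np by auto
  ultimately show ?thesis using np by linarith
qed

lemma bdirs_nonempty:
  assumes "cball x r \<subseteq> \<Omega> - {k0}" "r > 0"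
  shows "bdirs r x \<noteq> {}"
proof -
  obtain z where z: "z \<in> sphere x r" "d x = norm (x - z) + d z"
    using d_sphere_min[OF assms(1), of x] assms(2) by auto
  then have "(1 / r) *\<^sub>R (x - z) \<in> bdirs r x"
    using assms(2) by (auto simp: bdirs_def dist_norm)
  then show ?thesis by auto
qed

lemma compact_bdirs:
  assumes "cball x r \<subseteq> \<Omega>" "0 \<le> r"
  shows "compact (bdirs r x)"
proof -
  have eq: "bdirs r x = {p \<in> sphere 0 1. d (x - r *\<^sub>R p) = d x - r}" by (auto simp: bdirs_def dist_norm)
  have "closed {p \<in> sphere 0 1. d (x - r *\<^sub>R p) = d x - r}"
  proof (rule continuous_closed_preimage_constant)
    show "continuous_on (sphere 0 1) (\<lambda>p. d (x - r *\<^sub>R p))"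
      using assms by (intro continuous_on_compose2[OF continuous_on_d] continuous_intros)
        (auto simp: dist_norm subset_iff)
  qed simp
  then show ?thesis unfolding eq by (metis (no_types, lifting) compact_Int_closed compact_sphere Int_absorb1 mem_Collect_eq subsetI)
qed

lemma bdirs_closed_graph:
  assumes "\<And>i::nat. p i \<in> bdirs r (x i)" "x \<longlonglongrightarrow> y" "p \<longlonglongrightarrow> q" "cball y r \<subseteq> \<Omega>" "0 \<le> r"
  shows "q \<in> bdirs r y"
proof -
  have "(\<lambda>i. norm (p i)) \<longlonglongrightarrow> norm q" using assms(3) by (rule tendsto_norm)
  moreover have "(\<lambda>i. norm (p i)) = (\<lambda>i. 1)" using assms(1) by (auto simp: bdirs_def)
  ultimately have nq: "norm q = 1" using LIMSEQ_unique tendsto_const by metis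
  have "y - r *\<^sub>R q \<in> \<Omega>" "y \<in> \<Omega>" using assms(4,5) nq by (auto simp: dist_norm subset_iff)
  have "(\<lambda>i. d (x i - r *\<^sub>R p i)) \<longlonglongrightarrow> d (y - r *\<^sub>R q)"
    by (rule tendsto_d[OF \<open>y - r *\<^sub>R q \<in> \<Omega>\<close>]) (intro tendsto_intros assms)
  moreover have "(\<lambda>i. d (x i) - r) \<longlonglongrightarrow> d y - r" by (intro tendsto_intros tendsto_d[OF \<open>y \<in> \<Omega>\<close>] assms)
  moreover have "(\<lambda>i. d (x i - r *\<^sub>R p i)) = (\<lambda>i. d (x i) - r)" using assms(1) by (auto simp: bdirs_def)
  ultimately show ?thesis using nq LIMSEQ_unique by (fastforce simp: bdirs_def)
qed

text \<open>Going from \<open>w\<close> straight to \<open>x - r p\<close> competes with the optimum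
  at \<open>w\<close>. The square subtracted in the error term is the missing curvature in the
  direction \<open>p\<close>, on which the deficit estimate of the flow depends.\<close>

lemma bdirs_upper_bound:
  assumes cb: "cball x r \<subseteq> \<Omega>" and r: "r > 0" and p: "p \<in> bdirs r x" and w: "norm (w - x) \<le> r / 2"
  shows "d w \<le> d x + p \<bullet> (w - x) + ((norm (w - x))\<^sup>2 - (p \<bullet> (w - x))\<^sup>2) / r"
proof -
  have np: "norm p = 1" "d (x - r *\<^sub>R p) = d x - r" using p by (auto simp: bdirs_def)
  have "closed_segment w (x - r *\<^sub>R p) \<subseteq> cball x r"
    using w r np by (intro closed_segment_subset) (auto simp: dist_norm norm_minus_commute)
  then have "d w \<le> norm (w - (x - r *\<^sub>R p)) + d (x - r *\<^sub>R p)" using cb by (intro d_segment) blast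
  moreover have "w - (x - r *\<^sub>R p) = (w - x) + r *\<^sub>R p" by simp
  ultimately show ?thesis using norm_shift_le[OF np(1) r w] np by simp
qed

lemma hull_bdirs_norm_le: "p \<in> convex hull (bdirs r x) \<Longrightarrow> norm p \<le> 1"
proof -
  have "convex hull (bdirs r x) \<subseteq> cball 0 1"
    by (rule hull_minimal) (auto simp: bdirs_def dist_norm)
  then show "p \<in> convex hull (bdirs r x) \<Longrightarrow> norm p \<le> 1" by auto
qed

text \<open>The quadratic term is concave in \<^term>\<open>p\<close>, so linearising it at the target value of
  \<^term>\<open>p \<bullet> v\<close> makes the bound affine and lets it pass to the convex hull.\<close>

lemma hull_bdirs_upper_bound:
  assumes cb: "cball x r \<subseteq> \<Omega>" and r: "r > 0" and p: "p \<in> convex hull (bdirs r x)" and w: "norm (w - x) \<le> r / 2"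
  shows "d w \<le> d x + p \<bullet> (w - x) + ((norm (w - x))\<^sup>2 - (p \<bullet> (w - x))\<^sup>2) / r"
proof -
  define v where "v = w - x"
  define c where "c = p \<bullet> v"
  have "d w - d x - ((norm v)\<^sup>2 + c\<^sup>2) / r \<le> q \<bullet> ((1 - 2 * c / r) *\<^sub>R v)" if q: "q \<in> bdirs r x" for q
  proof -
    have "d w \<le> d x + q \<bullet> v + ((norm v)\<^sup>2 - (q \<bullet> v)\<^sup>2) / r"
      using bdirs_upper_bound[OF cb r q w] by (simp add: v_def)
    moreover have "- (q \<bullet> v)\<^sup>2 \<le> c\<^sup>2 - 2 * c * (q \<bullet> v)"
      using zero_le_power2[of "q \<bullet> v - c"] by (simp add: power2_eq_square algebra_simps)
    then have "((norm v)\<^sup>2 - (q \<bullet> v)\<^sup>2) / r \<le> ((norm v)\<^sup>2 + c\<^sup>2 - 2 * c * (q \<bullet> v)) / r"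
      using r by (intro divide_right_mono) auto
    ultimately show ?thesis by (simp add: diff_divide_distrib add_divide_distrib algebra_simps)
  qed
  from hull_halfspace_ge[OF this p]
  have "d w - d x - ((norm v)\<^sup>2 + c\<^sup>2) / r \<le> (1 - 2 * c / r) * c" by (simp add: c_def)
  then show ?thesis unfolding v_def[symmetric] c_def[symmetric]
    by (simp add: power2_eq_square diff_divide_distrib add_divide_distrib algebra_simps)
qed

lemma hull_bdirs_upper_bound':
  assumes cb: "cball x r \<subseteq> \<Omega>" and r: "r > 0" and p: "p \<in> convex hull (bdirs r x)" and w: "norm (w - x) \<le> r / 2"
  shows "d w \<le> d x + p \<bullet> (w - x) + (norm (w - x))\<^sup>2 / r"
proof -
  have "((norm (w - x))\<^sup>2 - (p \<bullet> (w - x))\<^sup>2) / r \<le> (norm (w - x))\<^sup>2 / r"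
    using r by (intro divide_right_mono) auto
  then show ?thesis using hull_bdirs_upper_bound[OF assms] by linarith
qed

definition supergrad :: "real ^ 'n \<Rightarrow> real ^ 'n \<Rightarrow> bool" where
  "supergrad x p \<longleftrightarrow> (\<forall>e>0. \<exists>\<delta>>0. \<forall>w. norm (w - x) < \<delta> \<longrightarrow> d w - d x - p \<bullet> (w - x) \<le> e * norm (w - x))"

text \<open>A Danskin argument. If a direction \<open>e\<close> separates \<open>p\<close> from the
  hull, let \<open>z i\<close> be optimal sphere points for \<open>x + s i e\<close>. They
  accumulate at a point optimal for \<open>x\<close>, which defines some \<open>q\<close> among the
  backward directions. Along \<open>e\<close> the function \<open>d\<close> then grows at the rate
  \<open>e \<bullet> q\<close> at least, too fast for \<open>p\<close> to be a
  supergradient.\<close>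

lemma supergrad_imp_hull:
  assumes cb: "cball x r \<subseteq> \<Omega> - {k0}" and r: "r > 0" and p: "supergrad x p"
  shows "p \<in> convex hull (bdirs r x)"
proof (rule ccontr)
  assume "p \<notin> convex hull (bdirs r x)"
  have cb': "cball x r \<subseteq> \<Omega>" using cb by blast
  have cl: "closed (convex hull (bdirs r x))"
    using compact_bdirs[OF cb'] r compact_convex_hull compact_imp_closed by force
  obtain e b where eb: "e \<bullet> p < b" "\<And>q. q \<in> convex hull (bdirs r x) \<Longrightarrow> b < e \<bullet> q"
    using separating_hyperplane_closed_point[OF convex_convex_hull cl \<open>p \<notin> _\<close>] by blast
  \<comment> \<open>The first bound keeps \<open>x + s i e\<close> inside the ball, the second makes
    \<open>s\<close> tend to zero.\<close>
  define s where "s i = min (r / (2 * (norm e + 1))) (1 / real (Suc i))" for i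
  have e1: "norm e + 1 > 0" by (simp add: add_nonneg_pos)
  have s0: "s i > 0" for i using r e1 by (simp add: s_def)
  have slim: "s \<longlonglongrightarrow> 0"
  proof (rule tendsto_sandwich[OF _ _ tendsto_const lim_inverse_n'])
    show "\<forall>\<^sub>F i in sequentially. 0 \<le> s i" using s0 by (intro always_eventually allI less_imp_le)
    show "\<forall>\<^sub>F i in sequentially. s i \<le> 1 / real i"
      unfolding eventually_sequentially
    proof (intro exI[of _ 1] allI impI)
      fix i :: nat assume "1 \<le> i"
      then have "1 / real (Suc i) \<le> 1 / real i" by (intro divide_left_mono) auto
      then show "s i \<le> 1 / real i" unfolding s_def by linarith
    qed
  qed
  have small: "norm (s i *\<^sub>R e) < r" for i
  proof -
    have "norm (s i *\<^sub>R e) = s i * norm e" using s0[of i] by simp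
    also have "\<dots> \<le> r / (2 * (norm e + 1)) * norm e" by (intro mult_right_mono) (auto simp: s_def)
    also have "\<dots> < r" using r e1 by (simp add: field_simps add_nonneg_pos)
    finally show ?thesis .
  qed
  have "\<exists>z. z \<in> sphere x r \<and> d (x + s i *\<^sub>R e) = norm (x + s i *\<^sub>R e - z) + d z" for i
    using d_sphere_min[OF cb, of "x + s i *\<^sub>R e"] small[of i] by (auto simp: dist_norm)
  then obtain z where z: "\<And>i. z i \<in> sphere x r" "\<And>i. d (x + s i *\<^sub>R e) = norm (x + s i *\<^sub>R e - z i) + d (z i)"
    by metis
  obtain z0 \<phi> where z0: "z0 \<in> sphere x r" "strict_mono (\<phi> :: nat \<Rightarrow> nat)" "(z \<circ> \<phi>) \<longlonglongrightarrow> z0"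
    using compact_sphere[of x r] z(1) unfolding compact_def by metis
  have slim': "(s \<circ> \<phi>) \<longlonglongrightarrow> 0" using LIMSEQ_subseq_LIMSEQ[OF slim z0(2)] .
  have z0O: "z0 \<in> \<Omega>" "x \<in> \<Omega>" using z0(1) cb' r by auto
  have dz0: "d x = norm (x - z0) + d z0"
  proof -
    have "(\<lambda>i. norm (x + (s \<circ> \<phi>) i *\<^sub>R e - (z \<circ> \<phi>) i) + d ((z \<circ> \<phi>) i)) \<longlonglongrightarrow> norm (x + 0 *\<^sub>R e - z0) + d z0"
      by (intro tendsto_intros slim' z0 tendsto_d z0O)
    moreover have "(\<lambda>i. d (x + (s \<circ> \<phi>) i *\<^sub>R e)) \<longlonglongrightarrow> d (x + 0 *\<^sub>R e)"
      using z0O by (intro tendsto_d tendsto_intros slim') auto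
    ultimately show ?thesis using z(2) LIMSEQ_unique by (fastforce simp: comp_def)
  qed
  define q where "q = (1 / r) *\<^sub>R (x - z0)"
  have q: "q \<in> bdirs r x" using z0(1) dz0 r unfolding q_def bdirs_def by (auto simp: dist_norm)
  have zr: "norm (x - z i) = r" for i using z(1)[of i] by (simp add: dist_norm)
  \<comment> \<open>Small enough that \<open>\<epsilon> * norm e\<close> is less than the separation
    gap \<open>b - e \<bullet> p\<close>.\<close>
  define \<epsilon> where "\<epsilon> = (b - e \<bullet> p) / (norm e + 1)"
  have "\<epsilon> > 0" using eb(1) e1 by (simp add: \<epsilon>_def)
  then obtain \<delta> where d: "\<delta> > 0" "\<And>w. norm (w - x) < \<delta> \<Longrightarrow> d w - d x - p \<bullet> (w - x) \<le> \<epsilon> * norm (w - x)"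
    using p unfolding supergrad_def by blast
  have ev: "\<forall>\<^sub>F i in sequentially. (1 / r) * ((x - (z \<circ> \<phi>) i) \<bullet> e) \<le> e \<bullet> p + \<epsilon> * norm e"
  proof -
    have "(\<lambda>i. norm ((s \<circ> \<phi>) i *\<^sub>R e)) \<longlonglongrightarrow> norm (0 *\<^sub>R e)" by (intro tendsto_intros slim')
    then have "\<forall>\<^sub>F i in sequentially. norm ((s \<circ> \<phi>) i *\<^sub>R e) < \<delta>"
      using d(1) by (intro order_tendstoD) auto
    then show ?thesis
    proof eventually_elim
      case (elim i)
      let ?s = "s (\<phi> i)" and ?z = "z (\<phi> i)"
      have s: "?s > 0" by (rule s0)
      have "closed_segment x ?z \<subseteq> cball x r" using z(1)[of "\<phi> i"] r by (intro closed_segment_subset) auto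
      then have "d x \<le> norm (x - ?z) + d ?z" using cb' by (intro d_segment) blast
      then have "norm (x + ?s *\<^sub>R e - ?z) - r \<le> d (x + ?s *\<^sub>R e) - d x"
        using z(2)[of "\<phi> i"] zr[of "\<phi> i"] by simp
      also have "\<dots> \<le> ?s * (p \<bullet> e) + \<epsilon> * (?s * norm e)"
        using d(2)[of "x + ?s *\<^sub>R e"] elim s by simp
      finally have 1: "norm (x + ?s *\<^sub>R e - ?z) \<le> r + ?s * (p \<bullet> e + \<epsilon> * norm e)" by (simp add: algebra_simps)
      \<comment> \<open>Cauchy-Schwarz bounds the shifted norm from below by its linearisation at
        \<open>x - z\<close>, so the norm need not be differentiated.\<close>
      have "(x - ?z) \<bullet> (x + ?s *\<^sub>R e - ?z) \<le> r * norm (x + ?s *\<^sub>R e - ?z)"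
        using norm_cauchy_schwarz[of "x - ?z" "x + ?s *\<^sub>R e - ?z"] zr[of "\<phi> i"] by simp
      also have "\<dots> \<le> r * (r + ?s * (p \<bullet> e + \<epsilon> * norm e))" using 1 r by (intro mult_left_mono) auto
      finally have 2: "(x - ?z) \<bullet> (x + ?s *\<^sub>R e - ?z) \<le> r * r + ?s * (r * (p \<bullet> e + \<epsilon> * norm e))" by (simp add: algebra_simps)
      have "(x - ?z) \<bullet> (x + ?s *\<^sub>R e - ?z) = (x - ?z) \<bullet> (x - ?z) + ?s * ((x - ?z) \<bullet> e)"
        by (simp add: algebra_simps)
      also have "(x - ?z) \<bullet> (x - ?z) = r * r" using zr[of "\<phi> i"] by (simp flip: power2_norm_eq_inner power2_eq_square)
      finally have "?s * ((x - ?z) \<bullet> e) \<le> ?s * (r * (p \<bullet> e + \<epsilon> * norm e))" using 2 by simp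
      then have "(x - ?z) \<bullet> e \<le> r * (p \<bullet> e + \<epsilon> * norm e)" using s by simp
      then show ?case using r by (simp add: field_simps inner_commute)
    qed
  qed
  have "(\<lambda>i. (1 / r) * ((x - (z \<circ> \<phi>) i) \<bullet> e)) \<longlonglongrightarrow> (1 / r) * ((x - z0) \<bullet> e)"
    by (intro tendsto_intros z0)
  then have "(1 / r) * ((x - z0) \<bullet> e) \<le> e \<bullet> p + \<epsilon> * norm e"
    using ev by (intro tendsto_upperbound) auto
  then have "e \<bullet> q \<le> e \<bullet> p + \<epsilon> * norm e" by (simp add: q_def inner_commute)
  moreover have "b < e \<bullet> q" using q by (intro eb(2) hull_inc)
  moreover have "\<epsilon> * norm e < b - e \<bullet> p"
    using e1 eb(1) unfolding \<epsilon>_def by (simp add: field_simps)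
  ultimately show False by linarith
qed

lemma quadratic_imp_supergrad:
  assumes "\<delta> > 0" "\<And>w. norm (w - x) < \<delta> \<Longrightarrow> d w \<le> d x + p \<bullet> (w - x) + C * (norm (w - x))\<^sup>2"
  shows "supergrad x p"
  unfolding supergrad_def
proof (intro allI impI)
  fix e :: real assume e: "e > 0"
  have C: "\<bar>C\<bar> + 1 > 0" by linarith
  show "\<exists>\<delta>>0. \<forall>w. norm (w - x) < \<delta> \<longrightarrow> d w - d x - p \<bullet> (w - x) \<le> e * norm (w - x)"
  proof (intro exI[of _ "min \<delta> (e / (\<bar>C\<bar> + 1))"] conjI allI impI)
    fix w assume w: "norm (w - x) < min \<delta> (e / (\<bar>C\<bar> + 1))"
    then have "(\<bar>C\<bar> + 1) * norm (w - x) \<le> e" using C by (simp add: field_simps)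
    moreover have "C * norm (w - x) \<le> (\<bar>C\<bar> + 1) * norm (w - x)" by (intro mult_right_mono) auto
    ultimately have "C * norm (w - x) * norm (w - x) \<le> e * norm (w - x)" by (intro mult_right_mono) auto
    then show "d w - d x - p \<bullet> (w - x) \<le> e * norm (w - x)"
      using assms(2)[of w] w by (simp add: power2_eq_square mult.assoc)
  qed (use assms e C in auto)
qed

lemma superdifferential_eq_supergrad:
  assumes "x \<in> \<Omega>"
  shows "superdifferential \<Omega> d x = {p. supergrad x p}"
proof -
  obtain r where r: "r > 0" "ball x r \<subseteq> \<Omega>" using assms open_dom openE by blast
  have "Limsup (at x within \<Omega>) (\<lambda>y. ereal ((d y - d x - p \<bullet> (y - x)) / norm (y - x))) \<le> 0 \<longleftrightarrow> supergrad x p" for p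
  proof -
    have "Limsup (at x within \<Omega>) (\<lambda>y. ereal ((d y - d x - p \<bullet> (y - x)) / norm (y - x))) \<le> 0 \<longleftrightarrow>
      (\<forall>e>0. \<forall>\<^sub>F y in at x within \<Omega>. (d y - d x - p \<bullet> (y - x)) / norm (y - x) < e)"
      unfolding Limsup_le_iff
    proof (intro iffI allI impI)
      fix e :: real assume "\<forall>y>0. \<forall>\<^sub>F w in at x within \<Omega>. ereal ((d w - d x - p \<bullet> (w - x)) / norm (w - x)) < y" "e > 0"
      then show "\<forall>\<^sub>F y in at x within \<Omega>. (d y - d x - p \<bullet> (y - x)) / norm (y - x) < e"
        by (metis (mono_tags, lifting) ereal_less(2) less_ereal.simps(1) eventually_mono)
    next
      fix y :: ereal assume e: "\<forall>e>0. \<forall>\<^sub>F y in at x within \<Omega>. (d y - d x - p \<bullet> (y - x)) / norm (y - x) < e" "0 < y"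
      obtain a where a: "0 < ereal a" "ereal a < y" using ereal_dense2[OF e(2)] by blast
      then have "a > 0" by simp
      with e(1) have "\<forall>\<^sub>F y in at x within \<Omega>. (d y - d x - p \<bullet> (y - x)) / norm (y - x) < a" by blast
      then show "\<forall>\<^sub>F w in at x within \<Omega>. ereal ((d w - d x - p \<bullet> (w - x)) / norm (w - x)) < y"
        by eventually_elim (use a in \<open>meson less_ereal.simps(1) less_trans\<close>)
    qed
    also have "\<dots> \<longleftrightarrow> supergrad x p"
    proof
      assume *: "\<forall>e>0. \<forall>\<^sub>F y in at x within \<Omega>. (d y - d x - p \<bullet> (y - x)) / norm (y - x) < e"
      show "supergrad x p" unfolding supergrad_def
      proof (intro allI impI)
        fix e :: real assume "e > 0"
        with * obtain \<delta> where d: "\<delta> > 0" "\<And>y. y \<in> \<Omega> \<Longrightarrow> y \<noteq> x \<Longrightarrow> dist y x < \<delta> \<Longrightarrow> (d y - d x - p \<bullet> (y - x)) / norm (y - x) < e"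
          unfolding eventually_at by metis
        show "\<exists>\<delta>>0. \<forall>w. norm (w - x) < \<delta> \<longrightarrow> d w - d x - p \<bullet> (w - x) \<le> e * norm (w - x)"
        proof (intro exI[of _ "min \<delta> r"] conjI allI impI)
          fix w assume w: "norm (w - x) < min \<delta> r"
          show "d w - d x - p \<bullet> (w - x) \<le> e * norm (w - x)"
          proof (cases "w = x")
            case False
            have "w \<in> \<Omega>" using r w by (auto simp: dist_norm norm_minus_commute)
            then show ?thesis using d(2)[of w] w False by (simp add: dist_norm pos_divide_less_eq less_imp_le)
          qed simp
        qed (use d r in auto)
      qed
    next
      assume *: "supergrad x p"
      show "\<forall>e>0. \<forall>\<^sub>F y in at x within \<Omega>. (d y - d x - p \<bullet> (y - x)) / norm (y - x) < e"
      proof (intro allI impI)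
        fix e :: real assume "e > 0"
        then obtain \<delta> where d: "\<delta> > 0" "\<And>w. norm (w - x) < \<delta> \<Longrightarrow> d w - d x - p \<bullet> (w - x) \<le> (e / 2) * norm (w - x)"
          using * unfolding supergrad_def by (meson half_gt_zero)
        show "\<forall>\<^sub>F y in at x within \<Omega>. (d y - d x - p \<bullet> (y - x)) / norm (y - x) < e"
          unfolding eventually_at
        proof (intro exI[of _ \<delta>] conjI ballI impI)
          fix y assume y: "y \<in> \<Omega>" "y \<noteq> x \<and> dist y x < \<delta>"
          then have n: "norm (y - x) > 0" by simp
          have "d y - d x - p \<bullet> (y - x) \<le> (e / 2) * norm (y - x)" using d(2) y by (simp add: dist_norm)
          also have "\<dots> < e * norm (y - x)" using n \<open>e > 0\<close> by simp
          finally show "(d y - d x - p \<bullet> (y - x)) / norm (y - x) < e" using n by (simp add: pos_divide_less_eq)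
        qed (rule d(1))
      qed
    qed
    finally show ?thesis .
  qed
  then show ?thesis unfolding superdifferential_def by auto
qed

section \<open>Reachable gradients and singular points\<close>

text \<open>Along the optimal segment to the sphere, with unit direction \<open>e\<close>, the
  function \<open>d\<close> decreases at unit rate, so \<open>e \<bullet> P \<le> -1\<close>. Being
  1-Lipschitz, \<open>d\<close> has \<open>norm P \<le> 1\<close>. Together these force
  \<open>P = - e\<close>.\<close>

lemma gradient_back_segment:
  assumes cb: "cball c r \<subseteq> \<Omega> - {k0}" and X: "X \<in> ball c r" and P: "GDERIV d X :> P"
  obtains z where "z \<in> sphere c r" "d X = norm (X - z) + d z" "X - z = norm (X - z) *\<^sub>R P" "norm P = 1"
proof -
  obtain z where z: "z \<in> sphere c r" "d X = norm (X - z) + d z" by (rule d_sphere_min[OF cb X])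
  define L where "L = norm (X - z)"
  have "X \<noteq> z" using z(1) X by auto
  then have L: "L > 0" by (simp add: L_def)
  define e where "e = (1 / L) *\<^sub>R (z - X)"
  have e: "norm e = 1" "z = X + L *\<^sub>R e" using L by (auto simp: e_def L_def norm_minus_commute)
  have cb': "cball c r \<subseteq> \<Omega>" using cb by blast
  have "e \<bullet> P \<le> -1"
  proof (rule GDERIV_along_line_le[OF P L])
    fix s assume s: "0 < s" "s < L"
    have "X + s *\<^sub>R e \<in> closed_segment X z"
      unfolding in_segment using s L by (intro exI[of _ "s / L"]) (auto simp: e_def algebra_simps)
    then have "closed_segment (X + s *\<^sub>R e) z \<subseteq> closed_segment X z" by (simp add: subset_closed_segment)
    also have "\<dots> \<subseteq> cball c r" using X z(1) by (intro closed_segment_subset) auto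
    finally have "d (X + s *\<^sub>R e) \<le> norm (X + s *\<^sub>R e - z) + d z" using cb' by (intro d_segment) blast
    also have "X + s *\<^sub>R e - z = (s - L) *\<^sub>R e" using e(2) by (simp add: algebra_simps)
    finally show "d (X + s *\<^sub>R e) \<le> d X + s * -1" using z(2) e(1) s by (simp add: L_def)
  qed
  moreover have "norm P \<le> 1"
  proof -
    obtain \<delta> where \<delta>: "\<delta> > 0" "ball X \<delta> \<subseteq> ball c r" using X openE[OF open_ball] by blast
    have "P \<bullet> P \<le> norm P"
    proof (rule GDERIV_along_line_le[OF P, of "\<delta> / (norm P + 1)"])
      show "\<delta> / (norm P + 1) > 0" using \<delta>(1) by (simp add: add_nonneg_pos)
      fix s assume s: "0 < s" "s < \<delta> / (norm P + 1)"
      have "s * (norm P + 1) < \<delta>" using s(2) by (simp add: pos_less_divide_eq add_nonneg_pos)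
      then have "s * norm P < \<delta>" using s(1) by (simp add: algebra_simps)
      then have "X + s *\<^sub>R P \<in> ball c r" using \<delta>(2) s by (auto simp: dist_norm subset_iff)
      then show "d (X + s *\<^sub>R P) \<le> d X + s * norm P"
        using d_lipschitz_convex[OF convex_cball cb', of "X + s *\<^sub>R P" X] X s by auto
    qed
    then have "norm P * norm P \<le> norm P * 1" by (simp flip: power2_norm_eq_inner power2_eq_square)
    then show ?thesis by (metis mult_le_cancel_left_pos norm_ge_zero zero_le_one le_less)
  qed
  moreover have "(norm (P + e))\<^sup>2 = (norm P)\<^sup>2 + 2 * (e \<bullet> P) + 1"
    using e(1) unfolding power2_norm_eq_inner by (simp add: inner_add_left inner_add_right inner_commute norm_eq_1)
  moreover have "(norm P)\<^sup>2 \<le> 1" using \<open>norm P \<le> 1\<close> by (simp add: power_le_one)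
  ultimately have "(norm (P + e))\<^sup>2 \<le> 0" by linarith
  then have Pe: "P = - e" by (simp add: eq_neg_iff_add_eq_0)
  have "X - z = - (L *\<^sub>R e)" by (simp add: e(2))
  then have "X - z = norm (X - z) *\<^sub>R P" using Pe by (simp add: L_def)
  moreover have "norm P = 1" using Pe e(1) by simp
  ultimately show ?thesis using that z by blast
qed

text \<open>At an interior point of a minimal segment \<open>d\<close> is squeezed. The far end
  \<open>x - r p\<close> provides an upper bound, the near end \<open>x\<close> with the Lipschitz
  property a lower bound; both touch \<open>d\<close> there, with gradient \<open>p\<close> and
  quadratic error.\<close>

lemma GDERIV_interior_of_back_segment:
  assumes cb: "cball x r \<subseteq> \<Omega>" and p: "p \<in> bdirs r x" and s: "0 < s" "s < r"
  shows "GDERIV d (x - s *\<^sub>R p) :> p"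
proof -
  define y where "y = x - s *\<^sub>R p"
  have np: "norm p = 1" "d (x - r *\<^sub>R p) = d x - r" using p by (auto simp: bdirs_def)
  have dy: "d y = d x - s" unfolding y_def using s by (intro bdirs_along[OF cb p]) auto
  define m where "m = min s (r - s)"
  have m: "m > 0" "m \<le> s" "m \<le> r - s" using s by (auto simp: m_def)
  show ?thesis unfolding y_def[symmetric]
  proof (rule quadratic_imp_GDERIV[of "m / 2"])
    show "m / 2 > 0" using m by simp
    fix w assume w: "norm (w - y) < m / 2"
    define v where "v = w - y"
    have yx: "norm (x - y) = s" using np s by (simp add: y_def)
    have inw: "w \<in> cball x r" using norm_triangle_sub[of "x - w" "x - y"] w m yx
      by (simp add: dist_norm norm_minus_commute)
    have up: "d w \<le> norm (v + (r - s) *\<^sub>R p) + (d x - r)"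
    proof -
      have "closed_segment w (x - r *\<^sub>R p) \<subseteq> cball x r"
        using inw np s by (intro closed_segment_subset) (auto simp: dist_norm)
      then have "d w \<le> norm (w - (x - r *\<^sub>R p)) + d (x - r *\<^sub>R p)" using cb by (intro d_segment) blast
      moreover have "w - (x - r *\<^sub>R p) = v + (r - s) *\<^sub>R p" by (simp add: v_def y_def algebra_simps)
      ultimately show ?thesis using np by simp
    qed
    have lo: "d x - norm (v + s *\<^sub>R (- p)) \<le> d w"
    proof -
      have "\<bar>d x - d w\<bar> \<le> norm (x - w)" using inw s by (intro d_lipschitz_convex[OF convex_cball cb]) auto
      moreover have "w - x = v + s *\<^sub>R (- p)" by (simp add: v_def y_def)
      ultimately show ?thesis by (metis abs_le_D1 diff_le_eq add.commute norm_minus_commute)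
    qed
    have wv: "norm v \<le> (r - s) / 2" "norm v \<le> s / 2" using w m by (auto simp: v_def)
    have v2: "((norm v)\<^sup>2 - c) / t \<le> (1 / m) * (norm v)\<^sup>2" if "c \<ge> 0" "m \<le> t" for c t
    proof -
      have "((norm v)\<^sup>2 - c) / t \<le> (norm v)\<^sup>2 / t" using that m by (intro divide_right_mono) auto
      also have "\<dots> \<le> (norm v)\<^sup>2 / m" using that m by (intro divide_left_mono) auto
      finally show ?thesis by simp
    qed
    have "d w \<le> d y + p \<bullet> v + (1 / m) * (norm v)\<^sup>2"
      using up norm_shift_le[OF np(1) _ wv(1)] v2[of "(p \<bullet> v)\<^sup>2" "r - s"] m s dy by auto
    moreover have "d y + p \<bullet> v - (1 / m) * (norm v)\<^sup>2 \<le> d w"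
      using lo norm_shift_le[of "- p" s v] v2[of "(p \<bullet> v)\<^sup>2" s] wv m s dy np by auto
    ultimately show "\<bar>d w - d y - p \<bullet> (w - y)\<bar> \<le> (1 / m) * (norm (w - y))\<^sup>2"
      unfolding v_def by linarith
  qed
qed

text \<open>Gradients at points near \<open>x\<close> come with optimal segments to the sphere
  around \<open>x\<close>, and optimality passes to the limit. Conversely, a backward direction
  \<open>p\<close> is itself the gradient at the points \<open>x - s p\<close>, which tend to
  \<open>x\<close>.\<close>

lemma reachable_gradients_eq_bdirs:
  assumes cb: "cball x r \<subseteq> \<Omega> - {k0}" and r: "r > 0"
  shows "reachable_gradients \<Omega> d x = bdirs r x"
proof (intro equalityI subsetI)
  have cb': "cball x r \<subseteq> \<Omega>" using cb by blast
  fix p assume "p \<in> reachable_gradients \<Omega> d x"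
  then obtain X P where XP: "\<And>h::nat. GDERIV d (X h) :> P h" "X \<longlonglongrightarrow> x" "P \<longlonglongrightarrow> p"
    unfolding reachable_gradients_def by blast
  have "\<forall>\<^sub>F h in sequentially. X h \<in> ball x r" using XP(2) r by (metis centre_in_ball open_ball topological_tendstoD)
  then obtain N where N: "\<And>h. h \<ge> N \<Longrightarrow> X h \<in> ball x r" unfolding eventually_sequentially by blast
  define Y Q where "Y h = X (h + N)" and "Q h = P (h + N)" for h
  have YQ: "Y \<longlonglongrightarrow> x" "Q \<longlonglongrightarrow> p" unfolding Y_def Q_def using XP by (auto intro: LIMSEQ_ignore_initial_segment)
  have "\<exists>z. z \<in> sphere x r \<and> d (Y h) = norm (Y h - z) + d z \<and> Y h - z = norm (Y h - z) *\<^sub>R Q h \<and> norm (Q h) = 1" for h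
    using gradient_back_segment[OF cb N XP(1), of "h + N"] unfolding Y_def Q_def by fastforce
  then obtain z where z: "\<And>h. z h \<in> sphere x r" "\<And>h. d (Y h) = norm (Y h - z h) + d (z h)"
    "\<And>h. Y h - z h = norm (Y h - z h) *\<^sub>R Q h" "\<And>h. norm (Q h) = 1" by metis
  have np: "norm p = 1"
  proof (rule LIMSEQ_unique)
    show "(\<lambda>h. norm (Q h)) \<longlonglongrightarrow> norm p" by (intro tendsto_intros YQ)
    show "(\<lambda>h. norm (Q h)) \<longlonglongrightarrow> 1" using z(4) by simp
  qed
  have len: "(\<lambda>h. norm (Y h - z h)) \<longlonglongrightarrow> r"
  proof (rule LIM_zero_cancel, rule Lim_null_comparison)
    show "(\<lambda>h. norm (Y h - x)) \<longlonglongrightarrow> 0" using YQ(1) by (simp add: LIM_zero tendsto_norm_zero)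
    have "norm (norm (Y h - z h) - r) \<le> norm (Y h - x)" for h
    proof -
      have "norm (x - z h) = r" using z(1)[of h] by (simp add: dist_norm)
      moreover have "\<bar>norm (Y h - z h) - norm (x - z h)\<bar> \<le> norm ((Y h - z h) - (x - z h))" by (rule norm_triangle_ineq3)
      ultimately show ?thesis by simp
    qed
    then show "\<forall>\<^sub>F h in sequentially. norm (norm (Y h - z h) - r) \<le> norm (Y h - x)" by simp
  qed
  have "(\<lambda>h. Y h - norm (Y h - z h) *\<^sub>R Q h) \<longlonglongrightarrow> x - r *\<^sub>R p" by (intro tendsto_intros YQ len)
  moreover have "Y h - norm (Y h - z h) *\<^sub>R Q h = z h" for h using z(3)[of h] by (simp add: algebra_simps)
  ultimately have zl: "z \<longlonglongrightarrow> x - r *\<^sub>R p" by simp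
  have in2: "x - r *\<^sub>R p \<in> \<Omega>" "x \<in> \<Omega>" using cb' np r by (auto simp: dist_norm subset_iff)
  have "(\<lambda>h. norm (Y h - z h) + d (z h)) \<longlonglongrightarrow> r + d (x - r *\<^sub>R p)"
    by (intro tendsto_intros len tendsto_d in2 zl)
  moreover have "(\<lambda>h. d (Y h)) \<longlonglongrightarrow> d x" by (intro tendsto_d in2 YQ)
  ultimately have "d x = r + d (x - r *\<^sub>R p)" using z(2) LIMSEQ_unique by simp
  then show "p \<in> bdirs r x" using np by (simp add: bdirs_def)
next
  have cb': "cball x r \<subseteq> \<Omega>" using cb by blast
  fix p assume p: "p \<in> bdirs r x"
  \<comment> \<open>Two successors, so that already the first point lies strictly inside the
    segment.\<close>
  define s where "s h = r / real (Suc (Suc h))" for h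
  have s: "0 < s h" "s h < r" for h using r by (auto simp: s_def field_simps add_pos_nonneg)
  have "s \<longlonglongrightarrow> 0" unfolding s_def
    using LIMSEQ_Suc[OF LIMSEQ_Suc[OF lim_const_over_n[of r]]] by simp
  then have "(\<lambda>h. x - s h *\<^sub>R p) \<longlonglongrightarrow> x - 0 *\<^sub>R p" by (intro tendsto_intros)
  moreover have "x - s h *\<^sub>R p \<in> \<Omega>" for h
    using s[of h] p cb' by (auto simp: bdirs_def dist_norm subset_iff)
  ultimately show "p \<in> reachable_gradients \<Omega> d x"
    unfolding reachable_gradients_def using GDERIV_interior_of_back_segment[OF cb' p] s
    by (intro CollectI exI[of _ "\<lambda>h. x - s h *\<^sub>R p"] exI[of _ "\<lambda>h. p"]) auto
qed

definition singular :: "real ^ 'n \<Rightarrow> bool" where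
  "singular x \<longleftrightarrow> (\<exists>p q. p \<in> reachable_gradients \<Omega> d x \<and> q \<in> reachable_gradients \<Omega> d x \<and> p \<noteq> q)"

lemma singularI_hull:
  assumes cb: "cball x r \<subseteq> \<Omega> - {k0}" and r: "r > 0" and p: "p \<in> convex hull (bdirs r x)" "norm p < 1"
  shows "singular x"
proof (rule ccontr)
  assume "\<not> singular x"
  then have eq: "\<And>p q. p \<in> bdirs r x \<Longrightarrow> q \<in> bdirs r x \<Longrightarrow> p = q"
    unfolding singular_def reachable_gradients_eq_bdirs[OF cb r] by blast
  obtain q where q: "q \<in> bdirs r x" using bdirs_nonempty[OF cb r] by blast
  then have "bdirs r x = {q}" using eq by blast
  then have "p = q" using p by simp
  then show False using q p by (simp add: bdirs_def)
qed

lemma singularE_hull: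
  assumes cb: "cball x r \<subseteq> \<Omega> - {k0}" and r: "r > 0" and "singular x"
  obtains p where "p \<in> convex hull (bdirs r x)" "norm p < 1"
proof -
  obtain p q where pq: "p \<in> bdirs r x" "q \<in> bdirs r x" "p \<noteq> q"
    using assms(3) unfolding singular_def reachable_gradients_eq_bdirs[OF cb r] by blast
  have n: "norm p = 1" "norm q = 1" using pq by (auto simp: bdirs_def)
  define m where "m = (1/2) *\<^sub>R p + (1/2) *\<^sub>R q"
  have "m \<in> convex hull (bdirs r x)"
    unfolding m_def by (intro convexD[OF convex_convex_hull] hull_inc pq) auto
  moreover have "(norm m)\<^sup>2 = 1 / 2 + (p \<bullet> q) / 2"
    using n unfolding m_def power2_norm_eq_inner
    by (simp add: inner_add_left inner_add_right inner_commute norm_eq_1)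
  then have "(norm m)\<^sup>2 < 1" using unit_vectors_eq_iff_inner[OF n] pq(3) by simp
  then have "norm m < 1" by (simp add: power_less_one_iff abs_square_less_1)
  ultimately show ?thesis using that by blast
qed

text \<open>Two different backward directions at the limit \<open>y\<close> are needed. Take any
  \<open>b\<close> there. A hull all of whose generators satisfied
  \<open>q \<bullet> b > \<kappa>\<close> could not contain a vector of norm at most
  \<open>\<kappa>\<close>, so each \<open>x i\<close> has a backward direction \<open>q i\<close>
  with \<open>q i \<bullet> b \<le> \<kappa>\<close>. A limit of these differs from
  \<open>b\<close>.\<close>

lemma singular_limit:
  assumes cb: "cball y r \<subseteq> \<Omega> - {k0}" and r: "r > 0" and "x \<longlonglongrightarrow> y"
    and p: "\<And>i::nat. p i \<in> convex hull (bdirs r (x i))" "\<And>i. norm (p i) \<le> \<kappa>" and "\<kappa> < 1"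
  shows "singular y"
proof -
  obtain b where b: "b \<in> bdirs r y" using bdirs_nonempty[OF cb r] by blast
  then have nb: "norm b = 1" by (simp add: bdirs_def)
  have "\<exists>q\<in>bdirs r (x i). q \<bullet> b \<le> \<kappa>" for i
  proof (rule ccontr)
    assume "\<not> (\<exists>q\<in>bdirs r (x i). q \<bullet> b \<le> \<kappa>)"
    then have "bdirs r (x i) \<subseteq> {q. b \<bullet> q > \<kappa>}" by (auto simp: inner_commute not_le)
    then have "convex hull (bdirs r (x i)) \<subseteq> {q. b \<bullet> q > \<kappa>}" by (intro hull_minimal convex_halfspace_gt) auto
    then have "\<kappa> < b \<bullet> p i" using p(1) by blast
    also have "\<dots> \<le> norm (p i)" using norm_cauchy_schwarz[of b "p i"] nb by simp
    finally show False using p(2)[of i] by simp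
  qed
  then obtain q where q: "\<And>i. q i \<in> bdirs r (x i)" "\<And>i. q i \<bullet> b \<le> \<kappa>" by metis
  have "\<And>i. q i \<in> sphere 0 1" using q(1) by (auto simp: bdirs_def)
  then obtain q0 \<phi> where q0: "strict_mono (\<phi> :: nat \<Rightarrow> nat)" "(q \<circ> \<phi>) \<longlonglongrightarrow> q0"
    using compact_sphere[of "0 :: real ^ 'n" 1] unfolding compact_def by blast
  have "q0 \<in> bdirs r y"
  proof (rule bdirs_closed_graph[of "q \<circ> \<phi>" r "x \<circ> \<phi>"])
    show "(q \<circ> \<phi>) i \<in> bdirs r ((x \<circ> \<phi>) i)" for i using q(1) by simp
    show "(x \<circ> \<phi>) \<longlonglongrightarrow> y" by (rule LIMSEQ_subseq_LIMSEQ[OF assms(3) q0(1)])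
  qed (use q0 cb r in auto)
  moreover have "q0 \<bullet> b \<le> \<kappa>"
  proof (rule LIMSEQ_le_const2)
    show "(\<lambda>i. (q \<circ> \<phi>) i \<bullet> b) \<longlonglongrightarrow> q0 \<bullet> b" by (intro tendsto_intros q0)
  qed (use q(2) in auto)
  then have "q0 \<noteq> b" using nb \<open>\<kappa> < 1\<close> by (auto simp: norm_eq_1)
  ultimately show ?thesis using b unfolding singular_def reachable_gradients_eq_bdirs[OF cb r] by blast
qed

section \<open>Prolongation of backward rays\<close>

text \<open>Minimal segments do not branch. Suppose the ray is minimal up to \<open>y\<close>, and
  let \<open>q\<close> be any backward direction at \<open>y\<close>. Then \<open>d\<close> changes
  by \<open>2 \<eta>\<close> between \<open>y + \<eta> p\<close> and \<open>y - \<eta> q\<close>, so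
  these points are at distance at least \<open>2 \<eta>\<close> and \<open>q = p\<close>. Hence the
  ray stays minimal beyond \<open>y\<close>, and there is no first failure.\<close>

lemma bdirs_ray_extends:
  assumes cb: "cball x r \<subseteq> \<Omega> - {k0}" and r: "r > 0" and p: "p \<in> bdirs r x"
    and vis: "\<And>s. 0 \<le> s \<Longrightarrow> s < \<rho> \<Longrightarrow> x - s *\<^sub>R p \<in> \<Omega> - {k0}" and t: "0 \<le> t" "t < \<rho>"
  shows "d (x - t *\<^sub>R p) = d x - t"
proof (rule ccontr)
  assume neq: "d (x - t *\<^sub>R p) \<noteq> d x - t"
  have cb': "cball x r \<subseteq> \<Omega>" using cb by blast
  have np: "norm p = 1" using p by (simp add: bdirs_def)
  define F where "F = {s. 0 \<le> s \<and> s < \<rho> \<and> d (x - s *\<^sub>R p) \<noteq> d x - s}"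
  have F: "t \<in> F" "bdd_below F" using neq t by (auto simp: F_def intro: bdd_belowI)
  define \<sigma> where "\<sigma> = Inf F"
  have Fr: "r \<le> s" if "s \<in> F" for s
    using that bdirs_along[OF cb' p, of s] by (force simp: F_def)
  then have "r \<le> \<sigma>" unfolding \<sigma>_def using F by (intro cInf_greatest) auto
  have "\<sigma> \<le> t" unfolding \<sigma>_def using F by (rule cInf_lower)
  have good: "d (x - s *\<^sub>R p) = d x - s" if "0 \<le> s" "s < \<sigma>" for s
  proof (rule ccontr)
    assume "\<not> ?thesis"
    then have "s \<in> F" using that \<open>\<sigma> \<le> t\<close> t by (auto simp: F_def)
    then have "\<sigma> \<le> s" unfolding \<sigma>_def using F(2) by (rule cInf_lower)
    then show False using that by simp
  qed
  define y where "y = x - \<sigma> *\<^sub>R p"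
  have y: "y \<in> \<Omega> - {k0}" unfolding y_def using vis \<open>r \<le> \<sigma>\<close> r \<open>\<sigma> \<le> t\<close> t by simp
  have dy: "d y = d x - \<sigma>"
  proof -
    define s where "s n = \<sigma> - \<sigma> / real (Suc n)" for n
    have s: "0 \<le> s n" "s n < \<sigma>" for n using r \<open>r \<le> \<sigma>\<close> by (auto simp: s_def field_simps)
    have sl: "s \<longlonglongrightarrow> \<sigma> - 0" unfolding s_def
      by (intro tendsto_intros LIMSEQ_Suc[OF lim_const_over_n])
    have "(\<lambda>n. d (x - s n *\<^sub>R p)) \<longlonglongrightarrow> d y"
      using y by (intro tendsto_d) (auto simp: y_def intro!: tendsto_intros sl[simplified])
    moreover have "(\<lambda>n. d x - s n) \<longlonglongrightarrow> d x - (\<sigma> - 0)" by (intro tendsto_intros sl)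
    ultimately show ?thesis using good s LIMSEQ_unique by simp
  qed
  have "open (\<Omega> - {k0})" using open_dom by (intro open_Diff) auto
  then obtain \<eta>0 where e0: "\<eta>0 > 0" "cball y \<eta>0 \<subseteq> \<Omega> - {k0}" using y open_contains_cball by blast
  \<comment> \<open>The bound by \<open>\<sigma>\<close> keeps \<open>y + \<eta> p\<close> on the
    part of the ray already known to be minimal.\<close>
  define \<eta> where "\<eta> = min \<eta>0 \<sigma>"
  have e: "\<eta> > 0" "\<eta> \<le> \<sigma>" "cball y \<eta> \<subseteq> \<Omega> - {k0}" using e0 r \<open>r \<le> \<sigma>\<close> by (auto simp: \<eta>_def)
  then have ecb: "cball y \<eta> \<subseteq> \<Omega>" by blast
  obtain q where q: "q \<in> bdirs \<eta> y" using bdirs_nonempty[OF e(3,1)] by blast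
  have nq: "norm q = 1" "d (y - \<eta> *\<^sub>R q) = d y - \<eta>" using q by (auto simp: bdirs_def)
  have "d (y + \<eta> *\<^sub>R p) = d y + \<eta>"
    using good[of "\<sigma> - \<eta>"] e dy by (simp add: y_def algebra_simps)
  moreover have "d (y + \<eta> *\<^sub>R p) - d (y - \<eta> *\<^sub>R q) \<le> norm ((y + \<eta> *\<^sub>R p) - (y - \<eta> *\<^sub>R q))"
    using d_lipschitz_convex[OF convex_cball ecb, of "y + \<eta> *\<^sub>R p" "y - \<eta> *\<^sub>R q"] np nq e(1) by (simp add: dist_norm)
  moreover have "(y + \<eta> *\<^sub>R p) - (y - \<eta> *\<^sub>R q) = \<eta> *\<^sub>R (p + q)" by (simp add: algebra_simps)
  ultimately have "2 * \<eta> \<le> \<eta> * norm (p + q)" using nq e by simp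
  then have "2 \<le> norm (p + q)" using e by simp
  then have "2\<^sup>2 \<le> (norm (p + q))\<^sup>2" by (intro power_mono) auto
  moreover have "(norm (p + q))\<^sup>2 = 2 + 2 * (p \<bullet> q)"
    using np nq unfolding power2_norm_eq_inner by (simp add: inner_add_left inner_add_right inner_commute norm_eq_1)
  ultimately have "p = q" using unit_vectors_eq_iff_inner[OF np nq(1)] by simp
  obtain f where f: "f \<in> F" "f < \<sigma> + \<eta>"
    using cInf_lessD[of F "\<sigma> + \<eta>"] F(1) e(1) unfolding \<sigma>_def by auto
  have "\<sigma> \<le> f" unfolding \<sigma>_def using f F by (intro cInf_lower)
  have "d (y - (f - \<sigma>) *\<^sub>R p) = d y - (f - \<sigma>)"
    using f \<open>\<sigma> \<le> f\<close> q \<open>p = q\<close> by (intro bdirs_along[OF ecb]) auto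
  then have "d (x - f *\<^sub>R p) = d x - f" using dy by (simp add: y_def algebra_simps)
  then show False using f by (simp add: F_def)
qed

text \<open>The ray cannot go on forever, as \<open>d\<close> would become negative. The alternative
  to leaving \<open>\<Omega>\<close> is to end at \<open>k0\<close>, and singularity excludes
  it.\<close>

lemma singular_ray_leaves:
  assumes cb: "cball x r \<subseteq> \<Omega> - {k0}" and r: "r > 0" and p: "p \<in> bdirs r x" and sing: "singular x"
  obtains \<rho> where "0 < \<rho>" "\<rho> \<le> d x" "x - \<rho> *\<^sub>R p \<notin> \<Omega>"
    "\<And>s. 0 \<le> s \<Longrightarrow> s < \<rho> \<Longrightarrow> x - s *\<^sub>R p \<in> \<Omega> \<and> d (x - s *\<^sub>R p) = d x - s"
proof -
  obtain q where q: "q \<in> bdirs r x" "q \<noteq> p"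
    using sing unfolding singular_def reachable_gradients_eq_bdirs[OF cb r] by metis
  have np: "norm p = 1" and nq: "norm q = 1" "d (x - r *\<^sub>R q) = d x - r" using p q by (auto simp: bdirs_def)
  have "x \<in> cball x r" using r by simp
  then have x: "x \<in> \<Omega> - {k0}" using cb by blast
  define T where "T = {s. 0 \<le> s} \<inter> (\<lambda>s. x - s *\<^sub>R p) -` (- (\<Omega> - {k0}))"
  have "open (\<Omega> - {k0})" using open_dom by (intro open_Diff) auto
  then have "closed (- (\<Omega> - {k0}))" by (rule closed_Compl)
  then have "closed ((\<lambda>s. x - s *\<^sub>R p) -` (- (\<Omega> - {k0})))"
    by (rule closed_vimage) (intro continuous_intros)
  moreover have "closed {s :: real. 0 \<le> s}" by (intro closed_Collect_le continuous_intros)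
  ultimately have "closed T" unfolding T_def by blast
  have bdd: "bdd_below T" by (auto simp: T_def intro: bdd_belowI)
  have vis0: "x - s *\<^sub>R p \<in> \<Omega> - {k0}" if "0 \<le> s" "s \<notin> T" for s using that by (auto simp: T_def)
  have ne: "T \<noteq> {}"
  proof
    assume "T = {}"
    then have vis: "x - s *\<^sub>R p \<in> \<Omega> - {k0}" if "0 \<le> s" for s using vis0 that by blast
    have dx: "d x \<ge> 0" using d_nonneg x by blast
    have "d (x - (d x + 1) *\<^sub>R p) = d x - (d x + 1)"
      using dx vis by (intro bdirs_ray_extends[OF cb r p, of "d x + 2"]) auto
    moreover have "d (x - (d x + 1) *\<^sub>R p) \<ge> 0" using vis[of "d x + 1"] dx d_nonneg by auto
    ultimately show False by simp
  qed
  define \<rho> where "\<rho> = Inf T"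
  have "\<rho> \<in> T" unfolding \<rho>_def using closed_contains_Inf[OF ne bdd \<open>closed T\<close>] .
  have "\<rho> > 0" using \<open>\<rho> \<in> T\<close> x by (cases "\<rho> = 0") (auto simp: T_def)
  have vis: "x - s *\<^sub>R p \<in> \<Omega> - {k0}" if "0 \<le> s" "s < \<rho>" for s
    using that cInf_lower[OF _ bdd, of s] vis0 unfolding \<rho>_def[symmetric] by force
  have along: "d (x - s *\<^sub>R p) = d x - s" if "0 \<le> s" "s < \<rho>" for s
    using bdirs_ray_extends[OF cb r p vis that] .
  \<comment> \<open>If the ray ended at \<open>k0\<close>, then
    \<open>d x \<le> \<rho> = |x - k0|\<close>. For a second backward direction \<open>q\<close> the
    point \<open>x - r q\<close> would be within \<open>\<rho> - r\<close> of \<open>k0\<close>,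
    which is equality in the triangle inequality and gives \<open>q = p\<close>.\<close>
  have "x - \<rho> *\<^sub>R p \<noteq> k0"
  proof
    assume k: "x - \<rho> *\<^sub>R p = k0"
    have xk: "x - k0 = \<rho> *\<^sub>R p" using k by (simp add: algebra_simps)
    have "r < \<rho>"
    proof (rule ccontr)
      assume "\<not> r < \<rho>"
      then have "k0 \<in> cball x r" using xk np \<open>\<rho> > 0\<close> by (simp add: dist_norm)
      then show False using cb by blast
    qed
    have "closed_segment x k0 \<subseteq> \<Omega>"
    proof
      fix w assume "w \<in> closed_segment x k0"
      then obtain u where u: "0 \<le> u" "u \<le> 1" "w = (1 - u) *\<^sub>R x + u *\<^sub>R k0" unfolding in_segment by blast
      have w: "w = x - (u * \<rho>) *\<^sub>R p" unfolding u(3) k[symmetric] by (simp add: algebra_simps)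
      show "w \<in> \<Omega>"
      proof (cases "u = 1")
        case True
        then show ?thesis using w k k0_dom by simp
      next
        case False
        then have "u * \<rho> < \<rho>" using u \<open>\<rho> > 0\<close> by simp
        then show ?thesis using w vis[of "u * \<rho>"] u \<open>\<rho> > 0\<close> by simp
      qed
    qed
    then have "d x \<le> \<rho>" using d_segment[of x k0] d_k0 xk np \<open>\<rho> > 0\<close> by simp
    moreover have "x - r *\<^sub>R q \<in> \<Omega>" using cb r nq by (auto simp: dist_norm subset_iff)
    then have "norm (x - r *\<^sub>R q - k0) \<le> d x - r" using d_ge nq by metis
    moreover have "x - r *\<^sub>R q - k0 = \<rho> *\<^sub>R p - r *\<^sub>R q" using xk by (simp add: algebra_simps)
    ultimately have "norm (\<rho> *\<^sub>R p - r *\<^sub>R q) \<le> \<rho> - r" by simp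
    then have "(norm (\<rho> *\<^sub>R p - r *\<^sub>R q))\<^sup>2 \<le> (\<rho> - r)\<^sup>2" by (intro power_mono) auto
    moreover have "(norm (\<rho> *\<^sub>R p - r *\<^sub>R q))\<^sup>2 = \<rho>\<^sup>2 + r\<^sup>2 - 2 * (\<rho> * r) * (p \<bullet> q)"
      using np nq unfolding power2_norm_eq_inner
      by (simp add: inner_diff_left inner_diff_right inner_commute norm_eq_1 power2_eq_square algebra_simps)
    ultimately have "2 * (\<rho> * r) * 1 \<le> 2 * (\<rho> * r) * (p \<bullet> q)" by (simp add: power2_eq_square algebra_simps)
    then have "1 \<le> p \<bullet> q" using r \<open>\<rho> > 0\<close> by (simp only: mult_le_cancel_left_pos mult_pos_pos zero_less_numeral)
    then show False using unit_vectors_eq_iff_inner[OF np nq(1)] q(2) by simp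
  qed
  then have "x - \<rho> *\<^sub>R p \<notin> \<Omega>" using \<open>\<rho> \<in> T\<close> by (auto simp: T_def)
  moreover have "\<rho> \<le> d x"
  proof (rule dense_le_bounded[OF \<open>\<rho> > 0\<close>])
    fix s assume "0 < s" "s < \<rho>"
    then show "s \<le> d x" using along[of s] vis[of s] d_nonneg[of "x - s *\<^sub>R p"] by auto
  qed
  ultimately show ?thesis using that \<open>\<rho> > 0\<close> vis along by blast
qed

section \<open>Proximal points and the singular arc\<close>

text \<open>Serves twice: \<open>q = 0\<close> gives the implicit Euler step, \<open>q\<close>
  outside the superdifferential gives the arc. Comparing the maximiser with \<open>x0\<close> and
  using that \<open>d\<close> is 1-Lipschitz bounds its distance from \<open>x0\<close>; so the
  maximum is interior and its first order condition yields the supergradient.\<close>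

lemma proximal_step:
  assumes cb: "cball x0 (2 * r) \<subseteq> \<Omega> - {k0}" and r: "r > 0" and s: "s > 0" and small: "2 * (1 + norm q) * s < r"
  obtains y where "norm (y - x0) \<le> 2 * (1 + norm q) * s"
    "q + (1 / s) *\<^sub>R (y - x0) \<in> convex hull (bdirs r y)"
    "q \<bullet> (y - x0) + (norm (y - x0))\<^sup>2 / (2 * s) \<le> d y - d x0"
proof -
  have cbr: "cball x0 r \<subseteq> cball x0 (2 * r)" using r by (intro subset_cball) auto
  then have cbr': "cball x0 r \<subseteq> \<Omega>" using cb by blast
  define \<Phi> where "\<Phi> w = d w - q \<bullet> (w - x0) - (norm (w - x0))\<^sup>2 / (2 * s)" for w
  have cont: "continuous_on (cball x0 r) \<Phi>"
    unfolding \<Phi>_def by (intro continuous_intros continuous_on_subset[OF continuous_on_d cbr']) (use s in auto)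
  obtain y where y: "y \<in> cball x0 r" "\<And>w. w \<in> cball x0 r \<Longrightarrow> \<Phi> w \<le> \<Phi> y"
    using continuous_attains_sup[OF compact_cball _ cont] r by (metis cball_eq_empty not_less_iff_gr_or_eq)
  have gain: "q \<bullet> (y - x0) + (norm (y - x0))\<^sup>2 / (2 * s) \<le> d y - d x0"
    using y(2)[of x0] r by (simp add: \<Phi>_def)
  have near: "norm (y - x0) \<le> 2 * (1 + norm q) * s"
  proof (cases "y = x0")
    case False
    have "d y - d x0 \<le> norm (y - x0)"
      using d_lipschitz_convex[OF convex_cball cbr', of y x0] y(1) r by simp
    moreover have "- (q \<bullet> (y - x0)) \<le> norm q * norm (y - x0)"
      using norm_cauchy_schwarz[of "- q" "y - x0"] by simp
    ultimately have "(norm (y - x0))\<^sup>2 / (2 * s) \<le> (1 + norm q) * norm (y - x0)"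
      using gain by (simp add: algebra_simps)
    then have "norm (y - x0) * norm (y - x0) \<le> (2 * (1 + norm q) * s) * norm (y - x0)"
      using s by (simp add: field_simps power2_eq_square)
    then show ?thesis using False by (simp only: mult_le_cancel_right_pos zero_less_norm_iff right_minus_eq not_False_eq_True)
  qed (use s in auto)
  have cby: "cball y r \<subseteq> \<Omega> - {k0}" using near small by (intro cball_subset_double[OF cb]) auto
  have "supergrad y (q + (1 / s) *\<^sub>R (y - x0))"
  proof (rule quadratic_imp_supergrad)
    show "r - norm (y - x0) > 0" using near small by simp
    fix w assume w: "norm (w - y) < r - norm (y - x0)"
    have "norm (w - x0) \<le> r" using norm_triangle_ineq[of "w - y" "y - x0"] w by simp
    then have "\<Phi> w \<le> \<Phi> y" by (intro y(2)) (simp add: dist_norm norm_minus_commute)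
    then have "d w \<le> d y + q \<bullet> (w - y) + ((norm (w - x0))\<^sup>2 - (norm (y - x0))\<^sup>2) / (2 * s)"
      unfolding \<Phi>_def by (simp add: inner_diff_right diff_divide_distrib)
    also have "(norm (w - x0))\<^sup>2 - (norm (y - x0))\<^sup>2 = 2 * ((y - x0) \<bullet> (w - y)) + (norm (w - y))\<^sup>2"
      unfolding power2_norm_eq_inner by (simp add: inner_diff_left inner_diff_right inner_commute)
    also have "(2 * ((y - x0) \<bullet> (w - y)) + (norm (w - y))\<^sup>2) / (2 * s)
        = (1 / s) * ((y - x0) \<bullet> (w - y)) + 1 / (2 * s) * (norm (w - y))\<^sup>2"
      using s by (simp add: add_divide_distrib)
    finally show "d w \<le> d y + (q + (1 / s) *\<^sub>R (y - x0)) \<bullet> (w - y) + 1 / (2 * s) * (norm (w - y))\<^sup>2"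
      by (simp add: inner_add_left)
  qed
  then have "q + (1 / s) *\<^sub>R (y - x0) \<in> convex hull (bdirs r y)"
    by (rule supergrad_imp_hull[OF cby r])
  then show ?thesis using that near gain by blast
qed

text \<open>The sum of the semiconcavity estimates at the two points. It replaces Lipschitz
  continuity of the multivalued gradient in all stability arguments below.\<close>

lemma hull_one_sided_lipschitz:
  assumes "cball x r \<subseteq> \<Omega>" "cball y r \<subseteq> \<Omega>" "r > 0" "p \<in> convex hull (bdirs r x)" "q \<in> convex hull (bdirs r y)"
    and "norm (x - y) \<le> r / 2"
  shows "(p - q) \<bullet> (x - y) \<le> 2 / r * (norm (x - y))\<^sup>2"
proof -
  have "d y \<le> d x + p \<bullet> (y - x) + (norm (y - x))\<^sup>2 / r"
    using assms by (intro hull_bdirs_upper_bound') (auto simp: norm_minus_commute)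
  moreover have "d x \<le> d y + q \<bullet> (x - y) + (norm (x - y))\<^sup>2 / r"
    using assms by (intro hull_bdirs_upper_bound') auto
  ultimately show ?thesis
    by (simp add: inner_diff_left inner_diff_right norm_minus_commute)
qed

text \<open>Passing to the limit in the semiconcavity inequality, uniform in \<open>i\<close>,
  avoids following convex combinations; the limit is a supergradient and so belongs to the
  hull.\<close>

lemma hull_closed_graph:
  assumes cb: "cball y r \<subseteq> \<Omega> - {k0}" and cbx: "\<And>i::nat. cball (x i) r \<subseteq> \<Omega>" and r: "r > 0"
    and "x \<longlonglongrightarrow> y" "p \<longlonglongrightarrow> q" "\<And>i. p i \<in> convex hull (bdirs r (x i))"
  shows "q \<in> convex hull (bdirs r y)"
proof (rule supergrad_imp_hull[OF cb r], rule quadratic_imp_supergrad)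
  show "r / 4 > 0" using r by simp
  fix w assume w: "norm (w - y) < r / 4"
  then have wO: "w \<in> \<Omega>" "y \<in> \<Omega>" using cb r by (auto simp: dist_norm norm_minus_commute subset_iff)
  have "(\<lambda>i. norm (x i - y)) \<longlonglongrightarrow> 0" using assms(4) by (simp add: LIM_zero tendsto_norm_zero)
  then have "\<forall>\<^sub>F i in sequentially. norm (x i - y) < r / 4" using r by (intro order_tendstoD) auto
  then have "\<forall>\<^sub>F i in sequentially. d w \<le> d (x i) + p i \<bullet> (w - x i) + (norm (w - x i))\<^sup>2 / r"
  proof eventually_elim
    case (elim i)
    have "norm (w - x i) \<le> r / 2"
      using norm_triangle_ineq[of "w - y" "y - x i"] elim w by (simp add: norm_minus_commute)
    then show ?case using hull_bdirs_upper_bound'[OF cbx r assms(6)] by blast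
  qed
  moreover have "(\<lambda>i. d (x i) + p i \<bullet> (w - x i) + (norm (w - x i))\<^sup>2 / r) \<longlonglongrightarrow> d y + q \<bullet> (w - y) + (norm (w - y))\<^sup>2 / r"
    using r by (intro tendsto_intros tendsto_d wO assms(4,5)) auto
  ultimately have "d w \<le> d y + q \<bullet> (w - y) + (norm (w - y))\<^sup>2 / r"
    by (intro tendsto_lowerbound[of _ _ sequentially]) auto
  then show "d w \<le> d y + q \<bullet> (w - y) + (1 / r) * (norm (w - y))\<^sup>2" by simp
qed

lemma hull_ne_unit_vector:
  assumes cb: "cball x r \<subseteq> \<Omega>" and r: "r > 0" and "norm \<theta> = 1" "\<theta> \<notin> bdirs r x"
  shows "\<theta> \<notin> convex hull (bdirs r x)"
proof
  assume \<theta>: "\<theta> \<in> convex hull (bdirs r x)"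
  have "bdirs r x \<subseteq> {q. \<theta> \<bullet> q < 1}"
  proof
    fix q assume q: "q \<in> bdirs r x"
    then have "norm q = 1" "q \<noteq> \<theta>" using assms(4) by (auto simp: bdirs_def)
    then show "q \<in> {q. \<theta> \<bullet> q < 1}" using unit_vectors_eq_iff_inner[of \<theta> q] assms(3) by auto
  qed
  then have "convex hull (bdirs r x) \<subseteq> {q. \<theta> \<bullet> q < 1}" by (intro hull_minimal convex_halfspace_lt)
  then have "\<theta> \<bullet> \<theta> < 1" using \<theta> by blast
  then show False using assms(3) by (simp add: norm_eq_1)
qed

text \<open>The slopes \<open>P s\<close> of the proximal points can only accumulate at the
  projection \<open>p0\<close> of \<open>q\<close> on \<open>D\<close>, which is shorter than one.
  So \<open>P s\<close> is short for small \<open>s\<close>, and the points are singular.\<close>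

lemma singular_arc:
  assumes cb: "cball x0 (2 * r) \<subseteq> \<Omega> - {k0}" and r: "r > 0" and sing: "singular x0"
    and \<theta>: "norm \<theta> = 1" "\<theta> \<notin> bdirs r x0"
  obtains \<sigma> L :: real and x :: "real \<Rightarrow> real ^ 'n" where "\<sigma> > 0" "L-lipschitz_on {0..<\<sigma>} x" "x 0 = x0"
    "\<And>t. t \<in> {0..<\<sigma>} \<Longrightarrow> x t \<in> cball x0 r \<and> singular (x t)" "\<And>t. t \<in> {0<..<\<sigma>} \<Longrightarrow> x t \<noteq> x0"
proof -
  have cb0: "cball x0 r \<subseteq> \<Omega> - {k0}" using r by (intro cball_subset_double[OF cb]) auto
  define D where "D = convex hull (bdirs r x0)"
  have cD: "compact D" unfolding D_def using cb0 r by (intro compact_convex_hull compact_bdirs) auto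
  have D: "convex D" "closed D" "D \<noteq> {}"
    using compact_imp_closed[OF cD] bdirs_nonempty[OF cb0 r] by (auto simp: D_def)
  obtain m where m: "m \<in> D" "norm m < 1" using singularE_hull[OF cb0 r sing] D_def by blast
  have "\<theta> \<notin> D" unfolding D_def using cb0 r \<theta> by (intro hull_ne_unit_vector) auto
  then obtain q where q: "q \<notin> D" "norm (closest_point D q) < 1"
    using exists_outside_with_short_projection[OF D(1) cD m, of \<theta>] \<theta> by auto
  define p0 where "p0 = closest_point D q"
  have p0D: "p0 \<in> D" unfolding p0_def using D by (intro closest_point_in_set) auto
  define M where "M = 2 * (1 + norm q)"
  have M: "M > 0" by (simp add: M_def add_pos_nonneg)
  \<comment> \<open>For \<open>s < s0\<close> the points stay within \<open>r / 4\<close> of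
    \<open>x0\<close>, so any two of them are close enough for the one-sided Lipschitz estimate, and
    \<open>s / r \<le> 1 / 4\<close> lets its error be absorbed in \<open>lip\<close>.\<close>
  define s0 where "s0 = r / (4 * (M + 1))"
  have s0: "s0 > 0" using r M by (simp add: s0_def)
  have s0M: "M * s < r / 4" "s / r \<le> 1 / 4" if "s < s0" "0 < s" for s
  proof -
    have "s * (4 * (M + 1)) < r" using that(1) M by (simp add: s0_def pos_less_divide_eq)
    then have *: "4 * (M * s) + 4 * s < r" by (simp add: algebra_simps)
    then show "M * s < r / 4" using that(2) by simp
    have "4 * s \<le> r" using * mult_pos_pos[OF M that(2)] by simp
    then show "s / r \<le> 1 / 4" using r by (simp add: field_simps)
  qed
  have "\<exists>y. norm (y - x0) \<le> M * s \<and> q + (1 / s) *\<^sub>R (y - x0) \<in> convex hull (bdirs r y)" if s: "0 < s" "s < s0" for s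
  proof -
    have "2 * (1 + norm q) * s < r" using s0M(1)[OF s(2,1)] r unfolding M_def by simp
    then show ?thesis using proximal_step[OF cb r s(1), of q] unfolding M_def by blast
  qed
  then obtain y where y: "\<And>s. 0 < s \<Longrightarrow> s < s0 \<Longrightarrow> norm (y s - x0) \<le> M * s"
    "\<And>s. 0 < s \<Longrightarrow> s < s0 \<Longrightarrow> q + (1 / s) *\<^sub>R (y s - x0) \<in> convex hull (bdirs r (y s))" by metis
  define P where "P s = q + (1 / s) *\<^sub>R (y s - x0)" for s
  have yP: "y s - x0 = s *\<^sub>R (P s - q)" if "s > 0" for s using that by (simp add: P_def)
  have PH: "P s \<in> convex hull (bdirs r (y s))" if "0 < s" "s < s0" for s using y(2)[OF that] by (simp add: P_def)
  have near: "norm (y s - x0) < r / 4" if "0 < s" "s < s0" for s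
    using y(1)[OF that] s0M(1)[OF that(2,1)] by linarith
  have cby: "cball (y s) r \<subseteq> \<Omega> - {k0}" if "0 < s" "s < s0" for s
    using near[OF that] r by (intro cball_subset_double[OF cb]) auto
  have short: "\<exists>\<sigma>>0. \<forall>s. 0 < s \<and> s < \<sigma> \<longrightarrow> norm (P s) < 1"
  proof (rule ccontr)
    assume "\<not> ?thesis"
    then have "\<exists>s. 0 < s \<and> s < min s0 (1 / real (Suc n)) \<and> 1 \<le> norm (P s)" for n
      using s0 by (metis min_less_iff_conj not_less of_nat_0_less_iff zero_less_Suc zero_less_divide_1_iff)
    then obtain s where s: "\<And>n. 0 < s n" "\<And>n. s n < min s0 (1 / real (Suc n))" "\<And>n. 1 \<le> norm (P (s n))" by metis
    have sl: "s \<longlonglongrightarrow> 0"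
    proof (rule tendsto_sandwich[OF _ _ tendsto_const LIMSEQ_Suc[OF lim_inverse_n']])
      show "\<forall>\<^sub>F n in sequentially. 0 \<le> s n" using s(1) by (intro always_eventually allI less_imp_le)
      show "\<forall>\<^sub>F n in sequentially. s n \<le> 1 / real (Suc n)"
        using s(2) by (intro always_eventually allI) (simp add: less_imp_le)
    qed
    have "\<forall>n. P (s n) \<in> cball 0 1"
    proof
      show "P (s n) \<in> cball 0 1" for n using hull_bdirs_norm_le[OF PH[of "s n"]] s[of n] by simp
    qed
    with compact_cball[of "0 :: real ^ 'n" 1, unfolded compact_def, rule_format, of "\<lambda>n. P (s n)"]
    obtain Q \<phi> where Q: "strict_mono (\<phi> :: nat \<Rightarrow> nat)" "((\<lambda>n. P (s n)) \<circ> \<phi>) \<longlonglongrightarrow> Q" by blast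
    define t where "t = s \<circ> \<phi>"
    have t: "0 < t n" "t n < s0" "1 \<le> norm (P (t n))" for n using s[of "\<phi> n"] by (auto simp: t_def)
    have tl: "t \<longlonglongrightarrow> 0" unfolding t_def by (rule LIMSEQ_subseq_LIMSEQ[OF sl Q(1)])
    have Pl: "(\<lambda>n. P (t n)) \<longlonglongrightarrow> Q" using Q(2) by (simp add: t_def comp_def)
    have yl: "(\<lambda>n. y (t n)) \<longlonglongrightarrow> x0"
    proof (rule LIM_zero_cancel, rule Lim_null_comparison)
      show "\<forall>\<^sub>F n in sequentially. norm (y (t n) - x0) \<le> M * t n" using y(1) t by simp
      show "(\<lambda>n. M * t n) \<longlonglongrightarrow> 0" using tendsto_mult_right_zero[OF tl] by simp
    qed
    have "Q \<in> D" unfolding D_def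
      by (rule hull_closed_graph[OF cb0 _ r yl Pl PH]) (use cby t in auto)
    \<comment> \<open>The one-sided Lipschitz estimate between \<open>y s\<close> and
      \<open>x0\<close>, divided by \<open>s\<close>, has a right-hand side tending to zero. Added
      to the variational inequality of the projection it gives
      \<open>|Q - p0|^2 \<le> 0\<close>.\<close>
    have "(Q - p0) \<bullet> (Q - q) \<le> 0"
    proof (rule LIMSEQ_le)
      show "(\<lambda>n. (P (t n) - p0) \<bullet> (P (t n) - q)) \<longlonglongrightarrow> (Q - p0) \<bullet> (Q - q)" by (intro tendsto_intros Pl)
      have "(\<lambda>n. 2 / r * t n * (norm (P (t n) - q))\<^sup>2) \<longlonglongrightarrow> 2 / r * 0 * (norm (Q - q))\<^sup>2"
        by (intro tendsto_intros Pl tl)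
      then show "(\<lambda>n. 2 / r * t n * (norm (P (t n) - q))\<^sup>2) \<longlonglongrightarrow> 0" by simp
      have "(P s - p0) \<bullet> (P s - q) \<le> 2 / r * s * (norm (P s - q))\<^sup>2" if "0 < s" "s < s0" for s
      proof -
        have "(P s - p0) \<bullet> (y s - x0) \<le> 2 / r * (norm (y s - x0))\<^sup>2"
          using cby[OF that] cb0 r PH[OF that] p0D near[OF that]
          by (intro hull_one_sided_lipschitz) (auto simp: D_def)
        moreover have "(P s - p0) \<bullet> (y s - x0) = s * ((P s - p0) \<bullet> (P s - q))"
          unfolding yP[OF that(1)] by (rule inner_scaleR_right)
        moreover have "2 / r * (norm (y s - x0))\<^sup>2 = s * (2 / r * s * (norm (P s - q))\<^sup>2)"
          unfolding yP[OF that(1)] norm_scaleR by (simp add: power_mult_distrib power2_eq_square)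
        ultimately have "s * ((P s - p0) \<bullet> (P s - q)) \<le> s * (2 / r * s * (norm (P s - q))\<^sup>2)" by linarith
        then show ?thesis using that(1) by (simp only: mult_le_cancel_left_pos)
      qed
      then show "\<exists>N. \<forall>n\<ge>N. (P (t n) - p0) \<bullet> (P (t n) - q) \<le> 2 / r * t n * (norm (P (t n) - q))\<^sup>2"
        using t by blast
    qed
    moreover have "(q - p0) \<bullet> (Q - p0) \<le> 0"
      unfolding p0_def using D(1,2) \<open>Q \<in> D\<close> by (rule closest_point_dot)
    ultimately have "(Q - p0) \<bullet> (Q - p0) \<le> 0" by (simp add: algebra_simps inner_commute)
    then have "Q = p0" by (metis inner_gt_zero_iff not_less right_minus_eq)
    moreover have "1 \<le> norm Q"
      by (rule LIMSEQ_le_const[OF tendsto_norm[OF Pl]]) (use t in auto)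
    ultimately show False using q(2) p0_def by simp
  qed
  then obtain \<sigma>1 where s1: "\<sigma>1 > 0" "\<And>s. 0 < s \<Longrightarrow> s < \<sigma>1 \<Longrightarrow> norm (P s) < 1" by blast
  define \<sigma> where "\<sigma> = min s0 \<sigma>1"
  have \<sigma>: "\<sigma> > 0" "\<sigma> \<le> s0" "\<sigma> \<le> \<sigma>1" using s0 s1 by (auto simp: \<sigma>_def)
  define x where "x t = (if t = 0 then x0 else y t)" for t
  \<comment> \<open>With \<open>\<Delta> = y s - y t\<close>, the definition of \<open>P\<close>
    gives \<open>s (P s - P t) = \<Delta> - ((s - t) / t) (y t - x0)\<close>. Multiplied by
    \<open>\<Delta>\<close>, the left side is at most half of \<open>|\<Delta>|^2\<close> and
    \<open>y t - x0\<close> has norm at most \<open>M * t\<close>; what remains is the Lipschitz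
    bound.\<close>
  have lip: "dist (x s) (x t) \<le> 2 * M * dist s t" if "0 < s" "s < \<sigma>" "0 < t" "t < \<sigma>" for s t
  proof -
    define \<Delta> where "\<Delta> = y s - y t"
    have st: "s < s0" "t < s0" using that \<sigma> by auto
    have "norm \<Delta> \<le> r / 2"
      using norm_triangle_ineq4[of "y s - x0" "y t - x0"] near[OF that(1) st(1)] near[OF that(3) st(2)]
      by (simp add: \<Delta>_def)
    then have "(P s - P t) \<bullet> \<Delta> \<le> 2 / r * (norm \<Delta>)\<^sup>2" unfolding \<Delta>_def
      using cby[OF that(1) st(1)] cby[OF that(3) st(2)] r PH[OF that(1) st(1)] PH[OF that(3) st(2)]
      by (intro hull_one_sided_lipschitz) auto
    then have 1: "s * ((P s - P t) \<bullet> \<Delta>) \<le> s * (2 / r * (norm \<Delta>)\<^sup>2)" using that by (intro mult_left_mono) auto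
    have "s *\<^sub>R (P s - P t) = \<Delta> - ((s - t) / t) *\<^sub>R (y t - x0)"
      using yP[OF that(1)] yP[OF that(3)] that unfolding \<Delta>_def
      by (simp add: algebra_simps P_def diff_divide_distrib)
    then have "s * ((P s - P t) \<bullet> \<Delta>) = (\<Delta> - ((s - t) / t) *\<^sub>R (y t - x0)) \<bullet> \<Delta>" by (metis inner_scaleR_left)
    also have "\<dots> = (norm \<Delta>)\<^sup>2 - (s - t) / t * ((y t - x0) \<bullet> \<Delta>)"
      by (simp add: inner_diff_left power2_norm_eq_inner)
    finally have E: "s * ((P s - P t) \<bullet> \<Delta>) = (norm \<Delta>)\<^sup>2 - (s - t) / t * ((y t - x0) \<bullet> \<Delta>)" .
    have "s * (2 / r * (norm \<Delta>)\<^sup>2) = 2 * (s / r) * (norm \<Delta>)\<^sup>2" by simp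
    then have 2: "(norm \<Delta>)\<^sup>2 \<le> 2 * (s / r) * (norm \<Delta>)\<^sup>2 + (s - t) / t * ((y t - x0) \<bullet> \<Delta>)"
      using 1 unfolding E by linarith
    have "(s - t) / t * ((y t - x0) \<bullet> \<Delta>) \<le> \<bar>s - t\<bar> / t * (M * t * norm \<Delta>)"
    proof -
      have "(s - t) / t * ((y t - x0) \<bullet> \<Delta>) \<le> \<bar>(s - t) / t * ((y t - x0) \<bullet> \<Delta>)\<bar>" by (rule abs_ge_self)
      also have "\<dots> = \<bar>s - t\<bar> / t * \<bar>(y t - x0) \<bullet> \<Delta>\<bar>" using that by (simp add: abs_mult)
      also have "\<bar>(y t - x0) \<bullet> \<Delta>\<bar> \<le> norm (y t - x0) * norm \<Delta>" by (rule Cauchy_Schwarz_ineq2)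
      also have "\<dots> \<le> M * t * norm \<Delta>" using y(1)[OF that(3) st(2)] by (intro mult_right_mono) auto
      finally show ?thesis using that by (simp add: mult_left_mono divide_right_mono)
    qed
    also have "\<dots> = M * \<bar>s - t\<bar> * norm \<Delta>" using that by simp
    finally have 3: "(s - t) / t * ((y t - x0) \<bullet> \<Delta>) \<le> M * \<bar>s - t\<bar> * norm \<Delta>" .
    have "2 * (s / r) * (norm \<Delta>)\<^sup>2 \<le> 1 / 2 * (norm \<Delta>)\<^sup>2"
    proof (rule mult_right_mono)
      show "2 * (s / r) \<le> 1 / 2" using s0M(2)[OF st(1) that(1)] by linarith
    qed simp
    then have "(norm \<Delta>)\<^sup>2 \<le> 2 * (M * \<bar>s - t\<bar> * norm \<Delta>)" using 2 3 by linarith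
    then have "norm \<Delta> * norm \<Delta> \<le> (2 * M * \<bar>s - t\<bar>) * norm \<Delta>" by (simp add: power2_eq_square algebra_simps)
    then have "norm \<Delta> \<le> 2 * M * \<bar>s - t\<bar>" using M by (cases "norm \<Delta> = 0") auto
    then show ?thesis using that unfolding x_def \<Delta>_def by (simp add: dist_norm dist_real_def)
  qed
  have lip0: "dist (x s) x0 \<le> 2 * M * s" if "0 < s" "s < \<sigma>" for s
  proof -
    have "norm (y s - x0) \<le> M * s" using y(1)[of s] that \<sigma> by auto
    also have "\<dots> \<le> 2 * M * s" using M that by simp
    finally show ?thesis using that by (simp add: x_def dist_norm)
  qed
  have "(2 * M)-lipschitz_on {0..<\<sigma>} x"
  proof (rule lipschitz_onI)
    fix s t assume st: "s \<in> {0..<\<sigma>}" "t \<in> {0..<\<sigma>}"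
    consider "s = 0" "t = 0" | "s = 0" "t > 0" | "s > 0" "t = 0" | "s > 0" "t > 0" using st by force
    then show "dist (x s) (x t) \<le> 2 * M * dist s t"
    proof cases
      case 2
      then show ?thesis using lip0[of t] st by (simp add: x_def dist_commute)
    next
      case 3
      then show ?thesis using lip0[of s] st by (simp add: x_def)
    next
      case 4
      then show ?thesis using lip[of s t] st by simp
    qed (simp add: x_def)
  qed (use M in simp)
  moreover have "x t \<in> cball x0 r \<and> singular (x t)" if "t \<in> {0..<\<sigma>}" for t
  proof (cases "t = 0")
    case False
    then have t: "0 < t" "t < s0" "t < \<sigma>1" using that \<sigma> by auto
    have "singular (y t)" by (rule singularI_hull[OF cby[OF t(1,2)] r PH[OF t(1,2)] s1(2)[OF t(1,3)]])
    moreover have "y t \<in> cball x0 r" using near[OF t(1,2)] r by (simp add: dist_norm norm_minus_commute)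
    ultimately show ?thesis using False by (simp add: x_def)
  qed (use sing r in \<open>simp add: x_def\<close>)
  moreover have "x t \<noteq> x0" if "t \<in> {0<..<\<sigma>}" for t
  proof
    \<comment> \<open>Then the slope at \<open>x0\<close> would be \<open>q\<close> itself, which
      was chosen outside \<open>D\<close>.\<close>
    assume "x t = x0"
    then have "y t = x0" using that by (simp add: x_def)
    then have "q \<in> D" using PH[of t] that \<sigma> by (simp add: P_def D_def)
    then show False using q by simp
  qed
  moreover have "x 0 = x0" by (simp add: x_def)
  ultimately show ?thesis using that \<sigma>(1) by blast
qed

end

section \<open>The generalised gradient flow in a half space\<close>

lemma increment_bounds:
  fixes f :: "nat \<Rightarrow> real"
  assumes "j \<le> k"
  shows "(\<And>i. j \<le> i \<Longrightarrow> i < k \<Longrightarrow> f (Suc i) - f i \<le> B) \<Longrightarrow> f k - f j \<le> real (k - j) * B"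
    and "(\<And>i. j \<le> i \<Longrightarrow> i < k \<Longrightarrow> B \<le> f (Suc i) - f i) \<Longrightarrow> real (k - j) * B \<le> f k - f j"
proof -
  have sum: "f k - f j = (\<Sum>i=j..<k. f (Suc i) - f i)" using assms by (rule sum_Suc_diff'[symmetric])
  show "f k - f j \<le> real (k - j) * B" if "\<And>i. j \<le> i \<Longrightarrow> i < k \<Longrightarrow> f (Suc i) - f i \<le> B"
    unfolding sum using sum_bounded_above[of "{j..<k}" "\<lambda>i. f (Suc i) - f i" B] that by simp
  show "real (k - j) * B \<le> f k - f j" if "\<And>i. j \<le> i \<Longrightarrow> i < k \<Longrightarrow> B \<le> f (Suc i) - f i"
    unfolding sum using sum_bounded_below[of "{j..<k}" B "\<lambda>i. f (Suc i) - f i"] that by simp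
qed

text \<open>A discrete form of the differential inequality \<open>(1 - a\<^sup>2)' \<ge> - C (1 - a\<^sup>2)\<close>
  for the speed \<open>a\<close> of the flow.\<close>

lemma speed_deficit_step:
  fixes a b c u :: real
  assumes a: "0 \<le> a" "a \<le> 1" and b: "0 \<le> b" "b \<le> 1" and c: "c \<le> a * b" and u: "0 \<le> u" "u \<le> 1 / 8"
    and le: "a\<^sup>2 - c \<le> u * (2 * a\<^sup>2 - c\<^sup>2 - a\<^sup>2 * a\<^sup>2)"
  shows "(1 - b\<^sup>2) * (1 - 4 * u) \<le> 1 - a\<^sup>2"
proof (cases "a \<le> b")
  case True
  have "b\<^sup>2 \<le> 1" using b by (simp add: power_le_one)
  then have "(1 - b\<^sup>2) * (1 - 4 * u) \<le> (1 - b\<^sup>2) * 1" using u by (intro mult_left_mono) auto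
  also have "\<dots> \<le> 1 - a\<^sup>2" using True a by (simp add: power_mono)
  finally show ?thesis .
next
  case False
  then have ab: "b < a" "0 < a" using b by auto
  have b2: "b\<^sup>2 \<le> 1" using b by (simp add: power_le_one)
  have ab2: "b\<^sup>2 \<le> a\<^sup>2" using ab b by (intro power_mono) auto
  have "a * b \<le> 1" using a b by (intro mult_le_one) auto
  then have "a * b + c \<le> 2" using c by linarith
  \<comment> \<open>This makes \<open>- c + u * c^2\<close> decreasing in \<open>c\<close> up to
    \<open>a * b\<close>, so that \<open>c\<close> may be replaced by its upper bound in the
    hypothesis.\<close>
  have "u * (a * b + c) \<le> 1"
  proof -
    have "u * (a * b + c) \<le> u * 2" using \<open>a * b + c \<le> 2\<close> u by (intro mult_left_mono) auto
    then show ?thesis using u by linarith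
  qed
  then have "(a * b - c) * (u * (a * b + c)) \<le> (a * b - c) * 1" using c by (intro mult_left_mono) auto
  moreover have "(a * b - c) * (u * (a * b + c)) = u * (a\<^sup>2 * b\<^sup>2) - u * c\<^sup>2" by (simp add: power2_eq_square algebra_simps)
  ultimately have "a\<^sup>2 - a * b \<le> u * (2 * a\<^sup>2 - a\<^sup>2 * b\<^sup>2 - a\<^sup>2 * a\<^sup>2)" using le by (simp add: algebra_simps)
  also have "u * (2 * a\<^sup>2 - a\<^sup>2 * b\<^sup>2 - a\<^sup>2 * a\<^sup>2) = a * (u * a * (2 - b\<^sup>2 - a\<^sup>2))"
    by (simp add: power2_eq_square algebra_simps)
  finally have "a * (a - b) \<le> a * (u * a * (2 - b\<^sup>2 - a\<^sup>2))" by (simp add: power2_eq_square algebra_simps)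
  then have "a - b \<le> u * a * (2 - b\<^sup>2 - a\<^sup>2)" using ab by simp
  also have "\<dots> \<le> u * a * (2 * (1 - b\<^sup>2))" using ab2 u a by (intro mult_left_mono) auto
  also have "\<dots> \<le> u * 1 * (2 * (1 - b\<^sup>2))" using u a b2 by (intro mult_right_mono mult_left_mono) auto
  finally have 1: "a - b \<le> 2 * u * (1 - b\<^sup>2)" by (simp add: algebra_simps)
  have "a\<^sup>2 - b\<^sup>2 = (a + b) * (a - b)" by (simp add: power2_eq_square algebra_simps)
  also have "\<dots> \<le> 2 * (a - b)" using ab a b by (intro mult_right_mono) auto
  also have "\<dots> \<le> 2 * (2 * u * (1 - b\<^sup>2))" using 1 by simp
  finally show ?thesis by (simp add: algebra_simps)
qed

lemma exp_le_one_minus_power: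
  fixes u :: real
  assumes "0 \<le> u" "u \<le> 1 / 2"
  shows "exp (- 2 * u * real k) \<le> (1 - u) ^ k"
proof -
  have "u * u \<le> u * (1 / 2)" using assms by (intro mult_left_mono) auto
  then have "2 * u\<^sup>2 \<le> u" by (simp add: power2_eq_square)
  then have "- 2 * u \<le> - u - 2 * u\<^sup>2" by linarith
  also have "\<dots> \<le> ln (1 - u)" using assms by (intro ln_one_minus_pos_lower_bound) auto
  finally have "exp (- 2 * u) \<le> exp (ln (1 - u))" by simp
  then have "exp (- 2 * u) \<le> 1 - u" using assms by simp
  then have "exp (- 2 * u) ^ k \<le> (1 - u) ^ k" by (intro power_mono) auto
  then show ?thesis by (simp add: exp_of_nat_mult[symmetric] mult.commute)
qed

lemma floor_index_bounds:
  fixes h t :: real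
  assumes "0 < h" "0 \<le> t"
  shows "real (nat \<lfloor>t / h\<rfloor>) * h \<le> t" "t - h \<le> real (nat \<lfloor>t / h\<rfloor>) * h"
proof -
  have eq: "real (nat \<lfloor>t / h\<rfloor>) = of_int \<lfloor>t / h\<rfloor>" using assms by simp
  have "of_int \<lfloor>t / h\<rfloor> * h \<le> t / h * h" using assms by (intro mult_right_mono) auto
  moreover have "t / h * h \<le> (of_int \<lfloor>t / h\<rfloor> + 1) * h"
    using assms by (intro mult_right_mono) linarith+
  ultimately show "real (nat \<lfloor>t / h\<rfloor>) * h \<le> t" "t - h \<le> real (nat \<lfloor>t / h\<rfloor>) * h"
    unfolding eq using assms by (auto simp: algebra_simps)
qed

text \<open>Arzela-Ascoli for step functions: they may jump, but the equicontinuity defect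
  \<open>h n\<close> vanishes. A diagonal sequence converges at the nonnegative rationals, and the
  estimate carries convergence to every time.\<close>

lemma almost_lipschitz_convergent_subsequence:
  fixes Z :: "nat \<Rightarrow> real \<Rightarrow> 'a::euclidean_space" and h :: "nat \<Rightarrow> real"
  assumes Z0: "\<And>n t. 0 \<le> t \<Longrightarrow> norm (Z n t - z) \<le> t"
    and Z: "\<And>n s t. 0 \<le> s \<Longrightarrow> s \<le> t \<Longrightarrow> norm (Z n t - Z n s) \<le> t - s + h n" and h: "h \<longlonglongrightarrow> 0"
  obtains \<phi> x where "strict_mono (\<phi> :: nat \<Rightarrow> nat)" "\<And>t. 0 \<le> t \<Longrightarrow> (\<lambda>n. Z (\<phi> n) t) \<longlonglongrightarrow> x t"
proof -
  define S where "S = \<rat> \<inter> {0::real..}"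
  have cS: "countable S" unfolding S_def using countable_rat by (rule countable_subset[rotated]) auto
  \<comment> \<open>The values grow linearly in \<open>q\<close>; the weight provides the bound
    uniform in \<open>q\<close> that the diagonal argument takes.\<close>
  have bd: "norm ((1 / (1 + q)) *\<^sub>R (Z n q - z)) \<le> 1" if "q \<in> S" for n q
  proof -
    have q: "0 \<le> q" using that by (simp add: S_def)
    have "norm (Z n q - z) \<le> 1 + q" using Z0[OF q, of n] by simp
    then show ?thesis unfolding norm_scaleR using q by (simp add: divide_le_eq)
  qed
  obtain \<phi> where \<phi>: "strict_mono (\<phi> :: nat \<Rightarrow> nat)"
    "\<And>q. q \<in> S \<Longrightarrow> \<exists>l. (\<lambda>n. (1 / (1 + q)) *\<^sub>R (Z (\<phi> n) q - z)) \<longlonglongrightarrow> l"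
    using function_convergent_subsequence[of S "\<lambda>n q. (1 / (1 + q)) *\<^sub>R (Z n q - z)" 1, OF cS bd] by blast
  have hl: "(\<lambda>n. h (\<phi> n)) \<longlonglongrightarrow> 0" using LIMSEQ_subseq_LIMSEQ[OF h \<phi>(1)] by (simp add: comp_def)
  have convS: "Cauchy (\<lambda>n. Z (\<phi> n) q)" if q: "q \<in> S" for q
  proof -
    obtain l where "(\<lambda>n. (1 / (1 + q)) *\<^sub>R (Z (\<phi> n) q - z)) \<longlonglongrightarrow> l" using \<phi>(2)[OF q] by blast
    then have "(\<lambda>n. z + (1 + q) *\<^sub>R ((1 / (1 + q)) *\<^sub>R (Z (\<phi> n) q - z))) \<longlonglongrightarrow> z + (1 + q) *\<^sub>R l"
      by (intro tendsto_intros)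
    moreover have "z + (1 + q) *\<^sub>R ((1 / (1 + q)) *\<^sub>R (Z (\<phi> n) q - z)) = Z (\<phi> n) q" for n
      using q by (simp add: S_def)
    ultimately show ?thesis using LIMSEQ_imp_Cauchy by simp
  qed
  have conv: "convergent (\<lambda>n. Z (\<phi> n) t)" if t: "0 \<le> t" for t
  proof (rule Cauchy_convergent, rule metric_CauchyI)
    fix e :: real assume e: "e > 0"
    obtain q where q: "q \<in> \<rat>" "t < q" "q < t + e / 6" using Rats_dense_in_real[of t "t + e / 6"] e by auto
    then have qS: "q \<in> S" using t by (simp add: S_def)
    obtain N1 where N1: "\<And>m n. m \<ge> N1 \<Longrightarrow> n \<ge> N1 \<Longrightarrow> dist (Z (\<phi> m) q) (Z (\<phi> n) q) < e / 3"
      using convS[OF qS] e unfolding Cauchy_def by (metis zero_less_divide_iff zero_less_numeral)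
    have "\<forall>\<^sub>F n in sequentially. h (\<phi> n) < e / 6" using hl e by (intro order_tendstoD) auto
    then obtain N2 where N2: "\<And>n. n \<ge> N2 \<Longrightarrow> h (\<phi> n) < e / 6" unfolding eventually_sequentially by blast
    have near: "dist (Z (\<phi> n) q) (Z (\<phi> n) t) < e / 3" if "n \<ge> N2" for n
      using Z[of t q "\<phi> n"] t q N2[OF that] by (simp add: dist_norm)
    have "dist (Z (\<phi> m) t) (Z (\<phi> n) t) < e" if "m \<ge> max N1 N2" "n \<ge> max N1 N2" for m n
    proof -
      have "dist (Z (\<phi> m) t) (Z (\<phi> n) t) \<le> dist (Z (\<phi> m) q) (Z (\<phi> m) t) + dist (Z (\<phi> m) q) (Z (\<phi> n) q) + dist (Z (\<phi> n) q) (Z (\<phi> n) t)"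
        by (smt (verit) dist_commute dist_triangle)
      then show ?thesis using near[of m] near[of n] N1[of m n] that by simp
    qed
    then show "\<exists>M. \<forall>m\<ge>M. \<forall>n\<ge>M. dist (Z (\<phi> m) t) (Z (\<phi> n) t) < e" by blast
  qed
  then have "(\<lambda>n. Z (\<phi> n) t) \<longlonglongrightarrow> lim (\<lambda>n. Z (\<phi> n) t)" if "0 \<le> t" for t
    using that by (simp add: convergent_LIMSEQ_iff)
  then show ?thesis using that[OF \<phi>(1), of "\<lambda>t. lim (\<lambda>n. Z (\<phi> n) t)"] by blast
qed

section \<open>The implicit Euler scheme\<close>

text \<open>The conditions on \<open>r\<close> make one radius serve at every point whose height
  \<open>\<nu> \<bullet> y\<close> and distance \<open>d y\<close> are no smaller than at
  \<open>x0\<close>: balls of radius \<open>2 * r\<close> stay in the half space and miss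
  \<open>k0\<close>.\<close>

locale halfspace_flow = eikonal \<Omega> k0 d for \<Omega> :: "(real ^ 'n) set" and k0 d +
  fixes \<nu> x0 p0 :: "real ^ 'n" and c r :: real
  assumes norm_nu: "norm \<nu> \<le> 1"
    and halfspace: "c < \<nu> \<bullet> y \<Longrightarrow> y \<in> \<Omega>"
    and r: "r > 0" "2 * r < \<nu> \<bullet> x0 - c" "2 * r < d x0" "cball k0 (2 * r) \<subseteq> \<Omega>"
    and p0: "p0 \<in> convex hull (bdirs r x0)" "norm p0 < 1"
begin

definition region :: "(real ^ 'n) set" where
  "region = {y. \<nu> \<bullet> x0 \<le> \<nu> \<bullet> y \<and> d x0 \<le> d y}"

abbreviation "l0 \<equiv> \<nu> \<bullet> x0 - c"

lemma nu_inner_le: "\<bar>\<nu> \<bullet> v\<bar> \<le> norm v"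
proof -
  have "\<bar>\<nu> \<bullet> v\<bar> \<le> norm \<nu> * norm v" by (rule Cauchy_Schwarz_ineq2)
  also have "\<dots> \<le> 1 * norm v" using norm_nu by (intro mult_right_mono) auto
  finally show ?thesis by simp
qed

lemma region_cball:
  assumes "y \<in> region"
  shows "cball y (2 * r) \<subseteq> \<Omega> - {k0}"
proof -
  have "cball y (2 * r) \<subseteq> \<Omega>"
  proof
    fix w assume "w \<in> cball y (2 * r)"
    then have "norm (y - w) \<le> 2 * r" by (simp add: dist_norm)
    then have "\<nu> \<bullet> y - \<nu> \<bullet> w \<le> 2 * r" using nu_inner_le[of "y - w"] by (simp add: inner_diff_right)
    then show "w \<in> \<Omega>" using assms r(2) by (intro halfspace) (simp add: region_def)
  qed
  moreover have "k0 \<notin> cball y (2 * r)"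
  proof
    assume "k0 \<in> cball y (2 * r)"
    then have n: "norm (y - k0) \<le> 2 * r" by (simp add: dist_norm)
    have "closed_segment y k0 \<subseteq> cball k0 (2 * r)"
      using n r(1) by (intro closed_segment_subset) (auto simp: dist_norm norm_minus_commute)
    then have "d y \<le> norm (y - k0) + d k0" using r(4) by (intro d_segment) blast
    then show False using n r(3) assms d_k0 by (simp add: region_def)
  qed
  ultimately show ?thesis by blast
qed

lemma region_cball':
  assumes "y \<in> region"
  shows "cball y r \<subseteq> \<Omega> - {k0}"
  using region_cball[OF assms] r(1) subset_cball[of r "2 * r" y] by auto

lemma d_le_halfspace:
  assumes "c < \<nu> \<bullet> y" "c < \<nu> \<bullet> z"
  shows "d y \<le> norm (y - z) + d z"
proof (rule d_segment)
  have "closed_segment y z \<subseteq> {w. \<nu> \<bullet> w > c}" using assms by (intro closed_segment_subset convex_halfspace_gt) auto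
  then show "closed_segment y z \<subseteq> \<Omega>" using halfspace by auto
qed

text \<open>At a singular point every backward ray leaves \<open>\<Omega>\<close>, hence loses the
  height \<open>\<nu> \<bullet> y - c\<close> within a length at most \<open>d y\<close>. This
  quantitative form drives both the growth of \<open>d\<close> and the unboundedness.\<close>

lemma hull_nu_lower_bound:
  assumes cb: "cball y r \<subseteq> \<Omega> - {k0}" and sing: "singular y" and y: "c < \<nu> \<bullet> y"
    and p: "p \<in> convex hull (bdirs r y)"
  shows "(\<nu> \<bullet> y - c) / d y \<le> p \<bullet> \<nu>"
proof (rule hull_halfspace_ge[OF _ p])
  fix q assume "q \<in> bdirs r y"
  from singular_ray_leaves[OF cb r(1) this sing]
  obtain \<rho> where \<rho>: "0 < \<rho>" "\<rho> \<le> d y" "y - \<rho> *\<^sub>R q \<notin> \<Omega>" by metis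
  have "\<nu> \<bullet> (y - \<rho> *\<^sub>R q) \<le> c" using halfspace \<rho>(3) not_less by blast
  then have "\<nu> \<bullet> y - c \<le> \<rho> * (q \<bullet> \<nu>)" by (simp add: inner_diff_right inner_commute)
  then have "(\<nu> \<bullet> y - c) / \<rho> \<le> q \<bullet> \<nu>" using \<rho> by (simp add: field_simps)
  moreover have "(\<nu> \<bullet> y - c) / d y \<le> (\<nu> \<bullet> y - c) / \<rho>" using \<rho> y by (intro divide_left_mono) auto
  ultimately show "(\<nu> \<bullet> y - c) / d y \<le> q \<bullet> \<nu>" by linarith
qed

definition state :: "real ^ 'n \<Rightarrow> real ^ 'n \<Rightarrow> bool" where
  "state x p \<longleftrightarrow> x \<in> region \<and> p \<in> convex hull (bdirs r x) \<and> norm p < 1"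

definition euler_step :: "real \<Rightarrow> real ^ 'n \<Rightarrow> real ^ 'n \<Rightarrow> real ^ 'n \<Rightarrow> real ^ 'n \<Rightarrow> bool" where
  "euler_step h x p x' p' \<longleftrightarrow> x' = x + h *\<^sub>R p' \<and> (1 - (norm p)\<^sup>2) * (1 - 4 * (h / r)) \<le> 1 - (norm p')\<^sup>2 \<and>
     (\<nu> \<bullet> x' - c) / d x' \<le> p' \<bullet> \<nu> \<and> h * (norm p')\<^sup>2 / 2 \<le> d x' - d x"

text \<open>The refined semiconcavity bounds from \<open>x\<close> to \<open>x'\<close> and back are
  added. In terms of \<open>a = |p'|\<close> and \<open>e = p \<bullet> p'\<close> this is the
  hypothesis of \<open>speed_deficit_step\<close> with \<open>u = h / r\<close>; the restriction
  \<open>h \<le> r / 8\<close> is the one on \<open>u\<close> there.\<close>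

lemma euler_step_exists:
  assumes st: "state x p" and h: "0 < h" "h \<le> r / 8"
  shows "\<exists>x' p'. state x' p' \<and> euler_step h x p x' p'"
proof -
  have x: "x \<in> region" "p \<in> convex hull (bdirs r x)" "norm p < 1" using st by (auto simp: state_def)
  obtain x' where x': "norm (x' - x) \<le> 2 * (1 + norm (0 :: real ^ 'n)) * h"
    "0 + (1 / h) *\<^sub>R (x' - x) \<in> convex hull (bdirs r x')"
    "0 \<bullet> (x' - x) + (norm (x' - x))\<^sup>2 / (2 * h) \<le> d x' - d x"
    by (rule proximal_step[OF region_cball[OF x(1)] r(1) h(1), of 0]) (use h r in auto)
  define p' where "p' = (1 / h) *\<^sub>R (x' - x)"
  have xp: "x' - x = h *\<^sub>R p'" using h by (simp add: p'_def)
  have p': "p' \<in> convex hull (bdirs r x')" using x'(2) by (simp add: p'_def)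
  then have np': "norm p' \<le> 1" by (rule hull_bdirs_norm_le)
  have gain: "h * (norm p')\<^sup>2 / 2 \<le> d x' - d x"
    using x'(3) h unfolding xp by (simp add: power_mult_distrib power2_eq_square mult_ac)
  have nxx: "norm (x' - x) \<le> h" using np' h unfolding xp by simp
  have cbx: "cball x r \<subseteq> \<Omega>" using region_cball'[OF x(1)] by blast
  have cbx0: "cball x' r \<subseteq> \<Omega> - {k0}" using nxx h r by (intro cball_subset_double[OF region_cball[OF x(1)]]) auto
  then have cbx': "cball x' r \<subseteq> \<Omega>" by blast
  define a where "a = norm p'"
  define e where "e = p \<bullet> p'"
  have up: "d x' \<le> d x + h * e + h\<^sup>2 * (a\<^sup>2 - e\<^sup>2) / r"
  proof -
    have "d x' \<le> d x + p \<bullet> (x' - x) + ((norm (x' - x))\<^sup>2 - (p \<bullet> (x' - x))\<^sup>2) / r"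
      using nxx h by (intro hull_bdirs_upper_bound[OF cbx r(1) x(2)]) auto
    then show ?thesis unfolding xp by (simp add: a_def e_def power_mult_distrib algebra_simps)
  qed
  have down: "d x \<le> d x' - h * a\<^sup>2 + h\<^sup>2 * (a\<^sup>2 - a\<^sup>2 * a\<^sup>2) / r"
  proof -
    have xx: "x - x' = - (h *\<^sub>R p')" using xp by (metis minus_diff_eq)
    have pp: "p' \<bullet> p' = a\<^sup>2" by (simp add: a_def power2_norm_eq_inner)
    have "d x \<le> d x' + p' \<bullet> (x - x') + ((norm (x - x'))\<^sup>2 - (p' \<bullet> (x - x'))\<^sup>2) / r"
      using nxx h by (intro hull_bdirs_upper_bound[OF cbx' r(1) p']) (auto simp: norm_minus_commute)
    then show ?thesis unfolding xx by (simp add: a_def[symmetric] pp power_mult_distrib power2_eq_square algebra_simps)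
  qed
  have "h * (a\<^sup>2 - e) \<le> h * (h / r * (2 * a\<^sup>2 - e\<^sup>2 - a\<^sup>2 * a\<^sup>2))"
    using up down r by (simp add: power2_eq_square field_simps)
  then have ineq: "a\<^sup>2 - e \<le> h / r * (2 * a\<^sup>2 - e\<^sup>2 - a\<^sup>2 * a\<^sup>2)" using h(1) by (simp only: mult_le_cancel_left_pos)
  have hr: "0 \<le> h / r" "h / r \<le> 1 / 8" using h r by (auto simp: field_simps)
  have deficit: "(1 - (norm p)\<^sup>2) * (1 - 4 * (h / r)) \<le> 1 - a\<^sup>2"
  proof (rule speed_deficit_step[OF _ _ _ _ _ hr ineq])
    show "e \<le> a * norm p" unfolding e_def a_def using norm_cauchy_schwarz[of p p'] by (simp add: mult.commute)
  qed (use np' x(3) in \<open>auto simp: a_def\<close>)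
  moreover have "0 < (1 - (norm p)\<^sup>2) * (1 - 4 * (h / r))"
  proof (rule mult_pos_pos)
    show "0 < 1 - (norm p)\<^sup>2" using x(3) by (simp add: abs_square_less_1)
    show "0 < 1 - 4 * (h / r)" using hr by linarith
  qed
  ultimately have "a\<^sup>2 < 1" by linarith
  then have na: "norm p' < 1" unfolding a_def by (simp add: abs_square_less_1)
  \<comment> \<open>Singularity has to precede the invariance of \<open>region\<close>: the lower
    bound on the height gain is available only at singular points.\<close>
  have sing: "singular x'" by (rule singularI_hull[OF cbx0 r(1) p' na])
  have "\<nu> \<bullet> x - \<nu> \<bullet> x' \<le> h" using nu_inner_le[of "x' - x"] nxx by (simp add: inner_diff_right)
  then have nux: "c < \<nu> \<bullet> x'" using x(1) h r(1,2) by (simp add: region_def)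
  have lb: "(\<nu> \<bullet> x' - c) / d x' \<le> p' \<bullet> \<nu>" by (rule hull_nu_lower_bound[OF cbx0 sing nux p'])
  have "0 \<le> d x'" using cbx' r by (intro d_nonneg) auto
  then have "0 \<le> p' \<bullet> \<nu>" using lb nux by (smt (verit) divide_nonneg_nonneg)
  then have "\<nu> \<bullet> x \<le> \<nu> \<bullet> x'" using h xp by (metis diff_ge_0_iff_ge inner_commute inner_diff_right inner_scaleR_right less_imp_le mult_nonneg_nonneg)
  moreover have "d x \<le> d x'" using gain h by (smt (verit) divide_nonneg_nonneg mult_nonneg_nonneg zero_le_power2)
  ultimately have "x' \<in> region" using x(1) by (simp add: region_def)
  then have "state x' p'" using p' na by (simp add: state_def)
  moreover have "euler_step h x p x' p'"
    unfolding euler_step_def using deficit lb gain xp by (simp add: a_def[symmetric] algebra_simps)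
  ultimately show ?thesis by blast
qed

definition scheme :: "real \<Rightarrow> (nat \<Rightarrow> real ^ 'n) \<Rightarrow> (nat \<Rightarrow> real ^ 'n) \<Rightarrow> bool" where
  "scheme h X P \<longleftrightarrow> X 0 = x0 \<and> P 0 = p0 \<and> (\<forall>k. state (X k) (P k) \<and> euler_step h (X k) (P k) (X (Suc k)) (P (Suc k)))"

lemma scheme_exists:
  assumes h: "0 < h" "h \<le> r / 8"
  shows "\<exists>X P. scheme h X P"
proof -
  have "state x0 p0" using p0 by (simp add: state_def region_def)
  then have "\<exists>f. \<forall>n. (state (fst (f n)) (snd (f n)) \<and> (n = 0 \<longrightarrow> f n = (x0, p0))) \<and>
      euler_step h (fst (f n)) (snd (f n)) (fst (f (Suc n))) (snd (f (Suc n)))"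
  proof (intro dependent_nat_choice)
    fix z :: "(real ^ 'n) \<times> (real ^ 'n)" and n :: nat
    assume "state (fst z) (snd z) \<and> (n = 0 \<longrightarrow> z = (x0, p0))"
    then obtain x' p' where "state x' p'" "euler_step h (fst z) (snd z) x' p'"
      using euler_step_exists[OF _ h] by blast
    then show "\<exists>y. (state (fst y) (snd y) \<and> (Suc n = 0 \<longrightarrow> y = (x0, p0))) \<and> euler_step h (fst z) (snd z) (fst y) (snd y)"
      by (intro exI[of _ "(x', p')"]) auto
  qed auto
  then obtain f where "\<forall>n. (state (fst (f n)) (snd (f n)) \<and> (n = 0 \<longrightarrow> f n = (x0, p0))) \<and>
      euler_step h (fst (f n)) (snd (f n)) (fst (f (Suc n))) (snd (f (Suc n)))" by blast
  then have "scheme h (\<lambda>n. fst (f n)) (\<lambda>n. snd (f n))" by (simp add: scheme_def)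
  then show ?thesis by blast
qed

context
  fixes h X P
  assumes sch: "scheme h X P" and h: "0 < h" "h \<le> r / 8"
begin

lemma sch_region: "X k \<in> region" and sch_hull: "P k \<in> convex hull (bdirs r (X k))" and sch_norm: "norm (P k) < 1"
  using sch by (auto simp: scheme_def state_def)

lemma sch_step: "X (Suc k) - X k = h *\<^sub>R P (Suc k)"
  using sch by (simp add: scheme_def euler_step_def)

lemma sch_d_pos: "0 < d (X k)" "d x0 \<le> d (X k)"
  using sch_region[of k] r by (auto simp: region_def)

lemma sch_d_step: "h * (norm (P (Suc k)))\<^sup>2 / 2 \<le> d (X (Suc k)) - d (X k)"
  using sch unfolding scheme_def euler_step_def by blast

lemma sch_d_mono: "j \<le> k \<Longrightarrow> d (X j) \<le> d (X k)"
proof (rule lift_Suc_mono_le[of "\<lambda>k. d (X k)"])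
  fix n
  have "0 \<le> h * (norm (P (Suc n)))\<^sup>2 / 2" using h by simp
  then show "d (X n) \<le> d (X (Suc n))" using sch_d_step[of n] by linarith
qed auto

lemma sch_dist:
  assumes "j \<le> k"
  shows "norm (X k - X j) \<le> real (k - j) * h"
proof -
  have "norm (X (Suc i) - X j) - norm (X i - X j) \<le> h" for i
  proof -
    have "norm (X (Suc i) - X j) \<le> norm (X (Suc i) - X i) + norm (X i - X j)"
      using norm_triangle_ineq[of "X (Suc i) - X i" "X i - X j"] by simp
    moreover have "norm (X (Suc i) - X i) \<le> h" using h sch_norm[of "Suc i"] unfolding sch_step by simp
    ultimately show ?thesis by linarith
  qed
  then show ?thesis using increment_bounds(1)[OF assms, of "\<lambda>i. norm (X i - X j)" h] by simp
qed

text \<open>The bound worsens as \<open>d\<close> grows. Since \<open>d\<close> is monotone along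
  the scheme, its value at the last index \<open>k\<close> gives a constant common to all earlier
  steps.\<close>

lemma sch_nu_step:
  assumes "Suc i \<le> k"
  shows "l0 / d (X k) \<le> P (Suc i) \<bullet> \<nu>"
proof -
  have "l0 / d (X k) \<le> (\<nu> \<bullet> X (Suc i) - c) / d (X (Suc i))"
    using sch_region[of "Suc i"] sch_d_mono[OF assms] sch_d_pos r by (intro frac_le) (auto simp: region_def)
  also have "\<dots> \<le> P (Suc i) \<bullet> \<nu>" using sch unfolding scheme_def euler_step_def by blast
  finally show ?thesis .
qed

lemma sch_nu:
  assumes "j \<le> k"
  shows "real (k - j) * (h * (l0 / d (X k))) \<le> \<nu> \<bullet> X k - \<nu> \<bullet> X j"
proof (rule increment_bounds(2)[OF assms, of _ "\<lambda>i. \<nu> \<bullet> X i"])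
  fix i assume "j \<le> i" "i < k"
  then have "h * (l0 / d (X k)) \<le> h * (P (Suc i) \<bullet> \<nu>)" using sch_nu_step[of i k] h by (intro mult_left_mono) auto
  also have "\<dots> = \<nu> \<bullet> (X (Suc i) - X i)" unfolding sch_step by (simp add: inner_commute)
  finally show "h * (l0 / d (X k)) \<le> \<nu> \<bullet> X (Suc i) - \<nu> \<bullet> X i" by (simp add: inner_diff_right)
qed

lemma sch_d:
  assumes "j \<le> k"
  shows "real (k - j) * (h * ((l0 / d (X k))\<^sup>2 / 2)) \<le> d (X k) - d (X j)"
proof (rule increment_bounds(2)[OF assms, of _ "\<lambda>i. d (X i)"])
  fix i assume i: "j \<le> i" "i < k"
  have "0 \<le> l0 / d (X k)" using r sch_d_pos(1)[of k] by simp
  moreover have "l0 / d (X k) \<le> norm (P (Suc i))"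
    using sch_nu_step[of i k] nu_inner_le[of "P (Suc i)"] i by (simp add: inner_commute)
  ultimately have "(l0 / d (X k))\<^sup>2 \<le> (norm (P (Suc i)))\<^sup>2" by (intro power_mono)
  then have "h * ((l0 / d (X k))\<^sup>2 / 2) \<le> h * ((norm (P (Suc i)))\<^sup>2 / 2)" using h by (intro mult_left_mono) auto
  then show "h * ((l0 / d (X k))\<^sup>2 / 2) \<le> d (X (Suc i)) - d (X i)" using sch_d_step[of i] by simp
qed

text \<open>Iterating the deficit estimate gives a power of \<open>1 - 4 * (h / r)\<close>, bounded
  below by an exponential in the elapsed time \<open>k * h\<close>. So the bound does not degenerate
  as \<open>h\<close> tends to zero.\<close>

lemma sch_speed: "(1 - (norm p0)\<^sup>2) * exp (- 8 * (real k * h) / r) \<le> 1 - (norm (P k))\<^sup>2"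
proof -
  define u where "u = h / r"
  have u: "0 \<le> 4 * u" "4 * u \<le> 1 / 2" using h r by (auto simp: u_def field_simps)
  have "(1 - (norm p0)\<^sup>2) * (1 - 4 * u) ^ k \<le> 1 - (norm (P k))\<^sup>2"
  proof (induction k)
    case 0
    then show ?case using sch by (simp add: scheme_def)
  next
    case (Suc k)
    have "(1 - (norm p0)\<^sup>2) * (1 - 4 * u) ^ Suc k = ((1 - (norm p0)\<^sup>2) * (1 - 4 * u) ^ k) * (1 - 4 * u)" by simp
    also have "\<dots> \<le> (1 - (norm (P k))\<^sup>2) * (1 - 4 * u)" using Suc u by (intro mult_right_mono) auto
    also have "\<dots> \<le> 1 - (norm (P (Suc k)))\<^sup>2" using sch unfolding scheme_def euler_step_def u_def by blast
    finally show ?case .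
  qed
  moreover have "(1 - (norm p0)\<^sup>2) * exp (- 2 * (4 * u) * real k) \<le> (1 - (norm p0)\<^sup>2) * (1 - 4 * u) ^ k"
    using exp_le_one_minus_power[OF u, of k] p0(2) by (intro mult_left_mono) (auto simp: abs_square_le_1)
  moreover have "- 2 * (4 * u) * real k = - 8 * (real k * h) / r" by (simp add: u_def)
  ultimately show ?thesis by simp
qed

text \<open>The slopes \<open>P\<close> need not converge pointwise with the step size, so the
  inclusion is encoded through positions only. In one step the squared distance to a test point
  \<open>w\<close> changes by at most \<open>2 h\<close> times \<open>p \<bullet> (Y - w)\<close>,
  which the supergradient inequality tested at \<open>w\<close> controls. Values at the last index
  and the largest possible error make the bound the same for all steps.\<close>

lemma sch_evi:
  assumes "j \<le> k" and w: "norm (w - X j) + real (k - j) * h \<le> r / 2"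
  shows "(norm (X k - w))\<^sup>2 - (norm (X j - w))\<^sup>2
    \<le> real (k - j) * (2 * h * (d (X k) - d w + (norm (w - X j) + real (k - j) * h)\<^sup>2 / r))"
proof (rule increment_bounds(1)[OF assms(1), of "\<lambda>i. (norm (X i - w))\<^sup>2"])
  fix i assume i: "j \<le> i" "i < k"
  define Y where "Y = X (Suc i)"
  define p where "p = P (Suc i)"
  have "norm (Y - X j) \<le> real (Suc i - j) * h" unfolding Y_def using i by (intro sch_dist) auto
  also have "\<dots> \<le> real (k - j) * h" using i h by (intro mult_right_mono) auto
  finally have wY: "norm (w - Y) \<le> norm (w - X j) + real (k - j) * h"
    using norm_triangle_ineq[of "w - X j" "X j - Y"] by (simp add: norm_minus_commute)
  have cb: "cball Y r \<subseteq> \<Omega>" using region_cball'[OF sch_region] unfolding Y_def by blast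
  have "d w \<le> d Y + p \<bullet> (w - Y) + (norm (w - Y))\<^sup>2 / r"
    using sch_hull wY w unfolding Y_def p_def by (intro hull_bdirs_upper_bound'[OF cb[unfolded Y_def] r(1)]) auto
  moreover have "(norm (w - Y))\<^sup>2 / r \<le> (norm (w - X j) + real (k - j) * h)\<^sup>2 / r"
    using wY r by (intro divide_right_mono power_mono) auto
  moreover have "d Y \<le> d (X k)" unfolding Y_def using i by (intro sch_d_mono) auto
  ultimately have 1: "p \<bullet> (Y - w) \<le> d (X k) - d w + (norm (w - X j) + real (k - j) * h)\<^sup>2 / r"
    by (simp add: inner_diff_right)
  have "(norm (Y - w))\<^sup>2 - (norm (X i - w))\<^sup>2 = 2 * ((Y - X i) \<bullet> (Y - w)) - (norm (Y - X i))\<^sup>2"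
    unfolding power2_norm_eq_inner by (simp add: inner_diff_left inner_diff_right inner_commute)
  also have "\<dots> \<le> 2 * ((Y - X i) \<bullet> (Y - w))" by simp
  also have "\<dots> = 2 * h * (p \<bullet> (Y - w))" unfolding Y_def p_def sch_step by simp
  also have "\<dots> \<le> 2 * h * (d (X k) - d w + (norm (w - X j) + real (k - j) * h)\<^sup>2 / r)"
    using 1 h by (intro mult_left_mono) auto
  finally show "(norm (X (Suc i) - w))\<^sup>2 - (norm (X i - w))\<^sup>2
    \<le> 2 * h * (d (X k) - d w + (norm (w - X j) + real (k - j) * h)\<^sup>2 / r)" by (simp add: Y_def)
qed

end

text \<open>The integrated evolution variational inequality; it survives pointwise limits of the
  scheme and, differentiated at \<^term>\<open>s\<close>, it says that the velocity is a supergradient.\<close>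

definition evi :: "(real \<Rightarrow> real ^ 'n) \<Rightarrow> bool" where
  "evi x \<longleftrightarrow> (\<forall>s t w. 0 \<le> s \<and> s < t \<and> norm (w - x s) + (t - s) < r / 2 \<longrightarrow>
     (norm (x t - w))\<^sup>2 - (norm (x s - w))\<^sup>2 \<le> (t - s) * (2 * (d (x t) - d w + (norm (w - x s) + (t - s))\<^sup>2 / r)))"

section \<open>The limit flow and its uniqueness\<close>

lemma flow_exists:
  obtains x where "x 0 = x0" "1-lipschitz_on {0..} x"
    "\<And>t. 0 \<le> t \<Longrightarrow> x t \<in> region" "\<And>t. 0 \<le> t \<Longrightarrow> singular (x t)"
    "\<And>s t. 0 \<le> s \<Longrightarrow> s \<le> t \<Longrightarrow> (t - s) * (l0 / d (x t)) \<le> \<nu> \<bullet> x t - \<nu> \<bullet> x s"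
    "\<And>s t. 0 \<le> s \<Longrightarrow> s \<le> t \<Longrightarrow> (t - s) * ((l0 / d (x t))\<^sup>2 / 2) \<le> d (x t) - d (x s)"
    "evi x"
proof -
  define h where "h n = r / 8 / real (Suc n)" for n
  have h: "0 < h n" "h n \<le> r / 8" for n
    using r(1) by (auto simp: h_def field_simps)
  have hl: "h \<longlonglongrightarrow> 0" unfolding h_def by (rule LIMSEQ_Suc[OF lim_const_over_n])
  have "\<exists>X P. scheme (h n) X P" for n using scheme_exists[OF h] .
  then obtain X P where sch: "\<And>n. scheme (h n) (X n) (P n)" by metis
  define k where "k n t = nat \<lfloor>t / h n\<rfloor>" for n t
  have k: "real (k n t) * h n \<le> t" "t - h n \<le> real (k n t) * h n" if "0 \<le> t" for n t
    unfolding k_def using floor_index_bounds[OF h(1) that] by auto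
  have kmono: "k n s \<le> k n t" if "s \<le> t" for n s t
    unfolding k_def using that h(1)[of n] by (intro nat_mono floor_mono divide_right_mono) auto
  have kdiff: "real (k n t - k n s) * h n = real (k n t) * h n - real (k n s) * h n" if "s \<le> t" for n s t
    using kmono[OF that] by (simp add: of_nat_diff left_diff_distrib)
  define Z where "Z n t = X n (k n t)" for n t
  have "X n 0 = x0" for n using sch[of n] by (simp add: scheme_def)
  then have Z0: "norm (Z n t - x0) \<le> t" if "0 \<le> t" for n t
    using sch_dist[OF sch h, of 0 "k n t" n] k(1)[OF that, of n] by (simp add: Z_def)
  have Zlip: "norm (Z n t - Z n s) \<le> t - s + h n" if "0 \<le> s" "s \<le> t" for n s t
    using sch_dist[OF sch[of n] h[of n] kmono[OF that(2), of n]] kdiff[OF that(2), of n] k(1)[of t n] k(2)[of s n] that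
    by (simp add: Z_def)
  obtain \<phi> x where \<phi>: "strict_mono (\<phi> :: nat \<Rightarrow> nat)" "\<And>t. 0 \<le> t \<Longrightarrow> (\<lambda>n. Z (\<phi> n) t) \<longlonglongrightarrow> x t"
    using almost_lipschitz_convergent_subsequence[of Z x0 h, OF Z0 Zlip hl] by blast
  have hl': "(\<lambda>n. h (\<phi> n)) \<longlonglongrightarrow> 0" using LIMSEQ_subseq_LIMSEQ[OF hl \<phi>(1)] by (simp add: comp_def)
  have kl: "(\<lambda>n. real (k (\<phi> n) t) * h (\<phi> n)) \<longlonglongrightarrow> t" if "0 \<le> t" for t
  proof (rule tendsto_sandwich[of "\<lambda>n. t - h (\<phi> n)" _ _ "\<lambda>n. t"])
    show "(\<lambda>n. t - h (\<phi> n)) \<longlonglongrightarrow> t" using tendsto_diff[OF tendsto_const hl', of t] by simp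
  qed (use k[OF that] in auto)
  have kdl: "(\<lambda>n. real (k (\<phi> n) t - k (\<phi> n) s) * h (\<phi> n)) \<longlonglongrightarrow> t - s" if "0 \<le> s" "s \<le> t" for s t
    unfolding kdiff[OF that(2)] using that by (intro tendsto_diff kl) auto
  have Zreg: "Z n t \<in> region" for n t unfolding Z_def by (rule sch_region[OF sch h])
  have nux: "\<nu> \<bullet> x0 \<le> \<nu> \<bullet> x t" if "0 \<le> t" for t
  proof (rule LIMSEQ_le_const)
    show "(\<lambda>n. \<nu> \<bullet> Z (\<phi> n) t) \<longlonglongrightarrow> \<nu> \<bullet> x t" by (intro tendsto_intros \<phi> that)
  qed (use Zreg in \<open>auto simp: region_def\<close>)
  have xO: "x t \<in> \<Omega>" if "0 \<le> t" for t using nux[OF that] r by (intro halfspace) linarith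
  have dl: "(\<lambda>n. d (Z (\<phi> n) t)) \<longlonglongrightarrow> d (x t)" if "0 \<le> t" for t
    by (rule tendsto_d[OF xO[OF that] \<phi>(2)[OF that]])
  have dx: "d x0 \<le> d (x t)" if "0 \<le> t" for t
    by (rule LIMSEQ_le_const[OF dl[OF that]]) (use Zreg in \<open>auto simp: region_def\<close>)
  have reg: "x t \<in> region" if "0 \<le> t" for t using nux[OF that] dx[OF that] by (simp add: region_def)
  have dpos: "0 < d (x t)" if "0 \<le> t" for t using dx[OF that] r by linarith
  have ll: "(\<lambda>n. l0 / d (Z (\<phi> n) t)) \<longlonglongrightarrow> l0 / d (x t)" if "0 \<le> t" for t
    using dpos[OF that] by (intro tendsto_divide tendsto_const dl that) auto
  have "x 0 = x0"
  proof (rule LIMSEQ_unique[OF \<phi>(2)])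
    show "(\<lambda>n. Z (\<phi> n) 0) \<longlonglongrightarrow> x0" using Z0[of 0] by simp
  qed simp
  moreover have "1-lipschitz_on {0..} x"
  proof (rule lipschitz_on_leI)
    fix s t :: real assume st: "s \<in> {0..}" "t \<in> {0..}" "s \<le> t"
    have "norm (x t - x s) \<le> t - s + 0"
    proof (rule LIMSEQ_le)
      show "(\<lambda>n. norm (Z (\<phi> n) t - Z (\<phi> n) s)) \<longlonglongrightarrow> norm (x t - x s)" using st by (intro tendsto_intros \<phi>) auto
      show "(\<lambda>n. t - s + h (\<phi> n)) \<longlonglongrightarrow> t - s + 0" by (intro tendsto_intros hl')
    qed (use Zlip st in auto)
    then show "dist (x s) (x t) \<le> 1 * dist s t" using st by (simp add: dist_norm norm_minus_commute)
  qed simp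
  moreover have "singular (x t)" if t: "0 \<le> t" for t
  proof (rule singular_limit[OF region_cball'[OF reg[OF t]] r(1) \<phi>(2)[OF t]])
    \<comment> \<open>A lower bound for the deficit at time \<open>t\<close>, common to all step
      sizes; thus all slopes are shorter than one fixed number below one.\<close>
    define m where "m = (1 - (norm p0)\<^sup>2) * exp (- 8 * t / r)"
    have np: "0 < 1 - (norm p0)\<^sup>2" using p0(2) by (simp add: abs_square_less_1)
    then have "m > 0" by (simp add: m_def)
    then show "sqrt (1 - m) < 1" by simp
    show "P (\<phi> n) (k (\<phi> n) t) \<in> convex hull bdirs r (Z (\<phi> n) t)" for n
      unfolding Z_def by (rule sch_hull[OF sch h])
    show "norm (P (\<phi> n) (k (\<phi> n) t)) \<le> sqrt (1 - m)" for n
    proof (rule real_le_rsqrt)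
      have "- 8 * t / r \<le> - 8 * (real (k (\<phi> n) t) * h (\<phi> n)) / r"
        using k(1)[OF t] r by (intro divide_right_mono) auto
      then have "m \<le> (1 - (norm p0)\<^sup>2) * exp (- 8 * (real (k (\<phi> n) t) * h (\<phi> n)) / r)"
        unfolding m_def using np by (intro mult_left_mono) auto
      then show "(norm (P (\<phi> n) (k (\<phi> n) t)))\<^sup>2 \<le> 1 - m"
        using sch_speed[OF sch[of "\<phi> n"] h[of "\<phi> n"], of "k (\<phi> n) t"] by linarith
    qed
  qed
  moreover have "(t - s) * (l0 / d (x t)) \<le> \<nu> \<bullet> x t - \<nu> \<bullet> x s" if "0 \<le> s" "s \<le> t" for s t
  proof (rule LIMSEQ_le)
    show "(\<lambda>n. \<nu> \<bullet> Z (\<phi> n) t - \<nu> \<bullet> Z (\<phi> n) s) \<longlonglongrightarrow> \<nu> \<bullet> x t - \<nu> \<bullet> x s"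
      using that by (intro tendsto_intros \<phi>) auto
    show "(\<lambda>n. real (k (\<phi> n) t - k (\<phi> n) s) * h (\<phi> n) * (l0 / d (Z (\<phi> n) t))) \<longlonglongrightarrow> (t - s) * (l0 / d (x t))"
      using that by (intro tendsto_mult kdl ll) auto
    show "\<exists>N. \<forall>n\<ge>N. real (k (\<phi> n) t - k (\<phi> n) s) * h (\<phi> n) * (l0 / d (Z (\<phi> n) t)) \<le> \<nu> \<bullet> Z (\<phi> n) t - \<nu> \<bullet> Z (\<phi> n) s"
      using sch_nu[OF sch h kmono[OF that(2)]] by (auto simp: Z_def mult.assoc)
  qed
  moreover have "(t - s) * ((l0 / d (x t))\<^sup>2 / 2) \<le> d (x t) - d (x s)" if "0 \<le> s" "s \<le> t" for s t
  proof (rule LIMSEQ_le)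
    show "(\<lambda>n. d (Z (\<phi> n) t) - d (Z (\<phi> n) s)) \<longlonglongrightarrow> d (x t) - d (x s)"
      using that by (intro tendsto_diff dl) auto
    show "(\<lambda>n. real (k (\<phi> n) t - k (\<phi> n) s) * h (\<phi> n) * ((l0 / d (Z (\<phi> n) t))\<^sup>2 / 2)) \<longlonglongrightarrow> (t - s) * ((l0 / d (x t))\<^sup>2 / 2)"
      using that by (intro tendsto_mult kdl tendsto_divide tendsto_power ll tendsto_const) auto
    show "\<exists>N. \<forall>n\<ge>N. real (k (\<phi> n) t - k (\<phi> n) s) * h (\<phi> n) * ((l0 / d (Z (\<phi> n) t))\<^sup>2 / 2) \<le> d (Z (\<phi> n) t) - d (Z (\<phi> n) s)"
      using sch_d[OF sch h kmono[OF that(2)]] by (auto simp: Z_def mult.assoc)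
  qed
  moreover have "evi x"
    unfolding evi_def
  proof (intro allI impI)
    fix s t w assume A: "0 \<le> s \<and> s < t \<and> norm (w - x s) + (t - s) < r / 2"
    then have st: "0 \<le> s" "s \<le> t" "0 \<le> t" by auto
    define \<tau> where "\<tau> n = real (k (\<phi> n) t - k (\<phi> n) s) * h (\<phi> n)" for n
    have \<tau>l: "\<tau> \<longlonglongrightarrow> t - s" unfolding \<tau>_def by (rule kdl[OF st(1,2)])
    have wl: "(\<lambda>n. norm (w - Z (\<phi> n) s) + \<tau> n) \<longlonglongrightarrow> norm (w - x s) + (t - s)"
      by (intro tendsto_intros \<phi> st \<tau>l)
    have ev: "\<forall>\<^sub>F n in sequentially. norm (w - Z (\<phi> n) s) + \<tau> n < r / 2"
      using wl A by (intro order_tendstoD) auto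
    have "\<forall>\<^sub>F n in sequentially. (norm (Z (\<phi> n) t - w))\<^sup>2 - (norm (Z (\<phi> n) s - w))\<^sup>2
        \<le> \<tau> n * (2 * (d (Z (\<phi> n) t) - d w + (norm (w - Z (\<phi> n) s) + \<tau> n)\<^sup>2 / r))"
      using ev
    proof eventually_elim
      case (elim n)
      then have "norm (w - X (\<phi> n) (k (\<phi> n) s)) + real (k (\<phi> n) t - k (\<phi> n) s) * h (\<phi> n) \<le> r / 2"
        by (simp add: Z_def \<tau>_def)
      from sch_evi[OF sch h kmono[OF st(2)] this] show ?case
        unfolding Z_def \<tau>_def by (simp only: mult.assoc mult.left_commute[of 2])
    qed
    moreover have "(\<lambda>n. (norm (Z (\<phi> n) t - w))\<^sup>2 - (norm (Z (\<phi> n) s - w))\<^sup>2) \<longlonglongrightarrow> (norm (x t - w))\<^sup>2 - (norm (x s - w))\<^sup>2"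
      by (intro tendsto_intros \<phi> st)
    moreover have "(\<lambda>n. \<tau> n * (2 * (d (Z (\<phi> n) t) - d w + (norm (w - Z (\<phi> n) s) + \<tau> n)\<^sup>2 / r)))
        \<longlonglongrightarrow> (t - s) * (2 * (d (x t) - d w + (norm (w - x s) + (t - s))\<^sup>2 / r))"
      using r by (intro tendsto_mult tendsto_const tendsto_add tendsto_diff tendsto_divide tendsto_power \<tau>l dl st wl) auto
    ultimately show "(norm (x t - w))\<^sup>2 - (norm (x s - w))\<^sup>2 \<le> (t - s) * (2 * (d (x t) - d w + (norm (w - x s) + (t - s))\<^sup>2 / r))"
      by (intro tendsto_le[of sequentially]) auto
  qed
  ultimately show ?thesis using that reg by blast
qed

text \<open>Divided by \<open>t - s\<close>, the left side tends to the derivative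
  \<open>2 (v \<bullet> (x s - w))\<close> of the squared distance, and the right side to its value
  at \<open>t = s\<close>. The limit inequality is the semiconcavity estimate for \<open>v\<close>,
  tested at \<open>w\<close>.\<close>

lemma evi_imp_supergrad:
  assumes evi: "evi x" and s: "0 \<le> s" and xO: "x s \<in> \<Omega>"
    and v: "(x has_vector_derivative v) (at s within {0..})"
  shows "supergrad (x s) v"
proof (rule quadratic_imp_supergrad)
  show "r / 4 > 0" using r by simp
  fix w assume w: "norm (w - x s) < r / 4"
  have v': "(x has_vector_derivative v) (at s within {s..})"
    using v by (rule has_vector_derivative_within_subset) (use s in auto)
  have "((\<lambda>t. (x t - w) \<bullet> (x t - w)) has_vector_derivative (x s - w) \<bullet> v + v \<bullet> (x s - w)) (at s within {s..})"
    by (rule bounded_bilinear.has_vector_derivative[OF bounded_bilinear_inner])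
       (use has_vector_derivative_diff[OF v' has_vector_derivative_const[of w]] in auto)
  then have "((\<lambda>t. (norm (x t - w))\<^sup>2) has_real_derivative 2 * (v \<bullet> (x s - w))) (at s within {s..})"
    by (simp add: has_real_derivative_iff_has_vector_derivative power2_norm_eq_inner inner_commute)
  then have q: "((\<lambda>t. ((norm (x t - w))\<^sup>2 - (norm (x s - w))\<^sup>2) / (t - s)) \<longlongrightarrow> 2 * (v \<bullet> (x s - w))) (at s within {s..})"
    unfolding has_field_derivative_iff .
  have xl: "(x \<longlongrightarrow> x s) (at s within {s..})"
    using has_vector_derivative_continuous[OF v'] by (simp add: continuous_within)
  have tl: "((\<lambda>t. t) \<longlongrightarrow> s) (at s within {s..})" by (rule tendsto_ident_at)
  have "((\<lambda>t. 2 * (d (x t) - d w + (norm (w - x s) + (t - s))\<^sup>2 / r)) \<longlongrightarrow> 2 * (d (x s) - d w + (norm (w - x s) + (s - s))\<^sup>2 / r)) (at s within {s..})"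
    using r by (intro tendsto_intros tendsto_d[OF xO] xl tl) auto
  moreover have "\<forall>\<^sub>F t in at s within {s..}. ((norm (x t - w))\<^sup>2 - (norm (x s - w))\<^sup>2) / (t - s)
      \<le> 2 * (d (x t) - d w + (norm (w - x s) + (t - s))\<^sup>2 / r)"
    unfolding eventually_at
  proof (intro exI[of _ "r / 4"] conjI ballI impI)
    fix t assume t: "t \<in> {s..}" "t \<noteq> s \<and> dist t s < r / 4"
    then have ts: "s < t" "norm (w - x s) + (t - s) < r / 2" using w by (auto simp: dist_real_def)
    then have "(norm (x t - w))\<^sup>2 - (norm (x s - w))\<^sup>2 \<le> (t - s) * (2 * (d (x t) - d w + (norm (w - x s) + (t - s))\<^sup>2 / r))"
      using evi s unfolding evi_def by blast
    then show "((norm (x t - w))\<^sup>2 - (norm (x s - w))\<^sup>2) / (t - s) \<le> 2 * (d (x t) - d w + (norm (w - x s) + (t - s))\<^sup>2 / r)"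
      using ts by (simp add: pos_divide_le_eq mult.commute)
  qed (use r in simp)
  ultimately have "2 * (v \<bullet> (x s - w)) \<le> 2 * (d (x s) - d w + (norm (w - x s) + (s - s))\<^sup>2 / r)"
    using q by (intro tendsto_le[of "at s within {s..}"]) (auto simp: at_within_Ici_at_right)
  then show "d w \<le> d (x s) + v \<bullet> (w - x s) + (1 / r) * (norm (w - x s))\<^sup>2"
    by (simp add: inner_diff_right)
qed

lemma flow_unique_short_time:
  assumes lx: "1-lipschitz_on {a..b} x" and ly: "L-lipschitz_on {a..b} y" and ab: "a \<le> b" "4 / r * (b - a) \<le> 1 / 2"
    and reg: "\<And>t. t \<in> {a..b} \<Longrightarrow> x t \<in> region" and close: "\<And>t. t \<in> {a..b} \<Longrightarrow> norm (x t - y t) \<le> r / 2"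
    and neg: "negligible N"
    and dx: "\<And>t. t \<in> {a..b} - N \<Longrightarrow> \<exists>v. supergrad (x t) v \<and> (x has_vector_derivative v) (at t within {a..b})"
    and dy: "\<And>t. t \<in> {a..b} - N \<Longrightarrow> \<exists>v. supergrad (y t) v \<and> (y has_vector_derivative v) (at t within {a..b})"
    and eq: "x a = y a" and t: "t \<in> {a..b}"
  shows "x t = y t"
proof -
  define f where "f t = (norm (x t - y t))\<^sup>2" for t
  have lxy: "(1 + L)-lipschitz_on {a..b} (\<lambda>t. x t - y t)" by (rule lipschitz_on_diff[OF lx ly])
  have Lpos: "0 \<le> 1 + L" using lxy lipschitz_on_nonneg by blast
  have lf: "(r * (1 + L))-lipschitz_on {a..b} f"
  proof (rule lipschitz_onI)
    fix s t assume st: "s \<in> {a..b}" "t \<in> {a..b}"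
    define A B where "A = norm (x s - y s)" and "B = norm (x t - y t)"
    have "f s - f t = (A + B) * (A - B)" by (simp add: f_def A_def B_def power2_eq_square algebra_simps)
    then have "\<bar>f s - f t\<bar> = (A + B) * \<bar>A - B\<bar>" by (simp add: abs_mult A_def B_def)
    also have "\<dots> \<le> r * ((1 + L) * dist s t)"
    proof (rule mult_mono)
      show "A + B \<le> r" using close[OF st(1)] close[OF st(2)] by (simp add: A_def B_def)
      have "\<bar>A - B\<bar> \<le> norm ((x s - y s) - (x t - y t))" unfolding A_def B_def by (rule norm_triangle_ineq3)
      also have "\<dots> \<le> (1 + L) * dist s t" using lipschitz_onD[OF lxy st] by (simp add: dist_norm)
      finally show "\<bar>A - B\<bar> \<le> (1 + L) * dist s t" .
    qed (use r in auto)
    finally show "dist (f s) (f t) \<le> r * (1 + L) * dist s t" by (simp add: dist_real_def mult.assoc)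
  qed (use r Lpos in simp)
  have "continuous_on {a..b} f" by (rule lipschitz_on_continuous_on[OF lf])
  then obtain tm where tm: "tm \<in> {a..b}" "\<And>t. t \<in> {a..b} \<Longrightarrow> f t \<le> f tm"
    using continuous_attains_sup[OF compact_Icc, of a b f] ab by auto
  have f0: "0 \<le> f s" for s by (simp add: f_def)
  have "f tm - f a \<le> 4 / r * f tm * (tm - a)"
  proof (rule abs_continuous_mean_value_AE[OF _ _ _ neg])
    show "abs_continuous_on_interval a tm f"
      using tm(1) by (intro lipschitz_imp_abs_continuous[of "r * (1 + L)"] lipschitz_on_subset[OF lf]) auto
    show "0 \<le> 4 / r * f tm" using r f0 by simp
    fix s assume s: "s \<in> {a..tm} - N"
    then have sab: "s \<in> {a..b} - N" using tm(1) by auto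
    obtain v where v: "supergrad (x s) v" "(x has_vector_derivative v) (at s within {a..b})" using dx[OF sab] by blast
    obtain u where u: "supergrad (y s) u" "(y has_vector_derivative u) (at s within {a..b})" using dy[OF sab] by blast
    have sub: "{a..tm} \<subseteq> {a..b}" using tm(1) by auto
    have xr: "cball (x s) (2 * r) \<subseteq> \<Omega> - {k0}" using sab by (intro region_cball reg) auto
    have cl: "norm (x s - y s) \<le> r / 2" using sab by (intro close) auto
    have cx: "cball (x s) r \<subseteq> \<Omega> - {k0}" using r by (intro cball_subset_double[OF xr]) auto
    have cy: "cball (y s) r \<subseteq> \<Omega> - {k0}" using r cl by (intro cball_subset_double[OF xr]) (auto simp: norm_minus_commute)
    have "(v - u) \<bullet> (x s - y s) \<le> 2 / r * (norm (x s - y s))\<^sup>2"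
      using cx cy r(1) supergrad_imp_hull[OF cx r(1) v(1)] supergrad_imp_hull[OF cy r(1) u(1)] cl
      by (intro hull_one_sided_lipschitz) auto
    also have "\<dots> \<le> 2 / r * f tm" using tm(2)[of s] sab r by (intro mult_left_mono) (auto simp: f_def)
    finally have bd: "2 * ((v - u) \<bullet> (x s - y s)) \<le> 4 / r * f tm" by simp
    have dxy: "((\<lambda>s. x s - y s) has_vector_derivative (v - u)) (at s within {a..tm})"
      using v(2) u(2) sub by (intro has_vector_derivative_diff) (auto intro: has_vector_derivative_within_subset)
    have "((\<lambda>s. (x s - y s) \<bullet> (x s - y s)) has_vector_derivative (x s - y s) \<bullet> (v - u) + (v - u) \<bullet> (x s - y s)) (at s within {a..tm})"
      by (rule bounded_bilinear.has_vector_derivative[OF bounded_bilinear_inner dxy dxy])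
    then have "(f has_real_derivative 2 * ((v - u) \<bullet> (x s - y s))) (at s within {a..tm})"
      unfolding f_def by (simp add: has_real_derivative_iff_has_vector_derivative power2_norm_eq_inner inner_commute)
    then show "\<exists>w\<le>4 / r * f tm. (f has_real_derivative w) (at s within {a..tm})" using bd by blast
  qed (use tm in auto)
  also have "4 / r * f tm * (tm - a) = f tm * (4 / r * (tm - a))" by simp
  also have "\<dots> \<le> f tm * (1 / 2)"
  proof (rule mult_left_mono[OF _ f0])
    have "4 / r * (tm - a) \<le> 4 / r * (b - a)" using tm(1) r by (intro mult_left_mono) auto
    then show "4 / r * (tm - a) \<le> 1 / 2" using ab(2) by linarith
  qed
  finally have "f tm \<le> 0" using eq by (simp add: f_def)
  then have "f t \<le> 0" using tm(2)[OF t] by linarith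
  then show ?thesis by (simp add: f_def)
qed

text \<open>At the first time \<open>a\<close> of disagreement the curves still agree by continuity,
  and the short-time result carries agreement beyond \<open>a\<close>. The ball needed around
  \<open>y t\<close> is inherited from the one around \<open>x t\<close>.\<close>

lemma flow_unique:
  assumes lx: "1-lipschitz_on {0..} x" and reg: "\<And>t. 0 \<le> t \<Longrightarrow> x t \<in> region"
    and dx: "AE t in lebesgue. 0 \<le> t \<longrightarrow> (\<exists>v. supergrad (x t) v \<and> (x has_vector_derivative v) (at t within {0..}))"
    and ly: "L-lipschitz_on I y" and I: "I \<subseteq> {0..}" "\<And>s t. t \<in> I \<Longrightarrow> 0 \<le> s \<Longrightarrow> s \<le> t \<Longrightarrow> s \<in> I"
    and dy: "AE t in lebesgue. t \<in> I \<longrightarrow> (\<exists>v. supergrad (y t) v \<and> (y has_vector_derivative v) (at t within I))"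
    and eq: "x 0 = y 0" and t1: "t1 \<in> I"
  shows "y t1 = x t1"
proof (rule ccontr)
  assume neq: "y t1 \<noteq> x t1"
  obtain N1 where N1: "negligible N1" "\<And>t. t \<notin> N1 \<Longrightarrow> 0 \<le> t \<longrightarrow> (\<exists>v. supergrad (x t) v \<and> (x has_vector_derivative v) (at t within {0..}))"
    using AE_lebesgue_obtain_negligible[OF dx] by blast
  obtain N2 where N2: "negligible N2" "\<And>t. t \<notin> N2 \<Longrightarrow> t \<in> I \<longrightarrow> (\<exists>v. supergrad (y t) v \<and> (y has_vector_derivative v) (at t within I))"
    using AE_lebesgue_obtain_negligible[OF dy] by blast
  have neg: "negligible (N1 \<union> N2)" using N1(1) N2(1) by (rule negligible_Un)
  have t1': "0 \<le> t1" using I t1 by auto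
  have sub: "{0..t1} \<subseteq> I" using I(2)[OF t1] by auto
  have lxy: "(1 + L)-lipschitz_on {0..t1} (\<lambda>t. x t - y t)"
    using sub by (intro lipschitz_on_diff lipschitz_on_subset[OF lx] lipschitz_on_subset[OF ly]) auto
  have L0: "0 \<le> 1 + L" using lxy lipschitz_on_nonneg by blast
  have cont: "continuous_on {0..t1} (\<lambda>t. x t - y t)" by (rule lipschitz_on_continuous_on[OF lxy])
  define A where "A = {t \<in> {0..t1}. x t \<noteq> y t}"
  have A: "t1 \<in> A" "bdd_below A" using neq t1' by (auto simp: A_def intro: bdd_belowI[of _ 0])
  define a where "a = Inf A"
  have a: "0 \<le> a" "a \<le> t1" unfolding a_def using A by (auto simp: A_def intro!: cInf_greatest cInf_lower)
  have before: "x t = y t" if "0 \<le> t" "t < a" for t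
  proof (rule ccontr)
    assume "x t \<noteq> y t"
    then have "t \<in> A" using that a by (auto simp: A_def)
    then have "a \<le> t" unfolding a_def using A(2) by (rule cInf_lower)
    then show False using that by simp
  qed
  have xa: "x a = y a"
  proof (cases "a = 0")
    case False
    then have "a > 0" using a by simp
    show ?thesis
    proof (rule ccontr)
      assume "x a \<noteq> y a"
      define \<epsilon> where "\<epsilon> = norm (x a - y a)"
      have e: "\<epsilon> > 0" using \<open>x a \<noteq> y a\<close> by (simp add: \<epsilon>_def)
      define s where "s = max 0 (a - \<epsilon> / (2 * (1 + L) + 1))"
      have s: "0 \<le> s" "s < a" "a - s \<le> \<epsilon> / (2 * (1 + L) + 1)" using e L0 \<open>a > 0\<close> by (auto simp: s_def)
      have "\<epsilon> \<le> (1 + L) * (a - s)"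
        using lipschitz_onD[OF lxy, of a s] before[OF s(1,2)] a s by (simp add: dist_norm \<epsilon>_def)
      also have "\<dots> \<le> (1 + L) * (\<epsilon> / (2 * (1 + L) + 1))" using s L0 by (intro mult_left_mono) auto
      also have "\<dots> < \<epsilon>"
      proof -
        have "m * (\<epsilon> / (2 * m + 1)) < \<epsilon>" if "0 \<le> m" for m
          using e that mult_nonneg_nonneg[OF that, of \<epsilon>] by (simp add: field_simps add_pos_nonneg)
        then show ?thesis using L0 by blast
      qed
      finally show False by simp
    qed
  qed (use eq in simp)
  have "a < t1" using xa neq a by (cases "a = t1") auto
  \<comment> \<open>The term \<open>r / 8\<close> makes the interval short enough for the Gronwall
    argument; the other keeps the two curves within \<open>r / 2\<close> of each other, given their
    Lipschitz constants.\<close>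
  define b where "b = min t1 (a + min (r / 8) (r / (2 * (1 + L) + 1)))"
  have "0 < r / (2 * (1 + L) + 1)" using r L0 by simp
  then have "0 < min (r / 8) (r / (2 * (1 + L) + 1))" using r(1) by simp
  then have b: "a < b" "b \<le> t1" "b \<le> a + min (r / 8) (r / (2 * (1 + L) + 1))"
    using \<open>a < t1\<close> by (auto simp: b_def)
  then have b': "b - a \<le> r / 8" "b - a \<le> r / (2 * (1 + L) + 1)" by linarith+
  have abI: "{a..b} \<subseteq> I" "{a..b} \<subseteq> {0..}" "{a..b} \<subseteq> {0..t1}" using a b sub by auto
  have "x t = y t" if t: "t \<in> {a..b}" for t
  proof (rule flow_unique_short_time[where x = x and y = y and N = "N1 \<union> N2" and a = a and b = b and L = L])
    show "1-lipschitz_on {a..b} x" using abI by (intro lipschitz_on_subset[OF lx])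
    show "L-lipschitz_on {a..b} y" using abI by (intro lipschitz_on_subset[OF ly])
    show "a \<le> b" using b by simp
    show "4 / r * (b - a) \<le> 1 / 2" using b' r(1) by (simp add: field_simps)
    show "x t \<in> region" if "t \<in> {a..b}" for t using that a by (intro reg) auto
    show "norm (x t - y t) \<le> r / 2" if t: "t \<in> {a..b}" for t
    proof -
      have "norm (x t - y t) \<le> (1 + L) * (t - a)"
        using lipschitz_onD[OF lxy, of t a] xa t a b by (simp add: dist_norm)
      also have "\<dots> \<le> (1 + L) * (r / (2 * (1 + L) + 1))" using t b' L0 by (intro mult_left_mono) auto
      also have "\<dots> \<le> r / 2"
      proof -
        have "m * (r / (2 * m + 1)) \<le> r / 2" if "0 \<le> m" for m
          using r(1) that mult_nonneg_nonneg[OF that, of r] by (simp add: field_simps)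
        then show ?thesis using L0 by blast
      qed
      finally show ?thesis .
    qed
    show "\<exists>v. supergrad (x t) v \<and> (x has_vector_derivative v) (at t within {a..b})" if t': "t \<in> {a..b} - (N1 \<union> N2)" for t
    proof -
      obtain v where "supergrad (x t) v" "(x has_vector_derivative v) (at t within {0..})"
        using N1(2)[of t] t' a by auto
      then show ?thesis using has_vector_derivative_within_subset[OF _ abI(2)] by blast
    qed
    show "\<exists>v. supergrad (y t) v \<and> (y has_vector_derivative v) (at t within {a..b})" if t': "t \<in> {a..b} - (N1 \<union> N2)" for t
    proof -
      have "t \<in> I" using t' abI(1) by blast
      then obtain v where "supergrad (y t) v" "(y has_vector_derivative v) (at t within I)"
        using N2(2)[of t] t' by auto
      then show ?thesis using has_vector_derivative_within_subset[OF _ abI(1)] by blast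
    qed
  qed (use neg xa t in auto)
  moreover obtain s where "s \<in> A" "s < b" using cInf_lessD[of A b] A(1) b(1) unfolding a_def by auto
  moreover have "a \<le> s" unfolding a_def using \<open>s \<in> A\<close> A(2) by (rule cInf_lower)
  ultimately show False by (auto simp: A_def)
qed

text \<open>On a bounded path \<open>d\<close> is bounded, since straight lines in the half space
  are admissible. Then the height grows at least linearly in time, contradicting
  boundedness.\<close>

lemma d_flow_unbounded:
  assumes reg: "\<And>t. 0 \<le> t \<Longrightarrow> x t \<in> region"
    and grow: "\<And>t. 0 \<le> t \<Longrightarrow> t * (l0 / d (x t)) \<le> \<nu> \<bullet> x t - \<nu> \<bullet> x0"
  shows "\<not> bounded (x ` {0..})"
proof
  assume "bounded (x ` {0..})"
  then obtain B where B: "\<And>t. 0 \<le> t \<Longrightarrow> norm (x t) \<le> B" unfolding bounded_iff by auto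
  define M where "M = B + norm x0"
  have nM: "norm (x t - x0) \<le> M" if "0 \<le> t" for t
    using norm_triangle_ineq4[of "x t" x0] B[OF that] by (simp add: M_def)
  then have M0: "0 \<le> M" using norm_ge_zero order_trans by (metis order_refl)
  have d0: "0 < d x0" using r by linarith
  have dM: "d (x t) \<le> M + d x0" "0 < d (x t)" if "0 \<le> t" for t
  proof -
    have "d (x t) \<le> norm (x t - x0) + d x0" using reg[OF that] r by (intro d_le_halfspace) (auto simp: region_def)
    then show "d (x t) \<le> M + d x0" using nM[OF that] by simp
    show "0 < d (x t)" using reg[OF that] d0 by (simp add: region_def)
  qed
  \<comment> \<open>The time at which the guaranteed height gain reaches \<open>M + 1\<close>, while
    the path stays within \<open>M\<close> of \<open>x0\<close>.\<close>
  define t where "t = (M + 1) * (M + d x0) / l0"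
  have l0: "0 < l0" using r by linarith
  have t: "0 \<le> t" using M0 d0 l0 by (simp add: t_def)
  have "M + 1 = t * (l0 / (M + d x0))" using l0 M0 d0 by (simp add: t_def)
  also have "\<dots> \<le> t * (l0 / d (x t))" using dM[OF t] l0 t by (intro mult_left_mono divide_left_mono) auto
  also have "\<dots> \<le> \<nu> \<bullet> x t - \<nu> \<bullet> x0" by (rule grow[OF t])
  also have "\<dots> \<le> norm (x t - x0)" using nu_inner_le[of "x t - x0"] by (simp add: inner_diff_right)
  also have "\<dots> \<le> M" by (rule nM[OF t])
  finally show False by simp
qed

end

section \<open>The obstacle distance\<close>

lemma eikonal_obstacle_dist:
  fixes K :: "(real ^ 'n) set"
  assumes "closed K" "connected (- K)" "k0 \<in> - K"
  shows "eikonal (- K) k0 (obstacle_dist K k0)"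
proof -
  note ne = reach_times_nonempty[OF assms]
  note eq = obstacle_dist_eq_Inf[OF ne]
  have lower: "obstacle_dist K k0 x \<le> t" if "t \<in> reach_times K k0 x" for x t
    using that cInf_lower[OF that bdd_below_reach_times] obstacle_dist_eq_Inf[of K k0 x] by (metis empty_iff)
  have ge: "norm (x - k0) \<le> obstacle_dist K k0 x" if "x \<in> - K" for x
    unfolding eq[OF that] using ne[OF that] reach_times_norm_le by (intro cInf_greatest) auto
  have Kc: "- K \<subseteq> closure (- K)" by (rule closure_subset)
  show ?thesis
  proof
    show "open (- K)" using assms(1) by (rule open_Compl)
    show "k0 \<in> - K" by fact
    have "(\<lambda>t. k0) \<in> admissible_curves K"
      unfolding admissible_curves_eq_lipschitz using assms(3) Kc by (auto intro!: lipschitz_onI)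
    then have "0 \<in> reach_times K k0 k0" unfolding reach_times_def by (intro CollectI conjI bexI[of _ "\<lambda>t. k0"]) auto
    then show "obstacle_dist K k0 k0 = 0" using lower[of 0 k0] ge[OF assms(3)] by simp
    show "norm (x - k0) \<le> obstacle_dist K k0 x" if "x \<in> - K" for x by (rule ge[OF that])
    show "obstacle_dist K k0 y \<le> norm (y - z) + obstacle_dist K k0 z" if seg: "closed_segment y z \<subseteq> - K" for y z
    proof -
      have z: "z \<in> - K" using seg by auto
      have "obstacle_dist K k0 y - norm (y - z) \<le> obstacle_dist K k0 z"
        unfolding eq[OF z]
      proof (rule cInf_greatest[OF ne[OF z]])
        fix t assume "t \<in> reach_times K k0 z"
        then have "norm (y - z) + t \<in> reach_times K k0 y" using seg Kc by (intro reach_times_segment) auto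
        then show "obstacle_dist K k0 y - norm (y - z) \<le> t" using lower by fastforce
      qed
      then show ?thesis by simp
    qed
    show "\<exists>z\<in>sphere a b. norm (y - z) + obstacle_dist K k0 z < obstacle_dist K k0 y + e"
      if cb: "cball a b \<subseteq> - K - {k0}" and y: "y \<in> ball a b" and e: "0 < e" for a b y e
    proof -
      have yK: "y \<in> - K" using cb y ball_subset_cball by blast
      obtain T where T: "T \<in> reach_times K k0 y" "T < obstacle_dist K k0 y + e"
        using cInf_lessD[OF ne[OF yK], of "obstacle_dist K k0 y + e"] e eq[OF yK] by auto
      have "k0 \<notin> ball a b" using cb ball_subset_cball by blast
      from reach_times_cross_sphere[OF T(1) y this]
      obtain z s where z: "z \<in> sphere a b" "norm (y - z) \<le> s" "T - s \<in> reach_times K k0 z" by metis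
      then show ?thesis using lower[OF z(3)] T(2) by (intro bexI[OF _ z(1)]) linarith
    qed
  qed
qed

text \<open>Near a point \<open>q\<close> of the frontier of \<open>U\<close> nearest to \<open>x0\<close>, the boundary is crossed
  transversally by the rays from \<open>x0\<close>, so that the points outside \<open>U\<close> near \<open>q\<close> are
  exactly the visible ones.\<close>

lemma nearest_point_visibility:
  fixes U :: "(real ^ 'n) set" and x0 q :: "real ^ 'n"
  assumes C2: "C2_boundary U" and q: "q \<in> frontier U" and qU: "q \<in> closure U" "q \<notin> U"
    and R: "R > 0" and e: "norm e = 1" "q = x0 + R *\<^sub>R e" and disj: "ball x0 R \<inter> closure U = {}"
  obtains \<delta> where "\<delta> > 0" "\<And>z. z \<in> cball q \<delta> \<Longrightarrow> z \<notin> U \<Longrightarrow> open_segment x0 z \<subseteq> - closure U"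
    "\<And>s. 0 < s \<Longrightarrow> s \<le> \<delta> \<Longrightarrow> q + s *\<^sub>R e \<in> U"
proof -
  obtain V \<phi> where V: "open V" "q \<in> V" "C2_on \<phi> V" "\<And>x. x \<in> V \<Longrightarrow> \<not> (GDERIV \<phi> x :> 0)" "U \<inter> V = {x \<in> V. \<phi> x < 0}"
    using C2 q unfolding C2_boundary_def by metis
  obtain g H where gH: "\<And>x. x \<in> V \<Longrightarrow> GDERIV \<phi> x :> g x" "\<And>x. x \<in> V \<Longrightarrow> (g has_derivative (\<lambda>h. H x *v h)) (at x)"
    using V(3) unfolding C2_on_def by metis
  have inU: "x \<in> U \<longleftrightarrow> \<phi> x < 0" if "x \<in> V" for x using V(5) that by auto
  have cont\<phi>: "isCont \<phi> x" if "x \<in> V" for x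
    using gH(1)[OF that] unfolding gderiv_def by (rule has_derivative_continuous)
  have contg: "isCont g q" using gH(2)[OF V(2)] by (rule has_derivative_continuous)
  have g0: "g q \<noteq> 0" using gH(1)[OF V(2)] V(4)[OF V(2)] by metis
  have pos_out: "x \<notin> closure U" if xV: "x \<in> V" "0 < \<phi> x" for x
  proof
    assume "x \<in> closure U"
    have "\<forall>\<^sub>F y in at x. 0 < \<phi> y" using cont\<phi>[OF xV(1)] xV(2) by (simp add: isCont_def order_tendstoD)
    then obtain \<epsilon>1 where e1: "\<epsilon>1 > 0" "\<And>y. y \<noteq> x \<Longrightarrow> dist y x < \<epsilon>1 \<Longrightarrow> 0 < \<phi> y" unfolding eventually_at by auto
    obtain \<epsilon>2 where e2: "\<epsilon>2 > 0" "ball x \<epsilon>2 \<subseteq> V" by (rule openE[OF V(1) xV(1)])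
    obtain y where y: "y \<in> U" "dist y x < min \<epsilon>1 \<epsilon>2"
      using \<open>x \<in> closure U\<close> e1(1) e2(1) unfolding closure_approachable by (metis min_less_iff_conj)
    then have "y \<in> V" using e2(2) by (auto simp: dist_commute)
    then have "\<phi> y < 0" using inU y(1) by blast
    moreover have "0 < \<phi> y" using e1(2)[of y] y(2) xV(2) by (cases "y = x") auto
    ultimately show False by simp
  qed
  have \<phi>q: "\<phi> q \<le> 0" using pos_out[OF V(2)] qU(1) not_less by blast
  have \<phi>q': "0 \<le> \<phi> q" using inU[OF V(2)] qU(2) by simp
  obtain \<epsilon> where \<epsilon>: "\<epsilon> > 0" "ball q \<epsilon> \<subseteq> V" by (rule openE[OF V(1,2)])
  \<comment> \<open>Directions with \<open>w \<bullet> e < 0\<close> enter the ball around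
    \<open>x0\<close>, where \<open>\<phi> \<ge> 0\<close>, while \<open>\<phi>\<close> vanishes at
    \<open>q\<close>. So \<open>\<phi>\<close> cannot decrease along them to first order.\<close>
  have inward: "0 \<le> w \<bullet> g q" if w: "w \<bullet> e < 0" for w
  proof -
    have w0: "norm w > 0" using w by auto
    define \<beta> where "\<beta> = min (2 * R * (- (w \<bullet> e)) / (norm w)\<^sup>2) (\<epsilon> / norm w)"
    have "0 < 2 * R * (- (w \<bullet> e)) / (norm w)\<^sup>2" using w w0 R by (intro divide_pos_pos mult_pos_pos) auto
    then have \<beta>: "\<beta> > 0" using w0 \<epsilon>(1) by (simp only: \<beta>_def min_less_iff_conj divide_pos_pos)
    have "GDERIV (\<lambda>x. - \<phi> x) q :> - g q" using gH(1)[OF V(2)] by (rule GDERIV_minus)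
    then have "w \<bullet> (- g q) \<le> 0"
    proof (rule GDERIV_along_line_le[OF _ \<beta>])
      fix s assume s: "0 < s" "s < \<beta>"
      have "s * norm w < \<epsilon>" using s w0 by (simp add: \<beta>_def pos_less_divide_eq)
      then have inV: "q + s *\<^sub>R w \<in> V" using \<epsilon>(2) s by (auto simp: dist_norm subset_iff)
      have "s < 2 * R * (- (w \<bullet> e)) / (norm w)\<^sup>2" using s(2) by (simp only: \<beta>_def min_less_iff_conj)
      then have "s * (norm w)\<^sup>2 < 2 * R * (- (w \<bullet> e))" using w0 by (simp only: pos_less_divide_eq zero_less_power)
      then have "s * (s * (norm w)\<^sup>2 + 2 * R * (w \<bullet> e)) < 0" using s by (intro mult_pos_neg) auto
      moreover have "(norm (q + s *\<^sub>R w - x0))\<^sup>2 = R\<^sup>2 + s * (s * (norm w)\<^sup>2 + 2 * R * (w \<bullet> e))"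
        using e(1) unfolding e(2) power2_norm_eq_inner
        by (simp add: inner_add_left inner_add_right inner_commute norm_eq_1 power2_eq_square algebra_simps)
      ultimately have "(norm (q + s *\<^sub>R w - x0))\<^sup>2 < R\<^sup>2" by linarith
      then have "norm (q + s *\<^sub>R w - x0) < R" using R by (simp add: power2_less_imp_less)
      then have "q + s *\<^sub>R w \<in> ball x0 R" by (simp add: dist_norm norm_minus_commute)
      then have "q + s *\<^sub>R w \<notin> U" using disj closure_subset by blast
      then have "0 \<le> \<phi> (q + s *\<^sub>R w)" using inU[OF inV] by simp
      then show "- \<phi> (q + s *\<^sub>R w) \<le> - \<phi> q + s * 0" using \<phi>q by simp
    qed
    then show ?thesis by simp
  qed
  \<comment> \<open>Otherwise \<open>- g q - e\<close> would be one of these directions, although it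
    is descending for \<open>\<phi>\<close>.\<close>
  have eg: "e \<bullet> g q < 0"
  proof (rule ccontr)
    assume "\<not> e \<bullet> g q < 0"
    then have ge: "0 \<le> e \<bullet> g q" by simp
    have "(- g q - e) \<bullet> e = - (e \<bullet> g q) - e \<bullet> e" by (simp add: inner_diff_left inner_commute[of "g q" e])
    then have "(- g q - e) \<bullet> e < 0" using ge e(1) by (simp add: norm_eq_1)
    then have "0 \<le> (- g q - e) \<bullet> g q" by (rule inward)
    then have "g q \<bullet> g q \<le> 0" using ge by (simp add: inner_diff_left)
    then show False using g0 inner_gt_zero_iff[of "g q"] by linarith
  qed
  define c where "c = - (e \<bullet> g q)"
  have c: "c > 0" using eg by (simp add: c_def)
  have "\<forall>\<^sub>F x in at q. norm (g x - g q) < c / 4"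
    using tendstoD[OF contg[unfolded isCont_def], of "c / 4"] c by (simp add: dist_norm)
  then obtain \<epsilon>' where \<epsilon>': "\<epsilon>' > 0" "\<And>x. x \<noteq> q \<Longrightarrow> dist x q < \<epsilon>' \<Longrightarrow> norm (g x - g q) < c / 4"
    unfolding eventually_at by auto
  define \<delta>1 where "\<delta>1 = min \<epsilon> \<epsilon>'"
  have d1: "\<delta>1 > 0" "ball q \<delta>1 \<subseteq> V" "\<And>x. x \<in> ball q \<delta>1 \<Longrightarrow> norm (g x - g q) < c / 4"
  proof -
    show "\<delta>1 > 0" using \<epsilon> \<epsilon>' by (simp add: \<delta>1_def)
    show "ball q \<delta>1 \<subseteq> V" using \<epsilon>(2) by (auto simp: \<delta>1_def)
    show "norm (g x - g q) < c / 4" if "x \<in> ball q \<delta>1" for x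
      using \<epsilon>'(2)[of x] that c by (cases "x = q") (auto simp: \<delta>1_def dist_commute)
  qed
  have decr: "\<phi> (p + \<tau> *\<^sub>R u) < \<phi> p" if "\<tau> > 0" "p \<in> ball q \<delta>1" "p + \<tau> *\<^sub>R u \<in> ball q \<delta>1" "norm u = 1"
      "norm (u - e) * norm (g q) \<le> c / 4" for p u \<tau>
  proof -
    have "\<phi> (p + 0 *\<^sub>R u) > \<phi> (p + \<tau> *\<^sub>R u)"
    proof (rule DERIV_neg_imp_decreasing[OF that(1), of "\<lambda>t. \<phi> (p + t *\<^sub>R u)"])
      fix t assume t: "0 \<le> t" "t \<le> \<tau>"
      have "p + t *\<^sub>R u \<in> closed_segment p (p + \<tau> *\<^sub>R u)"
        unfolding in_segment using t that(1) by (intro exI[of _ "t / \<tau>"]) (auto simp: algebra_simps)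
      then have inb: "p + t *\<^sub>R u \<in> ball q \<delta>1"
        using closed_segment_subset[OF that(2,3) convex_ball] by blast
      then have "GDERIV \<phi> (p + t *\<^sub>R u) :> g (p + t *\<^sub>R u)" using d1(2) gH(1) by blast
      then have f': "(\<phi> has_derivative (\<lambda>h. h \<bullet> g (p + t *\<^sub>R u))) (at (p + t *\<^sub>R u))" by (simp add: gderiv_def)
      have "((\<lambda>t. p + t *\<^sub>R u) has_derivative (\<lambda>h. h *\<^sub>R u)) (at t)" by (auto intro!: derivative_eq_intros)
      from has_derivative_compose[OF this f']
      have D: "((\<lambda>t. \<phi> (p + t *\<^sub>R u)) has_real_derivative (u \<bullet> g (p + t *\<^sub>R u))) (at t)"
        unfolding has_field_derivative_def by (simp add: mult_commute_abs)
      have "u \<bullet> g (p + t *\<^sub>R u) = e \<bullet> g q + (u - e) \<bullet> g q + u \<bullet> (g (p + t *\<^sub>R u) - g q)"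
        by (simp add: inner_diff_left inner_diff_right)
      also have "(u - e) \<bullet> g q \<le> c / 4" using norm_cauchy_schwarz[of "u - e" "g q"] that(5) by linarith
      also have "u \<bullet> (g (p + t *\<^sub>R u) - g q) \<le> c / 4"
        using norm_cauchy_schwarz[of u "g (p + t *\<^sub>R u) - g q"] that(4) d1(3)[OF inb] by simp
      finally have "u \<bullet> g (p + t *\<^sub>R u) < 0" using c by (simp add: c_def)
      then show "\<exists>y. ((\<lambda>t. \<phi> (p + t *\<^sub>R u)) has_real_derivative y) (at t) \<and> y < 0" using D by blast
    qed
    then show ?thesis by simp
  qed
  define N where "N = norm (g q) + 1"
  have gp: "N > 0" "norm (g q) \<le> N" by (simp_all add: N_def add_nonneg_pos)
  \<comment> \<open>The first bound keeps points at distance \<open>3 * \<delta>\<close> from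
    \<open>q\<close> in \<open>ball q \<delta>1\<close>, the second keeps \<open>z\<close> away from
    \<open>x0\<close>, and the third turns the direction from \<open>x0\<close> to \<open>z\<close>
    close enough to \<open>e\<close> for \<open>decr\<close>.\<close>
  define \<delta> where "\<delta> = min (\<delta>1 / 4) (min (R / 2) (c * R / (8 * N)))"
  have \<delta>: "\<delta> > 0" "\<delta> \<le> \<delta>1 / 4" "\<delta> \<le> R / 2" "\<delta> \<le> c * R / (8 * N)"
  proof -
    show "\<delta> > 0" using d1(1) R c gp(1) by (simp add: \<delta>_def)
    show "\<delta> \<le> \<delta>1 / 4" unfolding \<delta>_def by (rule min.cobounded1)
    show "\<delta> \<le> R / 2" unfolding \<delta>_def by (rule min.coboundedI2[OF min.cobounded1])
    show "\<delta> \<le> c * R / (8 * N)" unfolding \<delta>_def by (rule min.coboundedI2[OF min.cobounded2])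
  qed
  show ?thesis
  proof
    show "\<delta> > 0" by (rule \<delta>(1))
    fix s assume s: "0 < s" "s \<le> \<delta>"
    have "q + s *\<^sub>R e \<in> ball q \<delta>1" using s e(1) \<delta> d1(1) by (simp add: dist_norm)
    moreover from this have "\<phi> (q + s *\<^sub>R e) < \<phi> q" using s d1(1) e(1) c by (intro decr) auto
    ultimately show "q + s *\<^sub>R e \<in> U" using \<phi>q d1(2) inU by (metis less_le_trans subsetD)
  next
    fix z assume z: "z \<in> cball q \<delta>" "z \<notin> U"
    define l where "l = norm (z - x0)"
    define u where "u = (1 / l) *\<^sub>R (z - x0)"
    have qz: "norm (z - q) \<le> \<delta>" using z(1) by (simp add: dist_norm norm_minus_commute)
    have qx: "q - x0 = R *\<^sub>R e" using e(2) by simp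
    have lR: "\<bar>l - R\<bar> \<le> norm (z - q)"
      using norm_triangle_ineq3[of "z - x0" "q - x0"] e(1) R unfolding l_def qx by (simp add: e(2) diff_diff_eq)
    then have l: "l > 0" using qz \<delta> R by linarith
    have nu: "norm u = 1" using l by (simp add: u_def l_def)
    have zu: "z = x0 + l *\<^sub>R u" using l by (simp add: u_def)
    have ue: "R * norm (u - e) \<le> 2 * norm (z - q)"
    proof -
      have "R *\<^sub>R (u - e) = (z - q) + (R - l) *\<^sub>R u"
        unfolding e(2) using zu by (simp add: algebra_simps)
      then have "R * norm (u - e) = norm ((z - q) + (R - l) *\<^sub>R u)" using R by (metis abs_of_pos norm_scaleR)
      also have "\<dots> \<le> norm (z - q) + \<bar>R - l\<bar>" using norm_triangle_ineq[of "z - q" "(R - l) *\<^sub>R u"] nu by simp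
      finally show ?thesis using lR by linarith
    qed
    have small: "norm (u - e) * norm (g q) \<le> c / 4"
    proof -
      have "R * norm (u - e) \<le> 2 * (c * R / (8 * N))" using ue qz \<delta>(4) by linarith
      also have "\<dots> = R * (c / 4 / N)" by simp
      finally have "norm (u - e) \<le> c / 4 / N" using R by (simp only: mult_le_cancel_left_pos)
      then have "norm (u - e) * N \<le> c / 4" using gp(1) by (simp only: pos_le_divide_eq)
      moreover have "norm (u - e) * norm (g q) \<le> norm (u - e) * N" using gp(2) by (intro mult_left_mono) auto
      ultimately show ?thesis by linarith
    qed
    show "open_segment x0 z \<subseteq> - closure U"
    proof
      fix w assume "w \<in> open_segment x0 z"
      then obtain v where v: "0 < v" "v < 1" "w = (1 - v) *\<^sub>R x0 + v *\<^sub>R z" unfolding in_segment by auto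
      define \<tau> where "\<tau> = v * l"
      have \<tau>: "0 < \<tau>" "\<tau> < l" using v l by (auto simp: \<tau>_def)
      have w: "w = x0 + \<tau> *\<^sub>R u" unfolding v(3) zu \<tau>_def by (simp add: algebra_simps)
      show "w \<in> - closure U"
      proof (cases "\<tau> < R")
        case True
        then have "w \<in> ball x0 R" using w \<tau> nu by (simp add: dist_norm)
        then show ?thesis using disj by blast
      next
        case False
        \<comment> \<open>Beyond radius \<open>R\<close> the rest of the segment lies near
          \<open>q\<close>, where \<open>\<phi>\<close> strictly decreases along it. It ends at
          \<open>z\<close> with \<open>\<phi> z \<ge> 0\<close>, so \<open>\<phi>\<close> is
          positive before.\<close>
        have "w - q = (\<tau> - R) *\<^sub>R u + R *\<^sub>R (u - e)" unfolding w e(2) by (simp add: algebra_simps)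
        then have "norm (w - q) \<le> \<bar>\<tau> - R\<bar> + R * norm (u - e)"
          using norm_triangle_ineq[of "(\<tau> - R) *\<^sub>R u" "R *\<^sub>R (u - e)"] nu R by simp
        also have "\<dots> \<le> 3 * \<delta>" using False \<tau> lR ue qz by linarith
        finally have wb: "w \<in> ball q \<delta>1" using \<delta> d1(1) by (simp add: dist_norm norm_minus_commute)
        have zb: "z \<in> ball q \<delta>1" using z(1) \<delta> d1(1) by simp
        have zw: "w + (l - \<tau>) *\<^sub>R u = z" using w zu by (simp add: algebra_simps)
        have "\<phi> (w + (l - \<tau>) *\<^sub>R u) < \<phi> w"
          using \<tau> wb zb nu small zw by (intro decr) auto
        moreover have "0 \<le> \<phi> z" using inU[of z] z(2) zb d1(2) by auto
        ultimately have "0 < \<phi> w" using zw by simp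
        then have "w \<notin> closure U" using pos_out wb d1(2) by blast
        then show ?thesis by simp
      qed
    qed
  qed
qed

text \<open>If the ray from \<open>x0\<close> straight at the nearest point \<open>q\<close> were
  minimal, near-optimal curves from points \<open>y n\<close> of the ray close to \<open>q\<close>
  would leave a small sphere around \<open>q\<close> at visible points \<open>z n\<close>. The
  direct segment from \<open>x0\<close> to \<open>z n\<close> cannot be much better than the detour
  through \<open>y n\<close>. In the limit \<open>q\<close> lies between \<open>x0\<close> and the
  exit point, which is then behind the boundary, inside \<open>U\<close>.\<close>

lemma nearest_direction_not_minimal:
  fixes U K :: "(real ^ 'n) set"
  assumes U: "open U" "C2_boundary U" and K: "K = closure U" "K \<noteq> {}" and conn: "connected (- K)" and k0: "k0 \<in> - K"
    and cb: "cball x0 r \<subseteq> - K - {k0}" and r: "r > 0"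
    and sing: "eikonal.singular (- K) (obstacle_dist K k0) x0"
  obtains \<theta> where "norm \<theta> = 1" "\<theta> \<notin> eikonal.bdirs (obstacle_dist K k0) r x0"
proof -
  define d where "d = obstacle_dist K k0"
  have cK: "closed K" using K by simp
  interpret eikonal "- K" k0 d unfolding d_def by (rule eikonal_obstacle_dist[OF cK conn k0])
  obtain q where q: "q \<in> K" "\<And>y. y \<in> K \<Longrightarrow> dist x0 q \<le> dist x0 y"
    using distance_attains_inf[OF cK K(2)] by blast
  define R where "R = dist x0 q"
  have x0: "x0 \<in> - K" using cb r by (meson centre_in_cball less_imp_le subsetD DiffD1)
  then have R: "R > 0" using q(1) unfolding R_def by (metis ComplD zero_less_dist_iff)
  define e where "e = (1 / R) *\<^sub>R (q - x0)"
  have e: "norm e = 1" "q = x0 + R *\<^sub>R e" using R by (auto simp: e_def R_def dist_norm norm_minus_commute)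
  have disj: "ball x0 R \<inter> closure U = {}" using q(2) K(1) unfolding R_def by force
  have qU: "q \<notin> U"
  proof
    assume "q \<in> U"
    then obtain \<epsilon> where ep: "\<epsilon> > 0" "ball q \<epsilon> \<subseteq> U" by (rule openE[OF U(1)])
    define s where "s = min (\<epsilon> / 2) (R / 2)"
    have s: "s > 0" "s < \<epsilon>" "s < R" using ep R by (auto simp: s_def)
    have "q - s *\<^sub>R e \<in> U" using ep(2) s e(1) by (auto simp: dist_norm subset_iff)
    moreover have "q - s *\<^sub>R e = x0 + (R - s) *\<^sub>R e" using e(2) by (simp add: algebra_simps)
    then have "q - s *\<^sub>R e \<in> ball x0 R" using s e(1) by (simp add: dist_norm)
    ultimately show False using disj closure_subset by blast
  qed
  have qc: "q \<in> closure U" using q(1) K(1) by simp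
  have "q \<in> frontier U" using qc qU U(1) by (simp add: frontier_def interior_open)
  from nearest_point_visibility[OF U(2) this qc qU R e disj]
  obtain \<delta>0 where \<delta>0: "\<delta>0 > 0" "\<And>z. z \<in> cball q \<delta>0 \<Longrightarrow> z \<notin> U \<Longrightarrow> open_segment x0 z \<subseteq> - closure U"
    "\<And>s. 0 < s \<Longrightarrow> s \<le> \<delta>0 \<Longrightarrow> q + s *\<^sub>R e \<in> U" by metis
  define \<delta> where "\<delta> = min \<delta>0 (min (R / 2) (dist q k0 / 2))"
  have "dist q k0 > 0" using q(1) k0 by auto
  moreover have "\<delta> \<le> R / 2" unfolding \<delta>_def by (rule min.coboundedI2[OF min.cobounded1])
  moreover have "\<delta> \<le> dist q k0 / 2" unfolding \<delta>_def by (rule min.coboundedI2[OF min.cobounded2])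
  moreover have "\<delta> \<le> \<delta>0" unfolding \<delta>_def by (rule min.cobounded1)
  moreover have "\<delta> > 0" using \<delta>0(1) R \<open>dist q k0 > 0\<close> by (simp add: \<delta>_def)
  ultimately have \<delta>: "\<delta> > 0" "\<delta> \<le> \<delta>0" "\<delta> < R" "\<delta> < dist q k0" using R by linarith+
  have "- e \<notin> bdirs r x0"
  proof
    assume p: "- e \<in> bdirs r x0"
    have sing': "singular x0" using sing unfolding d_def .
    obtain \<rho> where \<rho>: "0 < \<rho>" "x0 - \<rho> *\<^sub>R (- e) \<notin> - K"
      "\<And>s. 0 \<le> s \<Longrightarrow> s < \<rho> \<Longrightarrow> x0 - s *\<^sub>R (- e) \<in> - K \<and> d (x0 - s *\<^sub>R (- e)) = d x0 - s"
      using singular_ray_leaves[OF cb r p sing'] by metis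
    have "R \<le> \<rho>" using q(2)[of "x0 + \<rho> *\<^sub>R e"] \<rho>(1,2) e(1) by (simp add: R_def dist_norm)
    then have along: "x0 + s *\<^sub>R e \<in> - K \<and> d (x0 + s *\<^sub>R e) = d x0 - s" if "0 \<le> s" "s < R" for s
      using \<rho>(3)[of s] that by simp
    \<comment> \<open>Two successors, so that every \<open>y n\<close> lies strictly inside the ball
      of radius \<open>\<delta>\<close> around \<open>q\<close>.\<close>
    define s where "s n = R - \<delta> / real (Suc (Suc n))" for n
    have sn: "0 \<le> s n" "s n < R" "R - s n < \<delta>" for n
    proof -
      have "\<delta> / real (Suc (Suc n)) < \<delta>" "0 < \<delta> / real (Suc (Suc n))" using \<delta>(1) by (auto simp: field_simps add_pos_nonneg)
      then show "0 \<le> s n" "s n < R" "R - s n < \<delta>" using \<delta>(3) unfolding s_def by linarith+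
    qed
    have sl: "s \<longlonglongrightarrow> R"
    proof -
      have "s \<longlonglongrightarrow> R - 0" unfolding s_def
        by (intro tendsto_intros LIMSEQ_Suc[OF LIMSEQ_Suc[OF lim_const_over_n]])
      then show ?thesis by simp
    qed
    define y where "y n = x0 + s n *\<^sub>R e" for n
    have yK: "y n \<in> - K" "d (y n) = d x0 - s n" for n using along[OF sn(1,2)] by (auto simp: y_def)
    have "\<exists>z. z \<in> sphere q \<delta> \<and> z \<notin> U \<and> norm (y n - z) + s n \<le> norm (x0 - z) + 1 / real (Suc n)" for n
    proof -
      have ne: "reach_times K k0 (y n) \<noteq> {}" by (rule reach_times_nonempty[OF cK conn k0 yK(1)])
      obtain T where T: "T \<in> reach_times K k0 (y n)" "T < d (y n) + 1 / real (Suc n)"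
        using cInf_lessD[OF ne, of "d (y n) + 1 / real (Suc n)"] obstacle_dist_eq_Inf[OF ne] by (auto simp: d_def)
      have "norm (y n - q) < \<delta>"
      proof -
        have "y n - q = (s n - R) *\<^sub>R e" unfolding y_def e(2) by (simp add: algebra_simps)
        then show ?thesis using e(1) sn[of n] by simp
      qed
      then have yb: "y n \<in> ball q \<delta>" by (simp add: dist_norm norm_minus_commute)
      have "k0 \<notin> ball q \<delta>" using \<delta>(4) by simp
      from reach_times_cross_sphere[OF T(1) yb this]
      obtain z \<sigma> where z: "z \<in> sphere q \<delta>" "z \<in> closure (- K)" "norm (y n - z) \<le> \<sigma>" "T - \<sigma> \<in> reach_times K k0 z" by metis
      have "closure (- K) \<inter> U = {}"
        using U(1) closure_subset[of U] unfolding K(1) by (subst Int_commute, subst open_Int_closure_eq_empty) auto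
      then have zU: "z \<notin> U" using z(2) by blast
      have zx: "x0 \<noteq> z"
      proof
        assume "x0 = z"
        then have "R = \<delta>" using z(1) by (simp add: R_def dist_commute)
        then show False using \<delta>(3) by simp
      qed
      \<comment> \<open>The exit point \<open>z\<close> may lie on the boundary of the obstacle. The
        closed segment is then only in \<open>closure (- K)\<close>, which suffices for an
        admissible curve.\<close>
      have "open_segment x0 z \<subseteq> - K" using \<delta>0(2)[of z] z(1) zU \<delta>(2) K(1) by simp
      then have "closure (open_segment x0 z) \<subseteq> closure (- K)" by (rule closure_mono)
      then have "closed_segment x0 z \<subseteq> closure (- K)" using zx by (simp add: closure_open_segment)
      from reach_times_segment[OF z(4) this]
      have "norm (x0 - z) + (T - \<sigma>) \<in> reach_times K k0 x0" .
      then have "d x0 \<le> norm (x0 - z) + (T - \<sigma>)"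
        unfolding d_def using obstacle_dist_eq_Inf[of K k0 x0] cInf_lower[OF _ bdd_below_reach_times] by (metis empty_iff)
      then have "norm (y n - z) + s n \<le> norm (x0 - z) + 1 / real (Suc n)" using T(2) z(3) yK(2)[of n] by linarith
      then show ?thesis using z(1) zU by blast
    qed
    then obtain z where z: "\<And>n. z n \<in> sphere q \<delta>" "\<And>n. z n \<notin> U"
      "\<And>n. norm (y n - z n) + s n \<le> norm (x0 - z n) + 1 / real (Suc n)" by metis
    obtain w \<phi> where w: "w \<in> sphere q \<delta>" "strict_mono (\<phi> :: nat \<Rightarrow> nat)" "(z \<circ> \<phi>) \<longlonglongrightarrow> w"
      using compact_sphere[of q \<delta>, unfolded compact_def, rule_format, of z] z(1) by blast
    have zl: "(\<lambda>n. z (\<phi> n)) \<longlonglongrightarrow> w" using w(3) by (simp add: comp_def)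
    have "w \<notin> U"
    proof -
      have "closed (- U)" using U(1) by (rule closed_Compl)
      then have "w \<in> - U" by (rule closed_sequentially[OF _ _ zl]) (use z(2) in simp)
      then show ?thesis by simp
    qed
    have sl': "(\<lambda>n. s (\<phi> n)) \<longlonglongrightarrow> R" using LIMSEQ_subseq_LIMSEQ[OF sl w(2)] by (simp add: comp_def)
    have il: "(\<lambda>n. 1 / real (Suc (\<phi> n))) \<longlonglongrightarrow> 0"
      using LIMSEQ_subseq_LIMSEQ[OF LIMSEQ_Suc[OF lim_const_over_n[of 1]] w(2)] by (simp add: comp_def)
    have "norm (x0 + R *\<^sub>R e - w) + R \<le> norm (x0 - w) + 0"
    proof (rule LIMSEQ_le)
      show "(\<lambda>n. norm (y (\<phi> n) - z (\<phi> n)) + s (\<phi> n)) \<longlonglongrightarrow> norm (x0 + R *\<^sub>R e - w) + R"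
        unfolding y_def by (intro tendsto_intros sl' zl)
      show "(\<lambda>n. norm (x0 - z (\<phi> n)) + 1 / real (Suc (\<phi> n))) \<longlonglongrightarrow> norm (x0 - w) + 0"
        by (intro tendsto_intros zl il)
    qed (use z(3) in blast)
    moreover have "norm (x0 + R *\<^sub>R e - w) = \<delta>" using w(1) e(2) by (simp add: dist_norm)
    \<comment> \<open>Equality in the triangle inequality for \<open>x0\<close>, \<open>q\<close>,
      \<open>w\<close>: the exit point is \<open>q + \<delta> e\<close>, which lies in
      \<open>U\<close>.\<close>
    ultimately have far: "\<delta> + R \<le> norm (x0 - w)" by simp
    define v where "v = (1 / \<delta>) *\<^sub>R (w - q)"
    have v: "norm v = 1" "w = q + \<delta> *\<^sub>R v" using w(1) \<delta>(1) by (auto simp: v_def dist_norm norm_minus_commute)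
    have "(\<delta> + R)\<^sup>2 \<le> (norm (x0 - w))\<^sup>2" using far \<delta>(1) R by (intro power_mono) auto
    moreover have "(norm (x0 - w))\<^sup>2 = R\<^sup>2 + 2 * (R * \<delta>) * (e \<bullet> v) + \<delta>\<^sup>2"
    proof -
      have "x0 - w = - (R *\<^sub>R e + \<delta> *\<^sub>R v)" unfolding v(2) e(2) by simp
      then have "(norm (x0 - w))\<^sup>2 = (norm (R *\<^sub>R e + \<delta> *\<^sub>R v))\<^sup>2" by (simp only: norm_minus_cancel)
      also have "\<dots> = R\<^sup>2 + 2 * (R * \<delta>) * (e \<bullet> v) + \<delta>\<^sup>2" using e(1) v(1) unfolding power2_norm_eq_inner
        by (simp add: inner_add_left inner_add_right inner_commute norm_eq_1 power2_eq_square algebra_simps)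
      finally show ?thesis .
    qed
    ultimately have "2 * (R * \<delta>) * 1 \<le> 2 * (R * \<delta>) * (e \<bullet> v)" by (simp add: power2_eq_square algebra_simps)
    then have "1 \<le> e \<bullet> v" using R \<delta>(1) by (simp only: mult_le_cancel_left_pos mult_pos_pos zero_less_numeral)
    then have "e = v" using unit_vectors_eq_iff_inner[OF e(1) v(1)] by simp
    then have "w \<in> U" using \<delta>0(3)[OF \<delta>(1,2)] v(2) by simp
    then show False using \<open>w \<notin> U\<close> by simp
  qed
  then show ?thesis using that[of "- e"] e(1) unfolding d_def by simp
qed

lemma superdifferential_supergrad_AE:
  assumes "eikonal \<Omega> k0 d" "\<And>t. t \<in> I \<Longrightarrow> x t \<in> \<Omega>"
  shows "(AE t in lebesgue. t \<in> I \<longrightarrow> (\<exists>v\<in>superdifferential \<Omega> d (x t). (x has_vector_derivative v) (at t within I))) \<longleftrightarrow>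
    (AE t in lebesgue. t \<in> I \<longrightarrow> (\<exists>v. eikonal.supergrad d (x t) v \<and> (x has_vector_derivative v) (at t within I)))"
proof -
  interpret eikonal \<Omega> k0 d by fact
  have "(t \<in> I \<longrightarrow> (\<exists>v\<in>superdifferential \<Omega> d (x t). (x has_vector_derivative v) (at t within I))) \<longleftrightarrow>
      (t \<in> I \<longrightarrow> (\<exists>v. supergrad (x t) v \<and> (x has_vector_derivative v) (at t within I)))" for t
    using superdifferential_eq_supergrad[OF assms(2), of t] by auto
  then show ?thesis by simp
qed

theorem theorem3:
  fixes U K :: "(real ^ 'n) set" and k0 :: "real ^ 'n"
  assumes "open U" and "connected U" and "bounded U" and "C2_boundary U"
    and "K = closure U"
    and "connected (- K)"
    and "k0 \<in> - K"
  shows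
    "(\<forall>x0. x0 \<in> singular_set K k0 \<inter> ((convex hull K) - K) \<and> x0 \<noteq> k0 \<longrightarrow>
        (\<exists>\<sigma>>0. \<exists>x :: real \<Rightarrow> real ^ 'n.
           (\<exists>L. L-lipschitz_on {0..<\<sigma>} x) \<and>
           (\<forall>t\<in>{0..<\<sigma>}. x t \<in> singular_set K k0) \<and>
           x 0 = x0 \<and>
           (\<forall>t\<in>{0<..<\<sigma>}. x t \<noteq> x0)))
     \<and>
     (\<forall>x0. x0 \<in> singular_set K k0 - (convex hull K) \<and> x0 \<noteq> k0 \<longrightarrow>
        (\<exists>x :: real \<Rightarrow> real ^ 'n.
           inclusion_solution K k0 x0 \<infinity> x \<and>
           (\<forall>T y. inclusion_solution K k0 x0 T y \<longrightarrow>
              (\<forall>t. 0 \<le> t \<and> ereal t < T \<longrightarrow> y t = x t)) \<and>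
           (\<forall>t\<ge>0. x t \<in> singular_set K k0) \<and>
           strict_mono_on {0..} (\<lambda>t. obstacle_dist K k0 (x t)) \<and>
           inj_on x {0..} \<and>
           \<not> bounded (x ` {0..})))"
proof -
  define d where "d = obstacle_dist K k0"
  have cK: "closed K" using assms(5) by simp
  have eik: "eikonal (- K) k0 d" unfolding d_def by (rule eikonal_obstacle_dist[OF cK assms(6,7)])
  interpret E: eikonal "- K" k0 d by (rule eik)
  have sing_iff: "x \<in> singular_set K k0 \<longleftrightarrow> E.singular x" if "x \<in> - K" "x \<noteq> k0" for x
    using that closure_subset[of "- K"] unfolding singular_set_def E.singular_def d_def[symmetric] by auto
  have opn: "open (- K - {k0})" using cK by (intro open_Diff) auto
  have part1: "\<exists>\<sigma>>0. \<exists>x :: real \<Rightarrow> real ^ 'n. (\<exists>L. L-lipschitz_on {0..<\<sigma>} x) \<and>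
      (\<forall>t\<in>{0..<\<sigma>}. x t \<in> singular_set K k0) \<and> x 0 = x0 \<and> (\<forall>t\<in>{0<..<\<sigma>}. x t \<noteq> x0)"
    if x0: "x0 \<in> singular_set K k0 \<inter> ((convex hull K) - K)" "x0 \<noteq> k0" for x0
  proof -
    have "x0 \<in> - K - {k0}" using x0 by auto
    then obtain r0 where r0: "r0 > 0" "cball x0 r0 \<subseteq> - K - {k0}" using opn open_contains_cball by blast
    define r where "r = r0 / 2"
    have r: "r > 0" "cball x0 (2 * r) \<subseteq> - K - {k0}" using r0 by (auto simp: r_def)
    have cb: "cball x0 r \<subseteq> - K - {k0}" using r by (intro cball_subset_double[OF r(2)]) auto
    have sing: "E.singular x0" using x0 sing_iff by auto
    have "K \<noteq> {}" using x0 by auto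
    obtain \<theta> where "norm \<theta> = 1" "\<theta> \<notin> E.bdirs r x0"
      using nearest_direction_not_minimal[OF assms(1,4,5) \<open>K \<noteq> {}\<close> assms(6,7) cb r(1) sing[unfolded d_def]]
      unfolding d_def by blast
    from E.singular_arc[OF r(2,1) sing this]
    obtain \<sigma> L and x :: "real \<Rightarrow> real ^ 'n" where x: "\<sigma> > 0" "L-lipschitz_on {0..<\<sigma>} x" "x 0 = x0"
      "\<And>t. t \<in> {0..<\<sigma>} \<Longrightarrow> x t \<in> cball x0 r \<and> E.singular (x t)" "\<And>t. t \<in> {0<..<\<sigma>} \<Longrightarrow> x t \<noteq> x0"
      by metis
    have "x t \<in> singular_set K k0" if "t \<in> {0..<\<sigma>}" for t
    proof -
      have "x t \<in> - K - {k0}" using x(4)[OF that] cb by blast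
      then show ?thesis using x(4)[OF that] sing_iff[of "x t"] by blast
    qed
    then show ?thesis using x by blast
  qed
  have part2: "\<exists>x :: real \<Rightarrow> real ^ 'n.
           inclusion_solution K k0 x0 \<infinity> x \<and>
           (\<forall>T y. inclusion_solution K k0 x0 T y \<longrightarrow> (\<forall>t. 0 \<le> t \<and> ereal t < T \<longrightarrow> y t = x t)) \<and>
           (\<forall>t\<ge>0. x t \<in> singular_set K k0) \<and>
           strict_mono_on {0..} (\<lambda>t. obstacle_dist K k0 (x t)) \<and>
           inj_on x {0..} \<and> \<not> bounded (x ` {0..})"
    if x0: "x0 \<in> singular_set K k0 - (convex hull K)" "x0 \<noteq> k0" for x0
  proof -
    have x0K: "x0 \<in> - K" using x0 hull_subset[of K convex] by auto
    have sing: "E.singular x0" using x0 x0K sing_iff by auto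
    have "compact K" using assms(3,5) by simp
    then have "closed (convex hull K)" by (intro compact_imp_closed compact_convex_hull)
    then obtain a b where ab: "a \<bullet> x0 < b" "\<And>y. y \<in> convex hull K \<Longrightarrow> b < a \<bullet> y"
      using separating_hyperplane_closed_point[OF convex_convex_hull, of K x0] x0 by blast
    \<comment> \<open>Scales the separating functional to norm at most one; the sign in
      \<open>\<nu>\<close> makes the obstacle lie below the level \<open>c\<close>.\<close>
    define s where "s = 1 / (norm a + 1)"
    have s: "s > 0" by (simp add: s_def add_nonneg_pos)
    define \<nu> where "\<nu> = - (s *\<^sub>R a)"
    define c where "c = - (s * b)"
    have nu: "norm \<nu> \<le> 1" using s by (simp add: \<nu>_def s_def divide_le_eq add_nonneg_pos)
    have nx0: "c < \<nu> \<bullet> x0" using ab(1) s by (simp add: \<nu>_def c_def)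
    have half: "y \<in> - K" if "c < \<nu> \<bullet> y" for y
    proof
      assume "y \<in> K"
      then have "b < a \<bullet> y" using hull_subset[of K convex] by (intro ab(2)) auto
      then show False using that s by (simp add: \<nu>_def c_def)
    qed
    obtain r1 where r1: "r1 > 0" "cball x0 r1 \<subseteq> - K - {k0}"
      using opn x0K x0(2) open_contains_cball by (metis Diff_iff singletonD)
    obtain r2 where r2: "r2 > 0" "cball k0 r2 \<subseteq> - K" using E.open_dom assms(7) open_contains_cball by blast
    have dx0: "0 < d x0" using E.d_pos x0K x0(2) by blast
    \<comment> \<open>Division by three makes the inequalities for \<open>2 * r\<close> strict;
      \<open>r1\<close> and \<open>r2\<close> provide the balls around \<open>x0\<close> and
      \<open>k0\<close>.\<close>
    define r where "r = min (min r1 (r2 / 2)) (min ((\<nu> \<bullet> x0 - c) / 3) (d x0 / 3))"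
    have r: "r > 0" "r \<le> r1" "2 * r \<le> r2" "2 * r < \<nu> \<bullet> x0 - c" "2 * r < d x0"
    proof -
      show "r > 0" using r1(1) r2(1) nx0 dx0 by (simp add: r_def)
      have "r \<le> min r1 (r2 / 2)" "r \<le> min ((\<nu> \<bullet> x0 - c) / 3) (d x0 / 3)"
        unfolding r_def by (rule min.cobounded1, rule min.cobounded2)
      then have le: "r \<le> r1" "r \<le> r2 / 2" "r \<le> (\<nu> \<bullet> x0 - c) / 3" "r \<le> d x0 / 3"
        by (simp_all only: min.bounded_iff)
      show "r \<le> r1" "2 * r \<le> r2" using le(1,2) by simp_all
      show "2 * r < \<nu> \<bullet> x0 - c" using le(3) nx0 \<open>r > 0\<close> by simp
      show "2 * r < d x0" using le(4) dx0 \<open>r > 0\<close> by simp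
    qed
    have cb: "cball x0 r \<subseteq> - K - {k0}" using r1(2) subset_cball[OF r(2)] by blast
    obtain p0 where p0: "p0 \<in> convex hull (E.bdirs r x0)" "norm p0 < 1" by (rule E.singularE_hull[OF cb r(1) sing])
    have "cball k0 (2 * r) \<subseteq> - K" using r2(2) subset_cball[OF r(3)] by blast
    then interpret F: halfspace_flow "- K" k0 d \<nu> x0 p0 c r
      using nu half r p0 by unfold_locales
    obtain x where x: "x 0 = x0" "1-lipschitz_on {0..} x"
      "\<And>t. 0 \<le> t \<Longrightarrow> x t \<in> F.region" "\<And>t. 0 \<le> t \<Longrightarrow> E.singular (x t)"
      "\<And>s t. 0 \<le> s \<Longrightarrow> s \<le> t \<Longrightarrow> (t - s) * ((\<nu> \<bullet> x0 - c) / d (x t)) \<le> \<nu> \<bullet> x t - \<nu> \<bullet> x s"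
      "\<And>s t. 0 \<le> s \<Longrightarrow> s \<le> t \<Longrightarrow> (t - s) * (((\<nu> \<bullet> x0 - c) / d (x t))\<^sup>2 / 2) \<le> d (x t) - d (x s)"
      "F.evi x" using F.flow_exists by metis
    have xO: "x t \<in> - K - {k0}" if "0 \<le> t" for t
      using F.region_cball'[OF x(3)[OF that]] r(1) by (meson centre_in_cball less_imp_le subsetD)
    have "AE t in lebesgue. 0 \<le> t \<longrightarrow> (\<exists>v. (x has_vector_derivative v) (at t within {0..}) \<and> norm v \<le> 1)"
      by (rule lipschitz_AE_has_vector_derivative[OF x(2)])
    then have AEx: "AE t in lebesgue. 0 \<le> t \<longrightarrow> (\<exists>v. E.supergrad (x t) v \<and> (x has_vector_derivative v) (at t within {0..}))"
    proof eventually_elim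
      case (elim t)
      then show ?case using F.evi_imp_supergrad[OF x(7), of t] xO[of t] by blast
    qed
    have I: "{t. 0 \<le> t \<and> ereal t < \<infinity>} = {0..}" by auto
    have sol: "inclusion_solution K k0 x0 \<infinity> x"
      unfolding inclusion_solution_def Let_def I
    proof (intro conjI ballI)
      show "x t \<in> - (K \<union> {k0})" if "t \<in> {0..}" for t using xO[of t] that by auto
      have "AE t in lebesgue. t \<in> {0..} \<longrightarrow> (\<exists>v. E.supergrad (x t) v \<and> (x has_vector_derivative v) (at t within {0..}))"
        using AEx by simp
      then show "AE t in lebesgue. t \<in> {0..} \<longrightarrow>
          (\<exists>v\<in>superdifferential (- K) (obstacle_dist K k0) (x t). (x has_vector_derivative v) (at t within {0..}))"
        using superdifferential_supergrad_AE[OF eik, of "{0..}" x] xO unfolding d_def by auto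
    qed (use x in blast)+
    have uniq: "y t = x t" if y: "inclusion_solution K k0 x0 T y" and t: "0 \<le> t \<and> ereal t < T" for T y t
    proof -
      define J where "J = {t. 0 \<le> t \<and> ereal t < T}"
      obtain L where yL: "y 0 = x0" "L-lipschitz_on J y" "\<And>t. t \<in> J \<Longrightarrow> y t \<in> - (K \<union> {k0})"
        "AE t in lebesgue. t \<in> J \<longrightarrow> (\<exists>v\<in>superdifferential (- K) d (y t). (y has_vector_derivative v) (at t within J))"
        using y unfolding inclusion_solution_def Let_def J_def[symmetric] d_def by blast
      have yK: "y t \<in> - K" if "t \<in> J" for t using yL(3)[OF that] by simp
      have AEy: "AE t in lebesgue. t \<in> J \<longrightarrow> (\<exists>v. E.supergrad (y t) v \<and> (y has_vector_derivative v) (at t within J))"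
        using yL(4) superdifferential_supergrad_AE[OF eik yK, of J] by simp
      show ?thesis
      proof (rule F.flow_unique[OF x(2,3) AEx yL(2) _ _ AEy])
        show "J \<subseteq> {0..}" by (auto simp: J_def)
        show "s' \<in> J" if "t' \<in> J" "0 \<le> s'" "s' \<le> t'" for s' t'
          using that unfolding J_def by (auto intro: le_less_trans[of "ereal s'" "ereal t'"])
        show "x 0 = y 0" using x(1) yL(1) by simp
        show "t \<in> J" using t by (simp add: J_def)
      qed
    qed
    have mono: "strict_mono_on {0..} (\<lambda>t. obstacle_dist K k0 (x t))"
    proof (rule strict_mono_onI)
      fix s t :: real assume st: "s \<in> {0..}" "t \<in> {0..}" "s < t"
      have "0 < d (x t)" using E.d_pos xO[of t] st by auto
      then have "0 < (t - s) * (((\<nu> \<bullet> x0 - c) / d (x t))\<^sup>2 / 2)"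
        using st nx0 by (intro mult_pos_pos divide_pos_pos zero_less_power) auto
      then show "obstacle_dist K k0 (x s) < obstacle_dist K k0 (x t)"
        using x(6)[of s t] st unfolding d_def by auto
    qed
    have inj: "inj_on x {0..}"
    proof (rule inj_onI)
      fix s t assume st: "s \<in> {0..}" "t \<in> {0..}" "x s = x t"
      then show "s = t"
        using strict_mono_onD[OF mono, of s t] strict_mono_onD[OF mono, of t s] by (cases s t rule: linorder_cases) auto
    qed
    have "\<not> bounded (x ` {0..})"
      using x(5)[of 0] x(1) by (intro F.d_flow_unbounded x(3)) auto
    moreover have "x t \<in> singular_set K k0" if "0 \<le> t" for t
      using sing_iff[of "x t"] xO[OF that] x(4)[OF that] by auto
    ultimately show ?thesis using sol uniq mono inj by blast
  qed
  show ?thesis using part1 part2 by blast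
qed

end
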